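(* Suppose $\mathfrak{a}\in\widetilde{\mathcal{E}}(\mathbb{R}_+,V(\mathbb{R}))$ satisfies $$\mathfrak{a}(t,\pm\infty)\ne 0\ \text{ for all } t\in\mathbb{R}_+,\qquad \mathfrak{a}(\xi,x)\ne 0\ \text{ for all } (\xi,x)\in\Delta\times\overline{\mathbb{R}},$$ and let $r>1$ be a number such that $$\sup_{(t,x)\in T_r\times\overline{\mathbb{R}}}\left|\frac1{\mathfrak{a}(t,x)}\right|<\infty,\qquad T_r:=(0,r^{-1}]\cup[r,\infty).$$ For $t\in[r^{-1},r]$ put $$\ell_\pm(t):=\frac{\ln r\pm\ln t}{2\ln r},\qquad c_\pm(t):=\frac1{\mathfrak{a}(t,\pm\infty)}-\frac{\ell_-(t)}{\mathfrak{a}(r^{-1},\pm\infty)}-\frac{\ell_+(t)}{\mathfrak{a}(r,\pm\infty)},$$ let $p_\pm(x):=(1\pm\tanh(\pi x))/2$ for $x\in\mathbb{R}$, extended by their limits to $x=\pm\infty$, and define $$\mathfrak{b}(t,x):=\begin{cases}\dfrac1{\mathfrak{a}(t,x)}, & (t,x)\in(\mathbb{R}_+\setminus[r^{-1},r])\times\overline{\mathbb{R}},\\[3mm] \dfrac{\ell_-(t)}{\mathfrak{a}(r^{-1},x)}+\dfrac{\ell_+(t)}{\mathfrak{a}(r,x)}+c_-(t)p_-(x)+c_+(t)p_+(x), & (t,x)\in[r^{-1},r]\times\overline{\mathbb{R}}.\end{cases}$$ Then $\mathfrak{b}\in\widetilde{\mathcal{E}}(\mathbb{R}_+,V(\mathbb{R}))$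 and $$\mathfrak{b}(t,\pm\infty)=1/\mathfrak{a}(t,\pm\infty)\ \text{ for all } t\in\mathbb{R}_+,\qquad \mathfrak{b}(\xi,x)=1/\mathfrak{a}(\xi,x)\ \text{ for all } (\xi,x)\in\Delta\times\overline{\mathbb{R}}.$$
   Context: All functions are complex-valued; $\mathbb{R}_+=(0,\infty)$, $\overline{\mathbb{R}}=[-\infty,+\infty]$, $\overline{\mathbb{R}}_+=[0,+\infty]$. $V(\mathbb{R})$ is the Banach algebra of all absolutely continuous functions $a$ on $\mathbb{R}$ of finite total variation $V(a):=\int_{\mathbb{R}}|a'(x)|\,dx$, with norm $\|a\|_V:=\|a\|_{L^\infty(\mathbb{R})}+V(a)$. Each $a\in V(\mathbb{R})$ has finite limits $a(\pm\infty)$. $C_b(\mathbb{R}_+,V(\mathbb{R}))$ is the Banach algebra of all bounded (norm-)continuous $V(\mathbb{R})$-valued functions $t\mapsto\mathfrak{a}(t,\cdot)$ on $\mathbb{R}_+$ with norm $\sup_{t\in\mathbb{R}_+}\|\mathfrak{a}(t,\cdot)\|_V$. Its elements are regarded as functions $\mathfrak{a}(t,x)$ on $\mathbb{R}_+\times\mathbb{R}$, and $\mathfrak{a}(t,\pm\infty)$ denotes the limit of $\mathfrak{a}(t,x)$ as $x\to\pm\infty$. $SO(\mathbb{R}_+,V(\mathbb{R}))$ is the set of $\mathfrak{a}\in C_b(\mathbb{R}_+,V(\mathbb{R}))$ such that $\lim_{r\to s}\max\{\|\mathfrak{a}(t,\cdot)-\mathfrak{a}(\tau,\cdot)\|_{L^\infty(\mathbb{R})}: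 t,\tau\in[r,2r]\}=0$ for $s\in\{0,\infty\}$. $\mathcal{E}(\mathbb{R}_+,V(\mathbb{R}))$ is the set of $\mathfrak{a}\in SO(\mathbb{R}_+,V(\mathbb{R}))$ such that $\lim_{|h|\to0}\sup_{t\in\mathbb{R}_+}\|\mathfrak{a}(t,\cdot)-\mathfrak{a}^h(t,\cdot)\|_V=0$, where $\mathfrak{a}^h(t,x):=\mathfrak{a}(t,x+h)$. $\widetilde{\mathcal{E}}(\mathbb{R}_+,V(\mathbb{R}))$ is the set of $\mathfrak{a}\in\mathcal{E}(\mathbb{R}_+,V(\mathbb{R}))$ such that $\lim_{m\to\infty}\sup_{t\in\mathbb{R}_+}\int_{\mathbb{R}\setminus[-m,m]}|\partial_x\mathfrak{a}(t,x)|\,dx=0$. $SO(\mathbb{R}_+)$ is the $C^*$-algebra of bounded continuous functions $f$ on $\mathbb{R}_+$ with $\lim_{r\to s}\max_{t,\tau\in[r,2r]}|f(t)-f(\tau)|=0$ for $s\in\{0,\infty\}$. $M(SO(\mathbb{R}_+))$ is its maximal ideal space (nonzero multiplicative linear functionals) with the Gelfand topology. For $s\in\{0,\infty\}$, $M_s(SO(\mathbb{R}_+)):=\{\xi\in M(SO(\mathbb{R}_+)): \xi(f)=f(s)\text{ for all }f\in C(\overline{\mathbb{R}}_+)\}$, and $\Delta:=M_0(SO(\mathbb{R}_+))\cup M_\infty(SO(\mathbb{R}_+))$. Values on $\Delta$: for $\mathfrak{a}\in\mathcal{E}(\mathbb{R}_+,V(\mathbb{R}))$ and $x\in\overline{\mathbb{R}}$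 the function $t\mapsto\mathfrak{a}(t,x)$ belongs to $SO(\mathbb{R}_+)$, and for $\xi\in\Delta$ one puts $\mathfrak{a}(\xi,x):=\xi(\mathfrak{a}(\cdot,x))$. For any countable family of symbols $\mathfrak{a}_k$ in $\mathcal{E}(\mathbb{R}_+,V(\mathbb{R}))$ and any $\xi\in M_s(SO(\mathbb{R}_+))$ there is a sequence $t_j\to s$ in $\mathbb{R}_+$ with $\mathfrak{a}_k(\xi,x)=\lim_j\mathfrak{a}_k(t_j,x)$ for all $x\in\overline{\mathbb{R}}$ and all $k$. A number $r$ as in the claim exists under the stated non-vanishing hypotheses. *)

theory Defs
  imports "HOL-Analysis.Analysis" "HOL-Probability.Essential_Supremum"
begin

section \<open>The Banach algebra \<open>V(\<real>)\<close>\<close>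

text \<open>Absolute continuity in the classical epsilon-delta sense. Degenerate intervals
  \<open>l k = u k\<close> are admitted; they contribute nothing to either sum.\<close>

definition abs_continuous_on :: "real set \<Rightarrow> (real \<Rightarrow> complex) \<Rightarrow> bool" where
  "abs_continuous_on S f \<longleftrightarrow>
     (\<forall>\<epsilon>>0. \<exists>\<delta>>0. \<forall>(n::nat) l u.
        (\<forall>k<n. l k \<le> u k \<and> {l k..u k} \<subseteq> S) \<longrightarrow>
        disjoint_family_on (\<lambda>k. {l k<..<u k}) {..<n} \<longrightarrow>
        (\<Sum>k<n. u k - l k) < \<delta> \<longrightarrow>
        (\<Sum>k<n. norm (f (u k) - f (l k))) < \<epsilon>)"

text \<open>An absolutely continuous function is differentiable almost everywhere, so the arbitrary
  value of \<^const>\<open>vector_derivative\<close> at the remaining points does not matter.\<close>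

definition V_space :: "(real \<Rightarrow> complex) set" where
  "V_space = {f. abs_continuous_on UNIV f \<and> integrable lebesgue (\<lambda>x. vector_derivative f (at x))}"

definition V_variation :: "(real \<Rightarrow> complex) \<Rightarrow> real" where
  "V_variation f = (LINT x|lebesgue. norm (vector_derivative f (at x)))"

definition Linf_norm :: "(real \<Rightarrow> complex) \<Rightarrow> real" where
  "Linf_norm f = real_of_ereal (esssup lebesgue (\<lambda>x. ereal (norm (f x))))"

definition V_norm :: "(real \<Rightarrow> complex) \<Rightarrow> real" where
  "V_norm f = Linf_norm f + V_variation f"

text \<open>The continuation of a function on \<open>\<real>\<close> to \<open>[-\<infinity>, \<infinity>]\<close> by its limits.\<close>

definition ext_infty :: "(real \<Rightarrow> complex) \<Rightarrow> ereal \<Rightarrow> complex" where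
  "ext_infty f x = (case x of ereal y \<Rightarrow> f y | PInfty \<Rightarrow> Lim at_top f | MInfty \<Rightarrow> Lim at_bot f)"


section \<open>Algebras of symbols on \<open>\<real>\<^sub>+ \<times> \<real>\<close>\<close>

text \<open>A symbol is a function \<open>real \<Rightarrow> real \<Rightarrow> complex\<close> of which only the values at
  \<open>t > 0\<close> are relevant.\<close>

definition Cb_V :: "(real \<Rightarrow> real \<Rightarrow> complex) set" where
  "Cb_V = {a. (\<forall>t>0. a t \<in> V_space) \<and>
              bdd_above ((\<lambda>t. V_norm (a t)) ` {0<..}) \<and>
              (\<forall>t>0. ((\<lambda>\<tau>. V_norm (\<lambda>x. a \<tau> x - a t x)) \<longlongrightarrow> 0) (at t within {0<..}))}"

definition SO_V :: "(real \<Rightarrow> real \<Rightarrow> complex) set" where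
  "SO_V = {a \<in> Cb_V. \<forall>F \<in> {at_right 0, at_top}.
     ((\<lambda>r. SUP (t, \<tau>) \<in> {r..2 * r} \<times> {r..2 * r}. Linf_norm (\<lambda>x. a t x - a \<tau> x)) \<longlongrightarrow> 0) F}"

definition E_V :: "(real \<Rightarrow> real \<Rightarrow> complex) set" where
  "E_V = {a \<in> SO_V. ((\<lambda>h. SUP t\<in>{0<..}. V_norm (\<lambda>x. a t x - a t (x + h))) \<longlongrightarrow> 0) (at 0)}"

definition E_tilde_V :: "(real \<Rightarrow> real \<Rightarrow> complex) set" where
  "E_tilde_V = {a \<in> E_V.
     ((\<lambda>m. SUP t\<in>{0<..}. LINT x:UNIV - {-m..m}|lebesgue. norm (vector_derivative (a t) (at x)))
        \<longlongrightarrow> 0) at_top}"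


section \<open>Slowly oscillating functions and the set \<open>\<Delta>\<close>\<close>

definition SO :: "(real \<Rightarrow> complex) set" where
  "SO = {f. continuous_on {0<..} f \<and> bounded (f ` {0<..}) \<and>
     (\<forall>F \<in> {at_right 0, at_top}.
        ((\<lambda>r. SUP (t, \<tau>) \<in> {r..2 * r} \<times> {r..2 * r}. norm (f t - f \<tau>)) \<longlongrightarrow> 0) F)}"

text \<open>The first condition makes \<open>\<xi>\<close> a functional on functions on \<open>\<real>\<^sub>+\<close>, although the
  elements of \<^const>\<open>SO\<close> are functions on the whole of \<open>real\<close>.\<close>

definition M_SO :: "((real \<Rightarrow> complex) \<Rightarrow> complex) set" where
  "M_SO = {\<xi>.
     (\<forall>f\<in>SO. \<forall>g\<in>SO. (\<forall>t>0. f t = g t) \<longrightarrow> \<xi> f = \<xi> g) \<and>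
     (\<forall>f\<in>SO. \<forall>g\<in>SO. \<xi> (\<lambda>t. f t + g t) = \<xi> f + \<xi> g) \<and>
     (\<forall>c. \<forall>f\<in>SO. \<xi> (\<lambda>t. c * f t) = c * \<xi> f) \<and>
     (\<forall>f\<in>SO. \<forall>g\<in>SO. \<xi> (\<lambda>t. f t * g t) = \<xi> f * \<xi> g) \<and>
     (\<exists>f\<in>SO. \<xi> f \<noteq> 0)}"

definition M_SO_fiber :: "ereal \<Rightarrow> ((real \<Rightarrow> complex) \<Rightarrow> complex) set" where
  "M_SO_fiber s = {\<xi> \<in> M_SO. \<forall>f :: ereal \<Rightarrow> complex.
     continuous_on {0..\<infinity>} f \<longrightarrow> \<xi> (\<lambda>t. f (ereal t)) = f s}"

definition Delta :: "((real \<Rightarrow> complex) \<Rightarrow> complex) set" where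
  "Delta = M_SO_fiber 0 \<union> M_SO_fiber \<infinity>"


section \<open>The regularizing symbol\<close>

definition T_set :: "real \<Rightarrow> real set" where
  "T_set r = {0<..inverse r} \<union> {r..}"

definition ell_minus :: "real \<Rightarrow> real \<Rightarrow> real" where
  "ell_minus r t = (ln r - ln t) / (2 * ln r)"

definition ell_plus :: "real \<Rightarrow> real \<Rightarrow> real" where
  "ell_plus r t = (ln r + ln t) / (2 * ln r)"

text \<open>The coefficients \<open>c\<^sub>-\<close> and \<open>c\<^sub>+\<close> are the values at \<open>x = -\<infinity>\<close> and \<open>x = \<infinity>\<close>.\<close>

definition c_coeff :: "(real \<Rightarrow> real \<Rightarrow> complex) \<Rightarrow> real \<Rightarrow> ereal \<Rightarrow> real \<Rightarrow> complex" where
  "c_coeff a r x t = 1 / ext_infty (a t) x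
     - of_real (ell_minus r t) / ext_infty (a (inverse r)) x
     - of_real (ell_plus r t) / ext_infty (a r) x"

definition p_minus :: "real \<Rightarrow> complex" where
  "p_minus x = of_real ((1 - tanh (pi * x)) / 2)"

definition p_plus :: "real \<Rightarrow> complex" where
  "p_plus x = of_real ((1 + tanh (pi * x)) / 2)"

definition b_symbol :: "(real \<Rightarrow> real \<Rightarrow> complex) \<Rightarrow> real \<Rightarrow> real \<Rightarrow> ereal \<Rightarrow> complex" where
  "b_symbol a r t x =
     (if t \<in> {inverse r..r} then
        of_real (ell_minus r t) / ext_infty (a (inverse r)) x
        + of_real (ell_plus r t) / ext_infty (a r) x
        + c_coeff a r (-\<infinity>) t * ext_infty p_minus x
        + c_coeff a r \<infinity> t * ext_infty p_plus x
      else 1 / ext_infty (a t) x)"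

end

theory Submission
  imports Defs
begin

text \<open>
  The symbol \<open>\<bb>\<close> is built by an algebra of symbols. Outside \<open>[1/r, r]\<close> it equals \<open>1/\<aa>\<close>, inside it
  interpolates between the two boundary symbols, and both regimes are given by a single formula.
  Let \<open>\<kappa>(t)\<close> be the point of \<open>[1/r, r]\<close> closest to \<open>t\<close>. At \<open>t = 1/r\<close> the pair
  \<open>(\<ell>\<^sub>-, \<ell>\<^sub>+)\<close> is \<open>(1, 0)\<close>, at \<open>t = r\<close> it is \<open>(0, 1)\<close>, and \<open>c\<^sub>\<plusminus>\<close> vanish at both points. Hence,
  for every \<open>t > 0\<close>,
  \<open>\<bb>(t, x) = \<ell>\<^sub>-(\<kappa>(t)) / \<aa>(min t (1/r), x) + \<ell>\<^sub>+(\<kappa>(t)) / \<aa>(max t r, x)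
     + c\<^sub>-(\<kappa>(t)) p\<^sub>-(x) + c\<^sub>+(\<kappa>(t)) p\<^sub>+(x)\<close>.

  It therefore suffices that \<^const>\<open>E_tilde_V\<close> is closed under sums and products
  (\<open>E_tilde_V_add\<close>, \<open>E_tilde_V_mult\<close>), under reciprocals of symbols bounded away from zero
  (\<open>E_tilde_V_inverse\<close>) and under the changes of variable \<open>t \<mapsto> min t (1/r)\<close> and \<open>t \<mapsto> max t r\<close>, which
  near each end of \<open>(0, \<infinity>)\<close> are the identity or constant (\<open>E_tilde_V_reparametrize\<close>), and that it
  contains the slowly oscillating functions of \<open>t\<close> alone (\<open>SO_imp_scalar_symbol\<close>) and the functions
  \<open>p\<^sub>\<plusminus>\<close> of \<open>x\<close> alone (\<open>p_plus_symbol\<close>, \<open>p_minus_symbol\<close>). Each closure property reduces to the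
  Banach algebra inequalities in \<open>V(\<real>)\<close>.

  Those inequalities, the identification of the essential supremum with the supremum, and the
  existence of limits at \<open>\<plusminus>\<infinity>\<close> all rest on two classical facts about an absolutely continuous
  function \<open>f\<close>: it is differentiable almost everywhere, and \<open>f(b) - f(a) = \<integral> f'\<close>. The first follows
  from Lebesgue's theorem on monotone functions, proved here with the Vitali covering theorem; the
  second is a Henstock--Kurzweil gauge argument.

  For the values on \<open>\<Delta>\<close>: for each \<open>x\<close> the product \<open>\<aa>(t, x) \<bb>(t, x)\<close> equals \<open>1\<close> outside \<open>[1/r, r]\<close>.
  A functional \<open>\<xi> \<in> \<Delta>\<close> annihilates every slowly oscillating function supported in a compact subset
  of \<open>(0, \<infinity>)\<close>, so \<open>\<xi>(\<aa>(\<cdot>, x)) \<xi>(\<bb>(\<cdot>, x)) = 1\<close> (\<open>Delta_reciprocal\<close>).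
\<close>


section \<open>Monotone functions are differentiable almost everywhere\<close>

text \<open>
  The Vitali covering theorem in the form used here: the covering intervals may contain the point
  anywhere, and they are selected by a predicate on their endpoints.
\<close>

lemma Vitali_covering_intervals:
  fixes E :: "real set" and P :: "real \<Rightarrow> real \<Rightarrow> bool"
  assumes "\<And>x d. x \<in> E \<Longrightarrow> 0 < d \<Longrightarrow> \<exists>l u. l \<le> x \<and> x \<le> u \<and> l < u \<and> u - l < d \<and> P l u"
  obtains C where "countable C" "\<And>l u. (l, u) \<in> C \<Longrightarrow> l < u \<and> P l u"
    "pairwise (\<lambda>i j. disjnt {fst i..snd i} {fst j..snd j}) C"
    "negligible (E - (\<Union>(l, u)\<in>C. {l..u}))"
proof -
  define K where "K = {(l, u). l < u \<and> P l u}"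
  let ?a = "\<lambda>i::real \<times> real. (fst i + snd i) / 2" and ?r = "\<lambda>i::real \<times> real. (snd i - fst i) / 2"
  have cb: "cball (?a i) (?r i) = {fst i..snd i}" for i
    by (simp add: cball_eq_atLeastAtMost field_simps)
  have K: "\<exists>i. i \<in> K \<and> x \<in> cball (?a i) (?r i) \<and> ?r i < d" if xd: "x \<in> E" "0 < d" for x d
  proof -
    obtain l u where "l \<le> x" "x \<le> u" "l < u" "u - l < d" "P l u"
      using assms[OF xd] by blast
    then show ?thesis
      using cb[of "(l, u)"] xd by (intro exI[of _ "(l, u)"]) (auto simp: K_def simp del: mem_cball)
  qed
  have pos: "0 < ?r i" if "i \<in> K" for i
    using that by (auto simp: K_def)
  obtain C where C: "countable C" "C \<subseteq> K"
     "pairwise (\<lambda>i j. disjnt (cball (?a i) (?r i)) (cball (?a j) (?r j))) C"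
     "negligible (E - (\<Union>i \<in> C. cball (?a i) (?r i)))"
    using Vitali_covering_theorem_cballs[where K=K and a="?a" and r="?r" and S=E, OF pos K] by blast
  show thesis
  proof
    show "countable C" by fact
    show "\<And>l u. (l, u) \<in> C \<Longrightarrow> l < u \<and> P l u" using C(2) by (auto simp: K_def)
    show "pairwise (\<lambda>i j. disjnt {fst i..snd i} {fst j..snd j}) C" using C(3) by (simp add: cb)
    show "negligible (E - (\<Union>(l, u)\<in>C. {l..u}))"
      using C(4) by (simp add: cb case_prod_unfold)
  qed
qed

text \<open>
  Induction on the number of intervals, removing the one with the largest left endpoint: by
  disjointness all others end before it begins.
\<close>

lemma sum_increments_disjoint_le:
  fixes F :: "real \<Rightarrow> real"
  assumes "mono F" "finite C" "a \<le> b"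
    and "\<And>l u. (l, u) \<in> C \<Longrightarrow> a \<le> l \<and> l < u \<and> u \<le> b"
    and "pairwise (\<lambda>i j. disjnt {fst i..snd i} {fst j..snd j}) C"
  shows "(\<Sum>(l, u)\<in>C. F u - F l) \<le> F b - F a"
  using assms(2-)
proof (induction "card C" arbitrary: C b)
  case 0
  then show ?case using monoD[OF assms(1)] by simp
next
  case (Suc n)
  then have "C \<noteq> {}" by auto
  with Suc.prems have ne: "finite (fst ` C)" "fst ` C \<noteq> {}" by auto
  then obtain i where i: "i \<in> C" "fst i = Max (fst ` C)"
    by (metis (mono_tags, lifting) Max_in image_iff)
  have mx: "fst j \<le> fst i" if "j \<in> C" for j using that ne i by simp
  obtain l u where lu: "i = (l, u)" by (cases i)
  have *: "snd j \<le> l" if "j \<in> C - {i}" for j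
  proof (rule ccontr)
    assume "\<not> snd j \<le> l"
    then have "l \<in> {fst j..snd j}" "l \<in> {fst i..snd i}"
      using mx[of j] that Suc.prems(3)[of l u] i lu by auto
    moreover have "disjnt {fst i..snd i} {fst j..snd j}"
      using Suc.prems(4) i that unfolding pairwise_def by auto
    ultimately show False unfolding disjnt_def by blast
  qed
  have "(\<Sum>(l, u)\<in>C - {i}. F u - F l) \<le> F l - F a"
  proof (rule Suc.hyps(1))
    show "n = card (C - {i})" using Suc.hyps(2) i Suc.prems(1) by simp
    show "finite (C - {i})" using Suc.prems by simp
    show "a \<le> l" using Suc.prems(3) i lu by simp
    show "a \<le> l' \<and> l' < u' \<and> u' \<le> l" if "(l', u') \<in> C - {i}" for l' u'
      using Suc.prems(3)[of l' u'] *[OF that] that by auto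
    show "pairwise (\<lambda>i j. disjnt {fst i..snd i} {fst j..snd j}) (C - {i})"
      using Suc.prems(4) by (rule pairwise_subset) auto
  qed
  moreover have "F u \<le> F b"
    using Suc.prems(3)[of l u] i lu by (auto intro: monoD[OF assms(1)])
  moreover have "(\<Sum>(l, u)\<in>C. F u - F l) = (F u - F l) + (\<Sum>(l, u)\<in>C - {i}. F u - F l)"
    using Suc.prems(1) i lu by (subst sum.remove[of _ i]) auto
  ultimately show ?case by linarith
qed

text \<open>
  Cover the points by disjoint intervals on which \<open>F\<close> gains more than \<open>q\<close> times the length;
  all gains together are at most \<open>F b - F a\<close>. The conclusion is phrased with a measurable
  superset because the set of steep points is not known to be measurable.
\<close>

lemma steep_points_measure_le:
  fixes F :: "real \<Rightarrow> real"
  assumes "mono F" "0 < q" "E \<subseteq> {a<..<b}" "a \<le> b"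
    and steep: "\<And>x d. x \<in> E \<Longrightarrow> 0 < d \<Longrightarrow>
      \<exists>l u. l \<le> x \<and> x \<le> u \<and> l < u \<and> u - l < d \<and> q * (u - l) < F u - F l"
  obtains B where "B \<in> lmeasurable" "E \<subseteq> B" "measure lebesgue B \<le> (F b - F a) / q"
proof -
  have S: "\<exists>l u. l \<le> x \<and> x \<le> u \<and> l < u \<and> u - l < d \<and> (q * (u - l) < F u - F l \<and> a \<le> l \<and> u \<le> b)"
    if "x \<in> E" "0 < d" for x d
  proof -
    have "x \<in> {a<..<b}" using that assms(3) by auto
    then have "0 < min d (min (x - a) (b - x))" using that by auto
    from steep[OF \<open>x \<in> E\<close> this] obtain l u
      where "l \<le> x" "x \<le> u" "l < u" "u - l < min d (min (x - a) (b - x))" "q * (u - l) < F u - F l" by blast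
    then show ?thesis by (intro exI[of _ l] exI[of _ u]) auto
  qed
  obtain C where C: "countable C"
      "\<And>l u. (l, u) \<in> C \<Longrightarrow> l < u \<and> (q * (u - l) < F u - F l \<and> a \<le> l \<and> u \<le> b)"
    "pairwise (\<lambda>i j. disjnt {fst i..snd i} {fst j..snd j}) C"
    "negligible (E - (\<Union>(l, u)\<in>C. {l..u}))"
    using Vitali_covering_intervals[where P="\<lambda>l u. q * (u - l) < F u - F l \<and> a \<le> l \<and> u \<le> b", OF S]
    by blast
  let ?U = "\<Union>(l, u)\<in>C. {l..u}"
  have fin: "measure lebesgue (\<Union>i\<in>I. case i of (l, u) \<Rightarrow> {l..u}) \<le> (F b - F a) / q"
    if "I \<subseteq> C" "finite I" for I
  proof -
    have "measure lebesgue (\<Union>i\<in>I. case i of (l, u) \<Rightarrow> {l..u})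
        \<le> (\<Sum>i\<in>I. measure lebesgue (case i of (l, u) \<Rightarrow> {l..u}))"
      using that by (intro measure_UNION_le) auto
    also have "\<dots> \<le> (\<Sum>(l, u)\<in>I. (F u - F l) / q)"
    proof (rule sum_mono)
      fix i assume "i \<in> I"
      then obtain l u where "i = (l, u)" "(l, u) \<in> C" using \<open>I \<subseteq> C\<close> by (cases i) auto
      then show "measure lebesgue (case i of (l, u) \<Rightarrow> {l..u}) \<le> (case i of (l, u) \<Rightarrow> (F u - F l) / q)"
        using C(2)[of l u] \<open>0 < q\<close> by (simp add: field_simps)
    qed
    also have "\<dots> = (\<Sum>(l, u)\<in>I. F u - F l) / q"
      by (simp add: sum_divide_distrib case_prod_unfold)
    also have "(\<Sum>(l, u)\<in>I. F u - F l) \<le> F b - F a"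
      using that C by (intro sum_increments_disjoint_le assms) (auto intro: pairwise_subset)
    finally show ?thesis using \<open>0 < q\<close> by (simp add: divide_right_mono)
  qed
  have U: "?U \<in> lmeasurable" "measure lebesgue ?U \<le> (F b - F a) / q"
    using fmeasurable_UN_bound[OF C(1) _ fin] measure_UN_bound[OF C(1) _ fin] by auto
  show thesis
  proof
    let ?B = "?U \<union> (E - ?U)"
    have N: "E - ?U \<in> null_sets lebesgue" using C(4) by (simp add: negligible_iff_null_sets)
    show "?B \<in> lmeasurable"
      by (rule fmeasurable.Un[OF U(1) negligible_imp_measurable[OF C(4)]])
    show "E \<subseteq> ?B" by blast
    have "measure lebesgue ?B = measure lebesgue ?U"
      using U N by (intro measure_Un_null_set) auto
    then show "measure lebesgue ?B \<le> (F b - F a) / q" using U by simp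
  qed
qed


text \<open>
  The core of Lebesgue's theorem. In an open \<open>U \<supseteq> E\<close>, cover \<open>E\<close> by disjoint intervals on which
  the total gain of \<open>F\<close> is at most \<open>p\<close> times the measure of \<open>U\<close>; inside each of them the steep points
  have measure at most the gain divided by \<open>q\<close>. So \<open>E\<close> has a superset of measure at most
  \<open>(p / q) |U|\<close>. As \<open>U\<close> may be taken close to any measurable superset of \<open>E\<close>, the outer measure
  \<open>m\<close> of \<open>E\<close> satisfies \<open>m \<le> (p / q) m\<close>, which forces \<open>m = 0\<close>.
\<close>

lemma flat_steep_points_negligible:
  fixes F :: "real \<Rightarrow> real"
  assumes F: "mono F" and pq: "0 < p" "p < q" and E: "E \<subseteq> {a<..<b}"
    and flat: "\<And>x d. x \<in> E \<Longrightarrow> 0 < d \<Longrightarrow>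
      \<exists>l u. l \<le> x \<and> x \<le> u \<and> l < u \<and> u - l < d \<and> F u - F l < p * (u - l)"
    and steep: "\<And>x d. x \<in> E \<Longrightarrow> 0 < d \<Longrightarrow>
      \<exists>l u. l \<le> x \<and> x \<le> u \<and> l < u \<and> u - l < d \<and> q * (u - l) < F u - F l"
  shows "negligible E"
proof -
  have step: "\<exists>B \<in> lmeasurable. E \<subseteq> B \<and> measure lebesgue B \<le> p / q * measure lebesgue U"
    if U: "open U" "U \<in> lmeasurable" "E \<subseteq> U" for U
  proof -
    have S: "\<exists>l u. l \<le> x \<and> x \<le> u \<and> l < u \<and> u - l < d \<and> (F u - F l < p * (u - l) \<and> {l..u} \<subseteq> U)"
      if xd: "x \<in> E" "0 < d" for x d
    proof -
      obtain e where e: "0 < e" "ball x e \<subseteq> U" using U xd openE by blast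
      then have "0 < min d e" using xd by auto
      from flat[OF \<open>x \<in> E\<close> this] obtain l u
        where lu: "l \<le> x" "x \<le> u" "l < u" "u - l < min d e" "F u - F l < p * (u - l)" by blast
      then have "{l..u} \<subseteq> ball x e" by (auto simp: dist_real_def)
      with e lu show ?thesis by (intro exI[of _ l] exI[of _ u]) auto
    qed
    obtain C where C: "countable C"
        "\<And>l u. (l, u) \<in> C \<Longrightarrow> l < u \<and> (F u - F l < p * (u - l) \<and> {l..u} \<subseteq> U)"
      "pairwise (\<lambda>i j. disjnt {fst i..snd i} {fst j..snd j}) C"
      "negligible (E - (\<Union>(l, u)\<in>C. {l..u}))"
      using Vitali_covering_intervals[where P="\<lambda>l u. F u - F l < p * (u - l) \<and> {l..u} \<subseteq> U", OF S]
      by blast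
    have "\<exists>B. B \<in> lmeasurable \<and> E \<inter> {l<..<u} \<subseteq> B \<and> measure lebesgue B \<le> p / q * (u - l)"
      if lu: "(l, u) \<in> C" for l u
    proof -
      obtain B where B: "B \<in> lmeasurable" "E \<inter> {l<..<u} \<subseteq> B"
          "measure lebesgue B \<le> (F u - F l) / q"
        using steep_points_measure_le[of F q "E \<inter> {l<..<u}" l u] C(2)[OF lu] F pq steep by auto
      have "(F u - F l) / q \<le> p / q * (u - l)"
        using C(2)[OF lu] pq by (simp add: divide_right_mono)
      with B show ?thesis by (intro exI[of _ B]) linarith
    qed
    then have "\<forall>i\<in>C. \<exists>B. B \<in> lmeasurable \<and> E \<inter> {fst i<..<snd i} \<subseteq> B
        \<and> measure lebesgue B \<le> p / q * (snd i - fst i)"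
      by auto
    then obtain B where B: "\<And>i. i \<in> C \<Longrightarrow> B i \<in> lmeasurable"
      "\<And>i. i \<in> C \<Longrightarrow> E \<inter> {fst i<..<snd i} \<subseteq> B i"
      "\<And>i. i \<in> C \<Longrightarrow> measure lebesgue (B i) \<le> p / q * (snd i - fst i)"
      by metis
    have fin: "measure lebesgue (\<Union>i\<in>I. B i) \<le> p / q * measure lebesgue U"
      if I: "I \<subseteq> C" "finite I" for I
    proof -
      have "measure lebesgue (\<Union>i\<in>I. B i) \<le> (\<Sum>i\<in>I. measure lebesgue (B i))"
        using I B by (intro measure_UNION_le) (auto dest: fmeasurableD)
      also have "\<dots> \<le> (\<Sum>i\<in>I. p / q * (snd i - fst i))"
        using I B by (intro sum_mono) auto
      also have "\<dots> = p / q * (\<Sum>i\<in>I. measure lebesgue {fst i..snd i})"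
        unfolding sum_distrib_left
      proof (rule sum.cong)
        fix i assume "i \<in> I"
        then have "(fst i, snd i) \<in> C" using I by auto
        from C(2)[OF this] show "p / q * (snd i - fst i) = p / q * measure lebesgue {fst i..snd i}"
          by simp
      qed simp
      also have "\<dots> \<le> p / q * measure lebesgue U"
      proof (rule mult_left_mono)
        have "(\<Sum>i\<in>I. measure lebesgue {fst i..snd i}) = measure lebesgue (\<Union>i\<in>I. {fst i..snd i})"
          using I C(3) by (intro measure_UNION'[symmetric]) (auto intro: pairwise_subset)
        also have "\<dots> \<le> measure lebesgue U"
          using I C(2) U by (intro measure_mono_fmeasurable) (fastforce intro: sets.finite_UN)+
        finally show "(\<Sum>i\<in>I. measure lebesgue {fst i..snd i}) \<le> measure lebesgue U" .
      qed (use pq in simp)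
      finally show ?thesis .
    qed
    let ?U = "\<Union>i\<in>C. B i"
    have UB: "?U \<in> lmeasurable" "measure lebesgue ?U \<le> p / q * measure lebesgue U"
      using fmeasurable_UN_bound[OF C(1) B(1) fin] measure_UN_bound[OF C(1) B(1) fin] by auto
    \<comment> \<open>The endpoints of the covering intervals form a countable set.\<close>
    define N where "N = (E - (\<Union>(l, u)\<in>C. {l..u})) \<union> fst ` C \<union> snd ` C"
    have "negligible (fst ` C \<union> snd ` C)" using C(1)
      by (auto simp: negligible_iff_null_sets intro!: null_sets_completionI countable_imp_null_set_lborel)
    then have N: "negligible N" unfolding N_def Un_assoc by (rule negligible_Un[OF C(4)])
    show ?thesis
    proof (intro bexI conjI)
      show "E \<subseteq> ?U \<union> N"
      proof
        fix x assume x: "x \<in> E"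
        show "x \<in> ?U \<union> N"
        proof (cases "x \<in> N")
          case False
          then obtain i where i: "i \<in> C" "fst i \<le> x" "x \<le> snd i"
            using x unfolding N_def by auto
          then have "fst i < x" "x < snd i" using False unfolding N_def by force+
          then show ?thesis using B(2)[OF i(1)] x i by auto
        qed simp
      qed
      show "?U \<union> N \<in> lmeasurable" by (rule fmeasurable.Un[OF UB(1) negligible_imp_measurable[OF N]])
      show "measure lebesgue (?U \<union> N) \<le> p / q * measure lebesgue U"
        using UB N measure_Un_null_set[of ?U lebesgue N] by (auto simp: negligible_iff_null_sets)
    qed
  qed
  \<comment> \<open>\<open>Inf M\<close> is the outer measure of \<open>E\<close>.\<close>
  define M where "M = measure lebesgue ` {S \<in> lmeasurable. E \<subseteq> S}"
  have bdd: "bdd_below M" unfolding M_def by (rule bdd_belowI[of _ 0]) auto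
  have ne: "M \<noteq> {}" unfolding M_def using E by (auto intro!: exI[of _ "{a<..<b}"])
  have "0 \<le> Inf M" using ne by (intro cInf_greatest) (auto simp: M_def)
  have *: "Inf M \<le> p / q * (m + e)" if me: "m \<in> M" "0 < e" for m e
  proof -
    obtain S where S: "S \<in> lmeasurable" "E \<subseteq> S" "m = measure lebesgue S"
      using me(1) unfolding M_def by auto
    obtain T where T: "open T" "S \<subseteq> T" "T - S \<in> lmeasurable" "emeasure lebesgue (T - S) < ennreal e"
      using sets_lebesgue_outer_open[OF fmeasurableD[OF S(1)] me(2)] by blast
    have "T = S \<union> (T - S)" using T by auto
    then have Tm: "T \<in> lmeasurable" using S T fmeasurable.Un by metis
    have "measure lebesgue (T - S) < e"
      using T(3,4) me(2) by (simp add: emeasure_eq_measure2 ennreal_less_iff)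
    moreover have "measure lebesgue (S \<union> (T - S)) \<le> measure lebesgue S + measure lebesgue (T - S)"
      using S T by (intro measure_Un_le) (auto dest: fmeasurableD)
    then have "measure lebesgue T \<le> measure lebesgue S + measure lebesgue (T - S)"
      by (simp only: \<open>T = S \<union> (T - S)\<close>[symmetric])
    ultimately have "measure lebesgue T \<le> m + e" using S by simp
    moreover obtain B where "B \<in> lmeasurable" "E \<subseteq> B" "measure lebesgue B \<le> p / q * measure lebesgue T"
      using step[OF T(1) Tm] S T by blast
    moreover have "Inf M \<le> measure lebesgue B"
      using calculation bdd by (intro cInf_lower) (auto simp: M_def)
    moreover have "p / q * measure lebesgue T \<le> p / q * (m + e)"
      using calculation(1) pq by (intro mult_left_mono) auto
    ultimately show ?thesis by linarith
  qed
  have "Inf M \<le> 0"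
  proof (rule ccontr)
    assume "\<not> Inf M \<le> 0"
    then have pos: "0 < Inf M" by simp
    have "1 < q / p" using pq by simp
    then have lt: "Inf M < q / p * Inf M" using mult_strict_right_mono[OF _ pos, of 1 "q / p"] by simp
    \<comment> \<open>Half of the gap, so that \<open>Inf M + 2 e = (q / p) Inf M\<close>.\<close>
    define e where "e = (q / p * Inf M - Inf M) / 2"
    have e: "e > 0" using lt by (simp add: e_def)
    obtain m where m: "m \<in> M" "m < Inf M + e"
      using cInf_lessD[OF ne, of "Inf M + e"] e by auto
    have "Inf M \<le> p / q * (m + e)" by (rule *[OF m(1) e])
    then have "q / p * Inf M \<le> m + e" using pq by (simp add: field_simps)
    moreover have "m + e < q / p * Inf M"
    proof -
      have "Inf M + e + e = q / p * Inf M" unfolding e_def by (simp add: field_simps)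
      with m(2) show ?thesis by linarith
    qed
    ultimately show False by linarith
  qed
  show ?thesis unfolding negligible_outer
  proof (intro allI impI)
    fix e :: real assume "0 < e"
    then obtain m where "m \<in> M" "m < e"
      using cInf_lessD[OF ne, of e] \<open>Inf M \<le> 0\<close> by auto
    then show "\<exists>T. E \<subseteq> T \<and> T \<in> lmeasurable \<and> measure lebesgue T < e" by (auto simp: M_def)
  qed
qed


text \<open>
  If the slopes over short intervals containing \<open>x\<close> are bounded and cannot oscillate across any
  rational gap \<open>(p, q)\<close>, they converge, to the infimum of their eventual upper bounds.
\<close>

lemma mono_bounded_derivates:
  fixes F :: "real \<Rightarrow> real"
  assumes F: "mono F"
    and bd: "0 < M" "0 < d0" "\<And>l u. l \<le> x \<Longrightarrow> x \<le> u \<Longrightarrow> l < u \<Longrightarrow> u - l < d0 \<Longrightarrow> F u - F l \<le> M * (u - l)"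
    and gap: "\<And>p q. p \<in> \<rat> \<Longrightarrow> q \<in> \<rat> \<Longrightarrow> 0 < p \<Longrightarrow> p < q \<Longrightarrow> \<exists>d>0.
       (\<forall>l u. l \<le> x \<longrightarrow> x \<le> u \<longrightarrow> l < u \<longrightarrow> u - l < d \<longrightarrow> p * (u - l) \<le> F u - F l) \<or>
       (\<forall>l u. l \<le> x \<longrightarrow> x \<le> u \<longrightarrow> l < u \<longrightarrow> u - l < d \<longrightarrow> F u - F l \<le> q * (u - l))"
  shows "F differentiable (at x)"
proof -
  define Q where "Q = {q. 0 \<le> q \<and> (\<exists>d>0. \<forall>l u. l \<le> x \<longrightarrow> x \<le> u \<longrightarrow> l < u \<longrightarrow> u - l < d \<longrightarrow> F u - F l \<le> q * (u - l))}"
  have ne: "Q \<noteq> {}" 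
  proof -
    have "M \<in> Q" unfolding Q_def using bd by (intro CollectI conjI exI[of _ d0]) auto
    then show ?thesis by blast
  qed
  have bb: "bdd_below Q" unfolding Q_def by (rule bdd_belowI[of _ 0]) auto
  define D where "D = Inf Q"
  have up: "\<exists>d>0. \<forall>l u. l \<le> x \<longrightarrow> x \<le> u \<longrightarrow> l < u \<longrightarrow> u - l < d \<longrightarrow> F u - F l \<le> (D + e) * (u - l)"
    if e: "0 < e" for e
  proof -
    obtain q where q: "q \<in> Q" "q < D + e"
      using cInf_lessD[OF ne, of "D + e"] e unfolding D_def by auto
    then obtain d where "d > 0" and d: "\<And>l u. l \<le> x \<Longrightarrow> x \<le> u \<Longrightarrow> l < u \<Longrightarrow> u - l < d \<Longrightarrow> F u - F l \<le> q * (u - l)"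
      unfolding Q_def by blast
    have "F u - F l \<le> (D + e) * (u - l)" if "l \<le> x" "x \<le> u" "l < u" "u - l < d" for l u
      using d[OF that] q mult_right_mono[of q "D + e" "u - l"] that by linarith
    then show ?thesis using \<open>d > 0\<close> by blast
  qed
  have lo: "\<exists>d>0. \<forall>l u. l \<le> x \<longrightarrow> x \<le> u \<longrightarrow> l < u \<longrightarrow> u - l < d \<longrightarrow> (D - e) * (u - l) \<le> F u - F l"
    if e: "0 < e" for e
  proof (cases "D - e \<le> 0")
    case True
    have "(D - e) * (u - l) \<le> F u - F l" if "l < u" for l u
    proof -
      have "(D - e) * (u - l) \<le> 0" using True that by (intro mult_nonpos_nonneg) auto
      also have "0 \<le> F u - F l" using monoD[OF F, of l u] that by simp
      finally show ?thesis .
    qed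
    then show ?thesis by (intro exI[of _ 1]) auto
  next
    case False
    \<comment> \<open>No rational in \<open>(D - e, D)\<close> is an eventual upper bound, so the slopes eventually stay above a smaller one.\<close>
    obtain q where q: "q \<in> \<rat>" "D - e < q" "q < D" using Rats_dense_in_real[of "D - e" D] e by auto
    obtain p where p: "p \<in> \<rat>" "D - e < p" "p < q" using Rats_dense_in_real[of "D - e" q] q by auto
    have nq: "q \<notin> Q" using q cInf_lower[OF _ bb, of q] unfolding D_def by force
    obtain d where d: "d > 0"
       "(\<forall>l u. l \<le> x \<longrightarrow> x \<le> u \<longrightarrow> l < u \<longrightarrow> u - l < d \<longrightarrow> p * (u - l) \<le> F u - F l) \<or>
       (\<forall>l u. l \<le> x \<longrightarrow> x \<le> u \<longrightarrow> l < u \<longrightarrow> u - l < d \<longrightarrow> F u - F l \<le> q * (u - l))"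
      using gap[OF p(1) q(1) _ p(3)] p False by auto
    moreover have "\<not> (\<forall>l u. l \<le> x \<longrightarrow> x \<le> u \<longrightarrow> l < u \<longrightarrow> u - l < d \<longrightarrow> F u - F l \<le> q * (u - l))"
      using nq d(1) False q unfolding Q_def by auto
    ultimately have *: "\<And>l u. l \<le> x \<Longrightarrow> x \<le> u \<Longrightarrow> l < u \<Longrightarrow> u - l < d \<Longrightarrow> p * (u - l) \<le> F u - F l"
      by blast
    have "(D - e) * (u - l) \<le> F u - F l" if "l \<le> x" "x \<le> u" "l < u" "u - l < d" for l u
      using *[OF that] p mult_right_mono[of "D - e" p "u - l"] that by linarith
    then show ?thesis using d(1) by blast
  qed
  have "(F has_derivative (\<lambda>h. h * D)) (at x)"
    unfolding has_derivative_at_alt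
  proof (intro conjI allI impI)
    show "bounded_linear (\<lambda>h. h * D)" by (rule bounded_linear_mult_left)
    fix e :: real assume e: "0 < e"
    obtain d1 where d1: "d1 > 0" "\<And>l u. l \<le> x \<Longrightarrow> x \<le> u \<Longrightarrow> l < u \<Longrightarrow> u - l < d1 \<Longrightarrow> F u - F l \<le> (D + e) * (u - l)"
      using up[OF e] by blast
    obtain d2 where d2: "d2 > 0" "\<And>l u. l \<le> x \<Longrightarrow> x \<le> u \<Longrightarrow> l < u \<Longrightarrow> u - l < d2 \<Longrightarrow> (D - e) * (u - l) \<le> F u - F l"
      using lo[OF e] by blast
    show "\<exists>d>0. \<forall>y. norm (y - x) < d \<longrightarrow> norm (F y - F x - (y - x) * D) \<le> e * norm (y - x)"
    proof (intro exI[of _ "min d1 d2"] conjI allI impI)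
      fix y assume y: "norm (y - x) < min d1 d2"
      consider "y = x" | "x < y" | "y < x" by linarith
      then show "norm (F y - F x - (y - x) * D) \<le> e * norm (y - x)"
      proof cases
        case 2
        then show ?thesis using d1(2)[of x y] d2(2)[of x y] y by (simp add: algebra_simps abs_le_iff)
      next
        case 3
        then show ?thesis using d1(2)[of y x] d2(2)[of y x] y by (simp add: algebra_simps abs_le_iff)
      qed simp
    qed (use d1 d2 in auto)
  qed
  then show ?thesis by (auto simp: differentiable_def)
qed

text \<open>
  A point of non-differentiability either has slopes above every bound, and such points are
  negligible by \<open>steep_points_measure_le\<close>, or lies in one of countably many exceptional sets
  indexed by pairs of rationals.
\<close>

theorem mono_differentiable_almost_everywhere:
  fixes F :: "real \<Rightarrow> real"
  assumes F: "mono F"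
  shows "negligible {x. \<not> F differentiable (at x)}"
proof -
  define steep where "steep q = {x. \<forall>d>0. \<exists>l u. l \<le> x \<and> x \<le> u \<and> l < u \<and> u - l < d \<and> q * (u - l) < F u - F l}" for q
  define flat where "flat p = {x. \<forall>d>0. \<exists>l u. l \<le> x \<and> x \<le> u \<and> l < u \<and> u - l < d \<and> F u - F l < p * (u - l)}" for p
  \<comment> \<open>\<open>Z\<close>: the points with arbitrarily large slopes over arbitrarily short intervals.\<close>
  define Z where "Z = (\<Inter>n::nat. steep (of_nat (Suc n)))"
  define R where "R = {(p, q :: real). p \<in> \<rat> \<and> q \<in> \<rat> \<and> 0 < p \<and> p < q}"
  have cR: "countable R"
    by (rule countable_subset[of _ "\<rat> \<times> \<rat>"]) (auto simp: R_def countable_rat)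
  have 1: "negligible (steep q \<inter> flat p)" if "(p, q) \<in> R" for p q :: real
  proof (subst negligible_on_intervals, intro allI)
    fix a b :: real
    have "negligible (steep q \<inter> flat p \<inter> {a - 1<..<b + 1})"
      by (rule flat_steep_points_negligible[OF F, of p q _ "a - 1" "b + 1"])
        (use that in \<open>auto simp: R_def steep_def flat_def\<close>)
    then show "negligible (steep q \<inter> flat p \<inter> cbox a b)"
      by (rule negligible_subset) auto
  qed
  have 2: "negligible Z"
  proof (subst negligible_on_intervals, intro allI)
    fix a b :: real
    show "negligible (Z \<inter> cbox a b)"
    proof (cases "a \<le> b")
      case True
      show ?thesis unfolding negligible_outer_le
      proof (intro allI impI)
        fix e :: real assume e: "0 < e"
        let ?c = "F (b + 1) - F (a - 1)"
        obtain n :: nat where n: "?c / e < of_nat n" using reals_Archimedean2 by blast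
        have st: "\<exists>l u. l \<le> x \<and> x \<le> u \<and> l < u \<and> u - l < d \<and> of_nat (Suc n) * (u - l) < F u - F l"
          if "x \<in> Z \<inter> cbox a b" "0 < d" for x d
          using that unfolding Z_def steep_def by blast
        have "Z \<inter> cbox a b \<subseteq> {a - 1<..<b + 1}" "a - 1 \<le> b + 1" using True by auto
        from steep_points_measure_le[OF F _ this st]
        obtain B where B: "B \<in> lmeasurable" "Z \<inter> cbox a b \<subseteq> B" "measure lebesgue B \<le> ?c / of_nat (Suc n)"
          using of_nat_0_less_iff[of "Suc n", where ?'a=real] by blast
        have "?c < e * of_nat n" using n e by (simp add: field_simps)
        also have "\<dots> \<le> e * of_nat (Suc n)" using e by simp
        finally have "?c / of_nat (Suc n) \<le> e" by (simp add: field_simps)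
        with B show "\<exists>T. Z \<inter> cbox a b \<subseteq> T \<and> T \<in> lmeasurable \<and> measure lebesgue T \<le> e"
          by (intro exI[of _ B] conjI) (auto intro: order_trans)
      qed
    qed simp
  qed
  have "{x. \<not> F differentiable (at x)} \<subseteq> Z \<union> (\<Union>(p, q)\<in>R. steep q \<inter> flat p)"
  proof (rule ccontr)
    assume "\<not> ?thesis"
    then obtain x where x: "\<not> F differentiable (at x)" "x \<notin> Z"
        "\<And>p q. (p, q) \<in> R \<Longrightarrow> x \<notin> steep q \<or> x \<notin> flat p"
      by blast
    obtain n :: nat where "x \<notin> steep (of_nat (Suc n))" using x(2) unfolding Z_def by blast
    then obtain d where d: "d > 0" "\<And>l u. l \<le> x \<Longrightarrow> x \<le> u \<Longrightarrow> l < u \<Longrightarrow> u - l < d \<Longrightarrow> F u - F l \<le> of_nat (Suc n) * (u - l)"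
      unfolding steep_def mem_Collect_eq by (meson not_less)
    have "F differentiable (at x)"
    proof (rule mono_bounded_derivates[OF F _ d])
      fix p q :: real assume "p \<in> \<rat>" "q \<in> \<rat>" "0 < p" "p < q"
      then have "x \<notin> steep q \<or> x \<notin> flat p" by (intro x) (auto simp: R_def)
      then show "\<exists>d>0.
       (\<forall>l u. l \<le> x \<longrightarrow> x \<le> u \<longrightarrow> l < u \<longrightarrow> u - l < d \<longrightarrow> p * (u - l) \<le> F u - F l) \<or>
       (\<forall>l u. l \<le> x \<longrightarrow> x \<le> u \<longrightarrow> l < u \<longrightarrow> u - l < d \<longrightarrow> F u - F l \<le> q * (u - l))"
      proof
        assume "x \<notin> steep q"
        then obtain d where "d > 0" "\<And>l u. l \<le> x \<Longrightarrow> x \<le> u \<Longrightarrow> l < u \<Longrightarrow> u - l < d \<Longrightarrow> F u - F l \<le> q * (u - l)"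
          unfolding steep_def mem_Collect_eq by (meson not_less)
        then show ?thesis by blast
      next
        assume "x \<notin> flat p"
        then obtain d where "d > 0" "\<And>l u. l \<le> x \<Longrightarrow> x \<le> u \<Longrightarrow> l < u \<Longrightarrow> u - l < d \<Longrightarrow> p * (u - l) \<le> F u - F l"
          unfolding flat_def mem_Collect_eq by (meson not_less)
        then show ?thesis by blast
      qed
    qed auto
    then show False using x by blast
  qed
  moreover have "negligible (Z \<union> (\<Union>(p, q)\<in>R. steep q \<inter> flat p))"
    using 1 2 cR by (intro negligible_Un negligible_countable_Union[of "(\<lambda>(p, q). steep q \<inter> flat p) ` R"]) auto
  ultimately show ?thesis by (rule negligible_subset[rotated])
qed


section \<open>Absolutely continuous functions\<close>

text \<open>
  Increasing chains of points suffice for the variation function, and they avoid families of intervals.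
\<close>

lemma abs_continuous_on_chain:
  assumes "abs_continuous_on UNIV f" "0 < \<epsilon>"
  obtains \<delta> where "0 < \<delta>"
    "\<And>(n::nat) s. mono s \<Longrightarrow> s n - s 0 < \<delta> \<Longrightarrow> (\<Sum>k<n. norm (f (s (Suc k)) - f (s k))) < \<epsilon>"
proof -
  obtain \<delta> where "\<delta> > 0" and \<delta>: "\<And>(n::nat) l u.
        (\<forall>k<n. l k \<le> u k \<and> {l k..u k} \<subseteq> UNIV) \<Longrightarrow>
        disjoint_family_on (\<lambda>k. {l k<..<u k}) {..<n} \<Longrightarrow>
        (\<Sum>k<n. u k - l k) < \<delta> \<Longrightarrow>
        (\<Sum>k<n. norm (f (u k) - f (l k))) < \<epsilon>"
    using assms unfolding abs_continuous_on_def by blast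
  show thesis
  proof
    show "\<delta> > 0" by fact
    fix n :: nat and s :: "nat \<Rightarrow> real" assume s: "mono s" "s n - s 0 < \<delta>"
    show "(\<Sum>k<n. norm (f (s (Suc k)) - f (s k))) < \<epsilon>"
    proof (rule \<delta>)
      show "\<forall>k<n. s k \<le> s (Suc k) \<and> {s k..s (Suc k)} \<subseteq> UNIV" using s by (auto intro: monoD)
      have "{s k<..<s (Suc k)} \<inter> {s j<..<s (Suc j)} = {}" if "k < j" for k j
      proof -
        have "s (Suc k) \<le> s j" using s(1) that by (intro monoD[of s]) auto
        then show ?thesis by auto
      qed
      then show "disjoint_family_on (\<lambda>k. {s k<..<s (Suc k)}) {..<n}"
        unfolding disjoint_family_on_def by (metis inf_commute linorder_neqE_nat)
      show "(\<Sum>k<n. s (Suc k) - s k) < \<delta>" using s(2) by (simp add: sum_lessThan_telescope)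
    qed
  qed
qed

definition chain_variations :: "(real \<Rightarrow> complex) \<Rightarrow> real \<Rightarrow> real \<Rightarrow> real set" where
  "chain_variations f A x =
     {\<Sum>k<n. norm (f (s (Suc k)) - f (s k)) | (n::nat) s. mono s \<and> s 0 = A \<and> s n = x}"

text \<open>
  Extending the interval by less than the \<open>\<delta>\<close> that belongs to \<open>\<epsilon> = 1\<close> raises the
  variation by at most \<open>1\<close>.
\<close>

lemma chain_variations_bdd_step:
  assumes "\<And>(n::nat) s. mono s \<Longrightarrow> s n - s 0 < \<delta> \<Longrightarrow> (\<Sum>k<n. norm (f (s (Suc k)) - f (s k))) < 1"
    and K: "\<And>v. v \<in> chain_variations f A c \<Longrightarrow> v \<le> K"
    and c: "A \<le> c" "c \<le> y" "y - c < \<delta>" and v: "v \<in> chain_variations f A y"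
  shows "v \<le> K + 1"
proof -
  obtain n s where s: "mono s" "s 0 = A" "s n = y" "v = (\<Sum>k<n. norm (f (s (Suc k)) - f (s k)))"
    using v unfolding chain_variations_def by blast
  let ?s1 = "\<lambda>k. min (s k) c" and ?s2 = "\<lambda>k. max (s k) c"
  \<comment> \<open>Cutting every point at \<open>c\<close> splits the chain, because \<open>{min s c, max s c} = {s, c}\<close>.\<close>
  have *: "f (min z c) + f (max z c) = f z + f c" for z by (auto simp: min_def max_def)
  have "v \<le> (\<Sum>k<n. norm (f (?s1 (Suc k)) - f (?s1 k)) + norm (f (?s2 (Suc k)) - f (?s2 k)))"
    unfolding s(4)
  proof (rule sum_mono)
    fix k
    have "f (s (Suc k)) - f (s k) = (f (?s1 (Suc k)) - f (?s1 k)) + (f (?s2 (Suc k)) - f (?s2 k))"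
      using *[of "s (Suc k)"] *[of "s k"] by (simp add: algebra_simps)
    then show "norm (f (s (Suc k)) - f (s k))
        \<le> norm (f (?s1 (Suc k)) - f (?s1 k)) + norm (f (?s2 (Suc k)) - f (?s2 k))"
      by (metis norm_triangle_ineq)
  qed
  also have "\<dots> = (\<Sum>k<n. norm (f (?s1 (Suc k)) - f (?s1 k))) + (\<Sum>k<n. norm (f (?s2 (Suc k)) - f (?s2 k)))"
    by (rule sum.distrib)
  also have "(\<Sum>k<n. norm (f (?s1 (Suc k)) - f (?s1 k))) \<le> K"
  proof (rule K)
    have "mono ?s1" using s(1) by (auto simp: mono_def min_def intro: order_trans)
    then show "(\<Sum>k<n. norm (f (?s1 (Suc k)) - f (?s1 k))) \<in> chain_variations f A c"
      unfolding chain_variations_def using s c by (auto intro!: exI[of _ n] exI[of _ ?s1])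
  qed
  also have "(\<Sum>k<n. norm (f (?s2 (Suc k)) - f (?s2 k))) < 1"
  proof (rule assms(1))
    show "mono ?s2" using s(1) by (fastforce simp: mono_def max_def intro: order_trans)
    show "?s2 n - ?s2 0 < \<delta>" using s c by auto
  qed
  finally show ?thesis by simp
qed

text \<open>
  Finitely many steps of length \<open>\<delta> / 2\<close> reach \<open>x\<close> from \<open>A\<close>.
\<close>

lemma abs_continuous_chain_variations_bdd:
  assumes f: "abs_continuous_on UNIV f" and "A \<le> x"
  shows "bdd_above (chain_variations f A x)"
proof -
  obtain \<delta> where \<delta>: "0 < \<delta>"
    "\<And>(n::nat) s. mono s \<Longrightarrow> s n - s 0 < \<delta> \<Longrightarrow> (\<Sum>k<n. norm (f (s (Suc k)) - f (s k))) < 1"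
    using abs_continuous_on_chain[OF f, of 1] by auto
  have Z: "v \<le> 0" if "v \<in> chain_variations f A A" for v
  proof -
    obtain n s where s: "mono s" "s 0 = A" "s n = A" "v = (\<Sum>k<n. norm (f (s (Suc k)) - f (s k)))"
      using \<open>v \<in> _\<close> unfolding chain_variations_def by blast
    have "s k = A" if "k \<le> n" for k
      using monoD[OF s(1), of 0 k] monoD[OF s(1), of k n] s that by auto
    then show ?thesis using s(4) by simp
  qed
  have *: "v \<le> of_nat m" if "v \<in> chain_variations f A y" "A \<le> y" "y - A \<le> of_nat m * (\<delta> / 2)" for v y and m :: nat
    using that
  proof (induction m arbitrary: v y)
    case 0
    then show ?case using Z[of v] by simp
  next
    case (Suc m)
    \<comment> \<open>The last point already reached by the induction hypothesis.\<close>
    define c where "c = min y (A + of_nat m * (\<delta> / 2))"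
    have "0 \<le> of_nat m * (\<delta> / 2)" using \<delta>(1) by simp
    then have c: "A \<le> c" "c \<le> y" "c - A \<le> of_nat m * (\<delta> / 2)" using Suc.prems by (auto simp: c_def min_def algebra_simps)
    have "y - c < \<delta>" using Suc.prems \<delta>(1) unfolding c_def by (auto simp: min_def algebra_simps)
    from chain_variations_bdd_step[OF \<delta>(2) Suc.IH[OF _ c(1,3)] c(1,2) this Suc.prems(1)]
    show ?case by simp
  qed
  obtain m :: nat where "(x - A) / (\<delta> / 2) < of_nat m" using reals_Archimedean2 by blast
  then have "x - A \<le> of_nat m * (\<delta> / 2)" using \<delta>(1) by (simp add: field_simps)
  with * assms(2) show ?thesis by (intro bdd_aboveI[of _ "of_nat m"]) blast
qed

text \<open>
  The witness is the total variation of \<open>f\<close> on \<open>[A, x]\<close>; appending \<open>y\<close> to a chain that ends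
  at \<open>x\<close> gives the inequality.
\<close>

lemma abs_continuous_variation_function:
  assumes f: "abs_continuous_on UNIV f"
  shows "\<exists>v :: real \<Rightarrow> real. \<forall>x y. A \<le> x \<longrightarrow> x \<le> y \<longrightarrow> norm (f y - f x) \<le> v y - v x"
proof (intro exI allI impI)
  define v where "v x = Sup (chain_variations f A x)" for x
  fix x y assume xy: "A \<le> x" "x \<le> y"
  have ne: "chain_variations f A x \<noteq> {}"
  proof -
    have "mono (\<lambda>k::nat. if k = 0 then A else x)" using xy by (auto simp: mono_def)
    then show ?thesis unfolding chain_variations_def using xy
      by (auto intro!: exI[of _ "1::nat"] exI[of _ "\<lambda>k::nat. if k = 0 then A else x"])
  qed
  have "w \<le> v y - norm (f y - f x)" if "w \<in> chain_variations f A x" for w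
  proof -
    obtain n s where s: "mono s" "s 0 = A" "s n = x" "w = (\<Sum>k<n. norm (f (s (Suc k)) - f (s k)))"
      using \<open>w \<in> _\<close> unfolding chain_variations_def by blast
    define s' where "s' k = (if k \<le> n then s k else y)" for k
    have "mono s'"
      unfolding mono_def s'_def using monoD[OF s(1)] s(3) xy by (auto intro: order_trans)
    moreover have "s' 0 = A" "s' (Suc n) = y" using s by (auto simp: s'_def)
    moreover have "w + norm (f y - f x) = (\<Sum>k<Suc n. norm (f (s' (Suc k)) - f (s' k)))"
      using s by (auto simp: s'_def)
    ultimately have "w + norm (f y - f x) \<in> chain_variations f A y"
      unfolding chain_variations_def by blast
    then have "w + norm (f y - f x) \<le> v y"
      unfolding v_def using abs_continuous_chain_variations_bdd[OF f, of A y] xy by (intro cSup_upper) auto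
    then show ?thesis by simp
  qed
  then have "v x \<le> v y - norm (f y - f x)" unfolding v_def[of x] using ne by (intro cSup_least)
  then show "norm (f y - f x) \<le> v y - v x" by simp
qed

text \<open>
  Both \<open>v + g\<close> and \<open>v - g\<close> are increasing, and \<open>g\<close> is half their difference. The maximum with
  \<open>A\<close> extends them to monotone functions on the whole line.
\<close>

lemma real_differentiable_of_increment_bound:
  fixes g v :: "real \<Rightarrow> real"
  assumes gv: "\<And>x y. A \<le> x \<Longrightarrow> x \<le> y \<Longrightarrow> \<bar>g y - g x\<bar> \<le> v y - v x"
  shows "negligible {x. A < x \<and> \<not> g differentiable (at x)}"
proof -
  define G where "G = (\<lambda>x. v (max A x) + g (max A x))"
  define H where "H = (\<lambda>x. v (max A x) - g (max A x))"
  have "G x \<le> G y \<and> H x \<le> H y" if "x \<le> y" for x y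
    using gv[of "max A x" "max A y"] max.mono[OF order_refl that, of A]
    unfolding G_def H_def by (auto simp: abs_le_iff)
  then have "mono G" "mono H" by (auto simp: mono_def)
  then have "negligible ({x. \<not> G differentiable (at x)} \<union> {x. \<not> H differentiable (at x)})"
    by (intro negligible_Un mono_differentiable_almost_everywhere)
  moreover have "{x. A < x \<and> \<not> g differentiable (at x)}
      \<subseteq> {x. \<not> G differentiable (at x)} \<union> {x. \<not> H differentiable (at x)}"
  proof clarify
    fix x assume x: "A < x" "\<not> g differentiable (at x)" "H differentiable (at x)" "G differentiable (at x)"
    have df: "(\<lambda>x. (1/2) * (G x - H x)) differentiable (at x)"
      using x by (intro derivative_intros) auto
    have eq: "(1/2) * (G y - H y) = g y" if "y \<in> UNIV" "dist y x < x - A" for y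
    proof -
      have "max A y = y" using that by (auto simp: dist_real_def)
      then show ?thesis by (simp add: G_def H_def)
    qed
    have "g differentiable (at x)"
      by (rule differentiable_transform_within[OF df _ UNIV_I eq]) (use x(1) in auto)
    then show False using x by blast
  qed
  ultimately show ?thesis by (rule negligible_subset)
qed


theorem abs_continuous_differentiable_almost_everywhere:
  assumes f: "abs_continuous_on UNIV f"
  shows "negligible {x. \<not> f differentiable (at x)}"
proof -
  have *: "negligible {x. - of_nat n < x \<and> \<not> (\<lambda>x. Re (f x)) differentiable (at x)}
      \<and> negligible {x. - of_nat n < x \<and> \<not> (\<lambda>x. Im (f x)) differentiable (at x)}" for n :: nat
  proof -
    obtain v where v: "\<And>x y. - of_nat n \<le> x \<Longrightarrow> x \<le> y \<Longrightarrow> norm (f y - f x) \<le> v y - v x"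
      using abs_continuous_variation_function[OF f, of "- of_nat n"] by blast
    have "\<bar>Re (f y) - Re (f x)\<bar> \<le> v y - v x" "\<bar>Im (f y) - Im (f x)\<bar> \<le> v y - v x"
      if "- of_nat n \<le> x" "x \<le> y" for x y
      using v[OF that] abs_Re_le_cmod[of "f y - f x"] abs_Im_le_cmod[of "f y - f x"] by auto
    then show ?thesis by (intro conjI real_differentiable_of_increment_bound[where v=v])
  qed
  have "{x. \<not> f differentiable (at x)} \<subseteq>
     (\<Union>n::nat. {x. - of_nat n < x \<and> \<not> (\<lambda>x. Re (f x)) differentiable (at x)}
       \<union> {x. - of_nat n < x \<and> \<not> (\<lambda>x. Im (f x)) differentiable (at x)})"
  proof (rule subsetI, rule ccontr)
    fix x assume x: "x \<in> {x. \<not> f differentiable (at x)}" and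
      "x \<notin> (\<Union>n::nat. {x. - of_nat n < x \<and> \<not> (\<lambda>x. Re (f x)) differentiable (at x)}
       \<union> {x. - of_nat n < x \<and> \<not> (\<lambda>x. Im (f x)) differentiable (at x)})"
    moreover obtain n :: nat where "- x < of_nat n" using reals_Archimedean2 by blast
    then have "- of_nat n < x" by linarith
    ultimately have "(\<lambda>x. Re (f x)) differentiable (at x) \<and> (\<lambda>x. Im (f x)) differentiable (at x)"
      by blast
    then obtain D1 D2 where "((\<lambda>x. Re (f x)) has_derivative D1) (at x)"
        "((\<lambda>x. Im (f x)) has_derivative D2) (at x)"
      unfolding differentiable_def by blast
    then have "((\<lambda>x. complex_of_real (Re (f x)) + \<i> * complex_of_real (Im (f x))) has_derivative
        (\<lambda>h. complex_of_real (D1 h) + \<i> * complex_of_real (D2 h))) (at x)"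
      by (intro has_derivative_add has_derivative_mult_right has_derivative_of_real)
    then have "(\<lambda>x. complex_of_real (Re (f x)) + \<i> * complex_of_real (Im (f x))) differentiable (at x)"
      unfolding differentiable_def by blast
    then have "f differentiable (at x)" by (simp add: complex_eq[symmetric])
    then show False using x by simp
  qed
  moreover have "negligible (\<Union>n::nat. {x. - of_nat n < x \<and> \<not> (\<lambda>x. Re (f x)) differentiable (at x)}
       \<union> {x. - of_nat n < x \<and> \<not> (\<lambda>x. Im (f x)) differentiable (at x)})"
    using * by (intro negligible_countable_Union) auto
  ultimately show ?thesis by (rule negligible_subset[rotated])
qed

text \<open>
  Absolute continuity for intervals indexed by an arbitrary finite set, as they come from a tagged
  division.
\<close>

lemma abs_continuous_on_finite_family:
  assumes "abs_continuous_on UNIV f" "0 < \<epsilon>"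
  obtains \<delta> where "0 < \<delta>"
    "\<And>(I :: 'i set) l u. finite I \<Longrightarrow> (\<And>i. i \<in> I \<Longrightarrow> l i \<le> u i) \<Longrightarrow>
        disjoint_family_on (\<lambda>i. {l i<..<u i}) I \<Longrightarrow> (\<Sum>i\<in>I. u i - l i) < \<delta> \<Longrightarrow>
        (\<Sum>i\<in>I. norm (f (u i) - f (l i))) < \<epsilon>"
proof -
  obtain \<delta> where "\<delta> > 0" and \<delta>: "\<And>(n::nat) l u.
        (\<forall>k<n. l k \<le> u k \<and> {l k..u k} \<subseteq> UNIV) \<Longrightarrow>
        disjoint_family_on (\<lambda>k. {l k<..<u k}) {..<n} \<Longrightarrow>
        (\<Sum>k<n. u k - l k) < \<delta> \<Longrightarrow>
        (\<Sum>k<n. norm (f (u k) - f (l k))) < \<epsilon>"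
    using assms unfolding abs_continuous_on_def by blast
  show thesis
  proof
    show "\<delta> > 0" by fact
    fix I :: "'i set" and l u :: "'i \<Rightarrow> real"
    assume I: "finite I" "\<And>i. i \<in> I \<Longrightarrow> l i \<le> u i" "disjoint_family_on (\<lambda>i. {l i<..<u i}) I"
      "(\<Sum>i\<in>I. u i - l i) < \<delta>"
    obtain h where "bij_betw h {0..<card I} I" using ex_bij_betw_nat_finite[OF I(1)] by blast
    then have h: "bij_betw h {..<card I} I" by (simp add: atLeast0LessThan)
    then have hI: "h k \<in> I" if "k < card I" for k using that by (auto dest: bij_betwE)
    have "(\<Sum>k<card I. norm (f (u (h k)) - f (l (h k)))) < \<epsilon>"
    proof (rule \<delta>)
      show "\<forall>k<card I. l (h k) \<le> u (h k) \<and> {l (h k)..u (h k)} \<subseteq> UNIV" using hI I(2) by auto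
      show "disjoint_family_on (\<lambda>k. {l (h k)<..<u (h k)}) {..<card I}"
        using I(3) hI bij_betw_imp_inj_on[OF h] unfolding disjoint_family_on_def inj_on_def
        by (metis lessThan_iff)
      show "(\<Sum>k<card I. u (h k) - l (h k)) < \<delta>"
        using I(4) sum.reindex_bij_betw[OF h, of "\<lambda>i. u i - l i"] by simp
    qed
    then show "(\<Sum>i\<in>I. norm (f (u i) - f (l i))) < \<epsilon>"
      using sum.reindex_bij_betw[OF h, of "\<lambda>i. norm (f (u i) - f (l i))"] by simp
  qed
qed

text \<open>
  A gauge argument. Off the null set \<open>N\<close> where the derivative does not exist, the usual straddle
  estimate holds. The intervals tagged in \<open>N\<close> stay in an open set of small measure, so that absolute
  continuity makes their total increment small.
\<close>

theorem abs_continuous_fundamental_theorem: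
  assumes f: "abs_continuous_on UNIV f" and ab: "a \<le> b"
  shows "((\<lambda>t. vector_derivative f (at t)) has_integral (f b - f a)) {a..b}"
proof -
  define N where "N = {x. \<not> f differentiable (at x)}"
  have N: "negligible N" unfolding N_def by (rule abs_continuous_differentiable_almost_everywhere[OF f])
  define g where "g t = (if t \<in> N then 0 else vector_derivative f (at t))" for t
  have "(g has_integral (f b - f a)) {a..b}"
    unfolding has_integral_real
  proof (intro allI impI)
    fix e :: real assume e: "0 < e"
    \<comment> \<open>The summand \<open>1\<close> covers the case \<open>a = b\<close>.\<close>
    define e1 where "e1 = e / (2 * (b - a + 1))"
    have e1: "e1 > 0" "e1 * (b - a) < e / 2" using e ab by (auto simp: e1_def field_simps)
    have "\<exists>d>0. x \<notin> N \<longrightarrow> (\<forall>y. norm (y - x) < d \<longrightarrow>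
         norm (f y - f x - (y - x) *\<^sub>R g x) \<le> e1 * norm (y - x))" for x
    proof (cases "x \<in> N")
      case True
      then show ?thesis by (auto intro: exI[of _ 1])
    next
      case False
      then have "(f has_vector_derivative g x) (at x)"
        by (simp add: N_def g_def vector_derivative_works[symmetric])
      then show ?thesis using e1(1) unfolding has_vector_derivative_def has_derivative_at_alt by blast
    qed
    then obtain d where d: "\<And>x. d x > 0" "\<And>x y. x \<notin> N \<Longrightarrow> norm (y - x) < d x \<Longrightarrow>
         norm (f y - f x - (y - x) *\<^sub>R g x) \<le> e1 * norm (y - x)" by metis
    have "0 < e / 2" using e by simp
    from abs_continuous_on_finite_family[OF f this, where 'i = "real \<times> real set"]
    obtain \<delta> where \<delta>: "\<delta> > 0" "\<And>(I :: (real \<times> real set) set) l u. finite I \<Longrightarrow>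
        (\<And>i. i \<in> I \<Longrightarrow> l i \<le> u i) \<Longrightarrow>
        disjoint_family_on (\<lambda>i. {l i<..<u i}) I \<Longrightarrow> (\<Sum>i\<in>I. u i - l i) < \<delta> \<Longrightarrow>
        (\<Sum>i\<in>I. norm (f (u i) - f (l i))) < e / 2" by blast
    obtain U where U: "open U" "N \<subseteq> U" "U - N \<in> lmeasurable" "emeasure lebesgue (U - N) < ennreal \<delta>"
      using sets_lebesgue_outer_open[OF negligible_imp_sets[OF N] \<delta>(1)] by blast
    have Um: "U \<in> lmeasurable" "measure lebesgue U < \<delta>"
    proof -
      have UN: "U = (U - N) \<union> N" using U by auto
      then show "U \<in> lmeasurable"
        using fmeasurable.Un[OF U(3) negligible_imp_measurable[OF N]] by simp
      have "measure lebesgue ((U - N) \<union> N) = measure lebesgue (U - N)"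
        using U(3) N by (intro measure_Un_null_set) (auto simp: negligible_iff_null_sets)
      then show "measure lebesgue U < \<delta>"
        using U(3,4) \<delta>(1) UN by (simp add: emeasure_eq_measure2 ennreal_less_iff)
    qed
    \<comment> \<open>Tags in the null set \<open>N\<close> are controlled by absolute continuity, the others by the derivative.\<close>
    define \<gamma> where "\<gamma> x = (if x \<in> N then U else ball x (d x))" for x
    have "gauge \<gamma>" using U d by (auto simp: gauge_def \<gamma>_def)
    have "norm ((\<Sum>(x, K)\<in>p. measure lborel K *\<^sub>R g x) - (f b - f a)) < e"
      if p: "p tagged_division_of {a..b}" "\<gamma> fine p" for p
    proof -
      note fin = tagged_division_ofD(1)[OF p(1)]
      have K: "x \<in> K \<and> K = {Inf K..Sup K} \<and> Inf K \<le> Sup K \<and> Inf K \<le> x \<and> x \<le> Sup K \<and> K \<subseteq> \<gamma> x"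
        if "(x, K) \<in> p" for x K
      proof -
        obtain l u where "K = cbox l u" using tagged_division_ofD(4)[OF p(1)] \<open>(x, K) \<in> p\<close> by blast
        moreover have "x \<in> K" by (rule tagged_division_ofD(2)[OF p(1) \<open>(x, K) \<in> p\<close>])
        moreover have "K \<subseteq> \<gamma> x" using p(2) \<open>(x, K) \<in> p\<close> by (auto simp: fine_def)
        ultimately show ?thesis by auto
      qed
      let ?p1 = "{i \<in> p. fst i \<in> N}" and ?p2 = "{i \<in> p. fst i \<notin> N}"
      let ?t = "\<lambda>(x, K). measure lborel K *\<^sub>R g x - (f (Sup K) - f (Inf K))"
      have "(\<Sum>(x, K)\<in>p. measure lborel K *\<^sub>R g x) - (f b - f a) = sum ?t p"
        using additive_tagged_division_1[OF ab p(1), of f] by (simp add: sum_subtractf case_prod_unfold)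
      also have "\<dots> = sum ?t ?p1 + sum ?t ?p2"
        by (subst sum.union_disjoint[symmetric]) (use fin in \<open>auto intro!: sum.cong\<close>)
      finally have "norm ((\<Sum>(x, K)\<in>p. measure lborel K *\<^sub>R g x) - (f b - f a)) \<le> norm (sum ?t ?p1) + norm (sum ?t ?p2)"
        by (simp add: norm_triangle_ineq)
      also have "norm (sum ?t ?p1) < e / 2"
      proof -
        have "norm (sum ?t ?p1) \<le> (\<Sum>i\<in>?p1. norm (f (Sup (snd i)) - f (Inf (snd i))))"
          by (rule sum_norm_le) (auto simp: g_def norm_minus_commute)
        also have "\<dots> < e / 2"
        proof (rule \<delta>(2))
          show "finite ?p1" using fin by simp
          show "Inf (snd i) \<le> Sup (snd i)" if "i \<in> ?p1" for i using K[of "fst i" "snd i"] that by simp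
          have int: "interior (snd i) = {Inf (snd i)<..<Sup (snd i)}" if "i \<in> ?p1" for i
            using K[of "fst i" "snd i"] that by (metis (mono_tags, lifting) interior_atLeastAtMost_real mem_Collect_eq prod.collapse)
          show disj: "disjoint_family_on (\<lambda>i. {Inf (snd i)<..<Sup (snd i)}) ?p1"
            unfolding disjoint_family_on_def
          proof (intro ballI impI)
            fix i j assume ij: "i \<in> ?p1" "j \<in> ?p1" "i \<noteq> j"
            then have "interior (snd i) \<inter> interior (snd j) = {}"
              using tagged_division_ofD(5)[OF p(1), of "fst i" "snd i" "fst j" "snd j"] by auto
            then show "{Inf (snd i)<..<Sup (snd i)} \<inter> {Inf (snd j)<..<Sup (snd j)} = {}"
              using int ij by simp
          qed
          have "(\<Sum>i\<in>?p1. Sup (snd i) - Inf (snd i)) = (\<Sum>i\<in>?p1. measure lebesgue {Inf (snd i)<..<Sup (snd i)})"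
          proof (rule sum.cong)
            fix i assume "i \<in> ?p1"
            then have "Inf (snd i) \<le> Sup (snd i)" using K[of "fst i" "snd i"] by simp
            then show "Sup (snd i) - Inf (snd i) = measure lebesgue {Inf (snd i)<..<Sup (snd i)}" by simp
          qed simp
          also have "\<dots> = measure lebesgue (\<Union>i\<in>?p1. {Inf (snd i)<..<Sup (snd i)})"
            using disj fin by (intro measure_UNION'[symmetric])
              (auto simp: disjoint_family_on_def pairwise_def disjnt_def)
          also have "\<dots> \<le> measure lebesgue U"
          proof (rule measure_mono_fmeasurable[OF _ _ Um(1)])
            show "(\<Union>i\<in>?p1. {Inf (snd i)<..<Sup (snd i)}) \<subseteq> U"
            proof (intro UN_least)
              fix i assume i: "i \<in> ?p1"
              then have "interior (snd i) \<subseteq> snd i" "snd i \<subseteq> \<gamma> (fst i)"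
                using K[of "fst i" "snd i"] interior_subset by auto
              then show "{Inf (snd i)<..<Sup (snd i)} \<subseteq> U" using int[OF i] i by (auto simp: \<gamma>_def)
            qed
            show "(\<Union>i\<in>?p1. {Inf (snd i)<..<Sup (snd i)}) \<in> sets lebesgue"
              using fin by (intro sets.finite_UN) auto
          qed
          finally show "(\<Sum>i\<in>?p1. Sup (snd i) - Inf (snd i)) < \<delta>" using Um(2) by linarith
        qed
        finally show ?thesis .
      qed
      also have "norm (sum ?t ?p2) \<le> (\<Sum>(x, K)\<in>?p2. e1 * (Sup K - Inf K))"
      proof (rule sum_norm_le, clarify)
        fix x K assume xK: "(x, K) \<in> p" "fst (x, K) \<notin> N"
        note k = K[OF xK(1)]
        then have b: "{Inf K..Sup K} \<subseteq> ball x (d x)" using xK(2) by (auto simp: \<gamma>_def)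
        have le: "Inf K \<le> Sup K" using k by blast
        have "Sup K \<in> ball x (d x)" "Inf K \<in> ball x (d x)"
          by (rule subsetD[OF b], use le in simp)+
        then have "norm (Sup K - x) < d x" "norm (Inf K - x) < d x"
          by (simp_all only: mem_ball dist_norm norm_minus_commute)
        then have 1: "norm (f (Sup K) - f x - (Sup K - x) *\<^sub>R g x) \<le> e1 * (Sup K - x)"
          and 2: "norm (f (Inf K) - f x - (Inf K - x) *\<^sub>R g x) \<le> e1 * (x - Inf K)"
          using d(2)[of x] xK(2) k by fastforce+
        have "measure lborel K = Sup K - Inf K" using k by (metis content_real)
        then have "measure lborel K *\<^sub>R g x = (Sup K - x) *\<^sub>R g x - (Inf K - x) *\<^sub>R g x"
          by (simp add: scaleR_left_diff_distrib[symmetric])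
        then have "measure lborel K *\<^sub>R g x - (f (Sup K) - f (Inf K)) =
           (f (Inf K) - f x - (Inf K - x) *\<^sub>R g x) - (f (Sup K) - f x - (Sup K - x) *\<^sub>R g x)"
          by (simp add: algebra_simps)
        also have "norm \<dots> \<le> e1 * (x - Inf K) + e1 * (Sup K - x)"
          using norm_triangle_ineq4 1 2 by (smt (verit))
        finally show "norm (measure lborel K *\<^sub>R g x - (f (Sup K) - f (Inf K))) \<le> e1 * (Sup K - Inf K)"
          by (simp add: algebra_simps)
      qed
      also have "(\<Sum>(x, K)\<in>?p2. e1 * (Sup K - Inf K)) \<le> (\<Sum>(x, K)\<in>p. e1 * (Sup K - Inf K))"
      proof (rule sum_mono2[OF fin])
        fix i assume "i \<in> p - ?p2"
        then show "0 \<le> (case i of (x, K) \<Rightarrow> e1 * (Sup K - Inf K))"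
          using K[of "fst i" "snd i"] e1 by (auto simp: case_prod_unfold)
      qed auto
      also have "\<dots> = e1 * (b - a)"
        using additive_tagged_division_1[OF ab p(1), of "\<lambda>x. x"]
        by (simp add: sum_distrib_left[symmetric] case_prod_unfold)
      finally show ?thesis using e1(2) by linarith
    qed
    with \<open>gauge \<gamma>\<close> show "\<exists>\<gamma>. gauge \<gamma> \<and> (\<forall>\<D>. \<D> tagged_division_of {a..b} \<and> \<gamma> fine \<D> \<longrightarrow>
        norm ((\<Sum>(x, K)\<in>\<D>. measure lborel K *\<^sub>R g x) - (f b - f a)) < e)"
      by (intro exI[of _ \<gamma>] conjI allI impI) auto
  qed
  then show ?thesis by (rule has_integral_spike[OF N, rotated]) (auto simp: g_def)
qed


section \<open>The Banach algebra \<open>V(\<real>)\<close>\<close>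

text \<open>
  One criterion covers sums, products and reciprocals.
\<close>

lemma abs_continuous_of_increments:
  assumes f: "abs_continuous_on UNIV f" and g: "abs_continuous_on UNIV g"
    and h: "\<And>x y. norm (h y - h x) \<le> \<alpha> * norm (f y - f x) + \<beta> * norm (g y - g x)"
    and ab: "0 \<le> \<alpha>" "0 \<le> \<beta>"
  shows "abs_continuous_on UNIV h"
  unfolding abs_continuous_on_def
proof (intro allI impI)
  fix e :: real assume "0 < e"
  define e1 where "e1 = e / (\<alpha> + \<beta> + 1)"
  have e1: "0 < e1" "(\<alpha> + \<beta>) * e1 < e" using \<open>0 < e\<close> ab by (auto simp: e1_def field_simps)
  obtain d1 where d1: "d1 > 0" "\<forall>(n::nat) l u.
        (\<forall>k<n. l k \<le> u k \<and> {l k..u k} \<subseteq> UNIV) \<longrightarrow>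
        disjoint_family_on (\<lambda>k. {l k<..<u k}) {..<n} \<longrightarrow>
        (\<Sum>k<n. u k - l k) < d1 \<longrightarrow> (\<Sum>k<n. norm (f (u k) - f (l k))) < e1"
    using f e1(1) unfolding abs_continuous_on_def by blast
  obtain d2 where d2: "d2 > 0" "\<forall>(n::nat) l u.
        (\<forall>k<n. l k \<le> u k \<and> {l k..u k} \<subseteq> UNIV) \<longrightarrow>
        disjoint_family_on (\<lambda>k. {l k<..<u k}) {..<n} \<longrightarrow>
        (\<Sum>k<n. u k - l k) < d2 \<longrightarrow> (\<Sum>k<n. norm (g (u k) - g (l k))) < e1"
    using g e1(1) unfolding abs_continuous_on_def by blast
  show "\<exists>\<delta>>0. \<forall>(n::nat) l u.
        (\<forall>k<n. l k \<le> u k \<and> {l k..u k} \<subseteq> UNIV) \<longrightarrow>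
        disjoint_family_on (\<lambda>k. {l k<..<u k}) {..<n} \<longrightarrow>
        (\<Sum>k<n. u k - l k) < \<delta> \<longrightarrow> (\<Sum>k<n. norm (h (u k) - h (l k))) < e"
  proof (intro exI[of _ "min d1 d2"] conjI allI impI)
    fix n :: nat and l u :: "nat \<Rightarrow> real"
    assume *: "\<forall>k<n. l k \<le> u k \<and> {l k..u k} \<subseteq> UNIV" "disjoint_family_on (\<lambda>k. {l k<..<u k}) {..<n}"
      "(\<Sum>k<n. u k - l k) < min d1 d2"
    have "(\<Sum>k<n. norm (h (u k) - h (l k)))
        \<le> (\<Sum>k<n. \<alpha> * norm (f (u k) - f (l k)) + \<beta> * norm (g (u k) - g (l k)))"
      by (intro sum_mono h)
    also have "\<dots> = \<alpha> * (\<Sum>k<n. norm (f (u k) - f (l k))) + \<beta> * (\<Sum>k<n. norm (g (u k) - g (l k)))"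
      by (simp add: sum.distrib sum_distrib_left)
    also have "\<dots> \<le> \<alpha> * e1 + \<beta> * e1"
      using d1(2) d2(2) * ab by (intro add_mono mult_left_mono) (auto intro: less_imp_le)
    also have "\<dots> < e" using e1 by (simp add: algebra_simps)
    finally show "(\<Sum>k<n. norm (h (u k) - h (l k))) < e" .
  qed (use d1 d2 in auto)
qed

lemma abs_continuous_Lipschitz:
  assumes h: "\<And>x y. norm (h y - h x) \<le> C * \<bar>y - x\<bar>"
  shows "abs_continuous_on UNIV h"
  unfolding abs_continuous_on_def
proof (intro allI impI)
  fix e :: real assume "0 < e"
  have C: "0 \<le> C" using order_trans[OF norm_ge_zero h[of 1 0]] by simp
  show "\<exists>\<delta>>0. \<forall>(n::nat) l u.
        (\<forall>k<n. l k \<le> u k \<and> {l k..u k} \<subseteq> UNIV) \<longrightarrow>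
        disjoint_family_on (\<lambda>k. {l k<..<u k}) {..<n} \<longrightarrow>
        (\<Sum>k<n. u k - l k) < \<delta> \<longrightarrow> (\<Sum>k<n. norm (h (u k) - h (l k))) < e"
  proof (intro exI[of _ "e / (C + 1)"] conjI allI impI)
    fix n :: nat and l u :: "nat \<Rightarrow> real"
    assume *: "\<forall>k<n. l k \<le> u k \<and> {l k..u k} \<subseteq> UNIV" "(\<Sum>k<n. u k - l k) < e / (C + 1)"
    have s0: "0 \<le> (\<Sum>k<n. u k - l k)" using * by (intro sum_nonneg) auto
    have "(\<Sum>k<n. norm (h (u k) - h (l k))) \<le> (\<Sum>k<n. C * (u k - l k))"
      using * h by (intro sum_mono) (metis abs_of_nonneg diff_ge_0_iff_ge lessThan_iff)
    also have "\<dots> \<le> (C + 1) * (\<Sum>k<n. u k - l k)"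
      using s0 by (simp add: sum_distrib_left[symmetric] mult_right_mono)
    also have "\<dots> < e" using * C by (simp add: field_simps)
    finally show "(\<Sum>k<n. norm (h (u k) - h (l k))) < e" .
  qed (use \<open>0 < e\<close> C in auto)
qed

lemma abs_continuous_continuous:
  assumes f: "abs_continuous_on UNIV f"
  shows "continuous_on UNIV f"
  unfolding continuous_on_iff
proof (intro ballI allI impI)
  fix x e :: real assume "0 < e"
  from abs_continuous_on_chain[OF f this] obtain d where d: "d > 0"
    "\<And>(n::nat) s. mono s \<Longrightarrow> s n - s 0 < d \<Longrightarrow> (\<Sum>k<n. norm (f (s (Suc k)) - f (s k))) < e" by blast
  have *: "norm (f z - f y) < e" if "y \<le> z" "z - y < d" for y z
  proof -
    have "mono (\<lambda>k::nat. if k = 0 then y else z)" using that by (auto simp: mono_def)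
    from d(2)[OF this, of 1] that show ?thesis by simp
  qed
  show "\<exists>d>0. \<forall>x'\<in>UNIV. dist x' x < d \<longrightarrow> dist (f x') (f x) < e"
  proof (intro exI[of _ d] conjI ballI impI)
    fix y assume "dist y x < d"
    then show "dist (f y) (f x) < e"
      using *[of x y] *[of y x] by (cases "x \<le> y") (auto simp: dist_norm norm_minus_commute)
  qed fact
qed

abbreviation D :: "(real \<Rightarrow> complex) \<Rightarrow> real \<Rightarrow> complex" where
  "D f x \<equiv> vector_derivative f (at x)"

abbreviation variation_on :: "real set \<Rightarrow> (real \<Rightarrow> complex) \<Rightarrow> real" where
  "variation_on S f \<equiv> LINT x:S|lebesgue. norm (D f x)"

lemma V_variation_UNIV: "V_variation f = variation_on UNIV f"
  by (simp add: V_variation_def set_lebesgue_integral_def)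

lemma V_spaceD:
  assumes "f \<in> V_space"
  shows "abs_continuous_on UNIV f" "integrable lebesgue (D f)" "continuous_on UNIV f"
    "negligible {x. \<not> f differentiable (at x)}"
  using assms abs_continuous_continuous abs_continuous_differentiable_almost_everywhere
  by (auto simp: V_space_def)

lemma V_space_has_derivative:
  "f differentiable (at x) \<Longrightarrow> (f has_vector_derivative D f x) (at x)"
  by (simp add: vector_derivative_works[symmetric])

text \<open>
  Where the derivative does not exist, \<^const>\<open>vector_derivative\<close> has an arbitrary value, so
  derivatives are only ever computed off a negligible set.
\<close>

lemma V_spaceI:
  assumes "abs_continuous_on UNIV f" "negligible N" "\<And>x. x \<notin> N \<Longrightarrow> D f x = g x" "integrable lebesgue g"
  shows "f \<in> V_space"
proof -
  have "g absolutely_integrable_on UNIV" using assms(4) by (simp add: set_integrable_def)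
  then have "D f absolutely_integrable_on UNIV"
    by (rule absolutely_integrable_spike[OF _ assms(2)]) (use assms(3) in auto)
  then show ?thesis using assms(1) by (simp add: V_space_def set_integrable_def)
qed

lemma V_set_integrable:
  assumes "f \<in> V_space" "S \<in> sets lebesgue"
  shows "set_integrable lebesgue S (D f)" "set_integrable lebesgue S (\<lambda>x. norm (D f x))"
proof -
  have *: "set_integrable lebesgue UNIV (D f)"
    using V_spaceD(2)[OF assms(1)] by (simp add: set_integrable_def)
  then show 1: "set_integrable lebesgue S (D f)" by (rule set_integrable_subset) (use assms in auto)
  show "set_integrable lebesgue S (\<lambda>x. norm (D f x))" by (rule set_integrable_norm[OF 1])
qed

lemma V_variation_on_nonneg: "0 \<le> variation_on S f"
  unfolding set_lebesgue_integral_def by (intro integral_nonneg_AE) auto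

lemma V_variation_on_mono:
  assumes "f \<in> V_space" "S \<in> sets lebesgue" "T \<in> sets lebesgue" "S \<subseteq> T"
  shows "variation_on S f \<le> variation_on T f"
  using V_set_integrable(2)[OF assms(1)] assms(2-)
  unfolding set_lebesgue_integral_def set_integrable_def
  by (intro integral_mono) (auto simp: indicator_def)

lemma V_increment_le:
  assumes "f \<in> V_space" "a \<le> b"
  shows "norm (f b - f a) \<le> variation_on {a..b} f"
    and "f b - f a = (LINT x:{a..b}|lebesgue. D f x)"
proof -
  have 1: "(D f has_integral (LINT x:{a..b}|lebesgue. D f x)) {a..b}"
    by (rule has_integral_set_lebesgue[OF V_set_integrable(1)[OF assms(1)]]) simp
  have 2: "(D f has_integral (f b - f a)) {a..b}"
    by (rule abs_continuous_fundamental_theorem[OF V_spaceD(1)[OF assms(1)] assms(2)])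
  show *: "f b - f a = (LINT x:{a..b}|lebesgue. D f x)" by (rule has_integral_unique[OF 2 1])
  have "norm (LINT x:{a..b}|lebesgue. D f x) \<le> (LINT x:{a..b}|lebesgue. norm (D f x))"
    using integral_norm_bound[of lebesgue "\<lambda>x. indicator {a..b} x *\<^sub>R D f x"]
    by (simp add: set_lebesgue_integral_def)
  then show "norm (f b - f a) \<le> variation_on {a..b} f" by (simp add: *)
qed

text \<open>
  This is the source of boundedness of the elements of \<open>V(\<real>)\<close>.
\<close>

lemma V_oscillation_le: "f \<in> V_space \<Longrightarrow> norm (f b - f a) \<le> V_variation f"
proof -
  assume f: "f \<in> V_space"
  have *: "norm (f b - f a) \<le> V_variation f" if "a \<le> b" for a b
    using V_increment_le(1)[OF f that] V_variation_on_mono[OF f, of "{a..b}" UNIV] by (simp add: V_variation_UNIV)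
  then show ?thesis using *[of a b] *[of b a] by (cases "a \<le> b") (auto simp: norm_minus_commute)
qed

lemma V_bounded: "f \<in> V_space \<Longrightarrow> norm (f x) \<le> norm (f 0) + V_variation f"
  using V_oscillation_le[of f x 0] norm_triangle_sub[of "f x" "f 0"] by simp

text \<open>
  For a continuous function the essential supremum bounds every value: a set where it is exceeded
  is open, and a nonempty open set is not negligible. Boundedness of \<open>f\<close> makes the essential supremum
  finite, so that its conversion to a real number is faithful.
\<close>

lemma Linf_norm_upper:
  assumes f: "f \<in> V_space"
  shows "norm (f x) \<le> Linf_norm f"
proof -
  have "(\<lambda>x. ereal (norm (f x))) \<in> borel_measurable borel"
    using V_spaceD(3)[OF f] by (intro borel_measurable_continuous_onI continuous_intros) auto
  then have meas: "(\<lambda>x. ereal (norm (f x))) \<in> borel_measurable lebesgue" 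
    by (simp add: measurable_completion)
  let ?e = "esssup lebesgue (\<lambda>x. ereal (norm (f x)))"
  have "?e \<le> ereal (norm (f 0) + V_variation f)"
    using V_bounded[OF f] by (intro esssup_I meas) auto
  moreover have *: "ereal (norm (f x)) \<le> ?e" for x
  proof (rule ccontr)
    assume "\<not> ereal (norm (f x)) \<le> ?e"
    then have "?e < ereal (norm (f x))" by simp
    from ereal_dense2[OF this] obtain c where c: "?e < ereal c" "ereal c < ereal (norm (f x))"
      by blast
    have "open {y. c < norm (f y)}"
      using V_spaceD(3)[OF f] by (intro open_Collect_less continuous_intros) auto
    moreover have "x \<in> {y. c < norm (f y)}" using c by simp
    ultimately have "\<not> negligible {y. c < norm (f y)}" using open_not_negligible by blast
    moreover have "AE y in lebesgue. ereal (norm (f y)) \<le> ?e" by (rule esssup_AE)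
    then have "AE y in lebesgue. \<not> c < norm (f y)"
    proof (rule AE_mp, intro AE_I2 impI)
      fix y assume "ereal (norm (f y)) \<le> ?e"
      then have "ereal (norm (f y)) < ereal c" using c by order
      then show "\<not> c < norm (f y)" by simp
    qed
    then have "negligible {y. c < norm (f y)}"
      using \<open>open {y. c < norm (f y)}\<close>
      by (subst negligible_iff_null_sets, subst AE_iff_null_sets) (auto simp: lborelD)
    ultimately show False by blast
  qed
  ultimately obtain c where "?e = ereal c" by (cases ?e) (use *[of 0] in auto)
  with *[of x] show ?thesis by (simp add: Linf_norm_def)
qed

lemma Linf_norm_least:
  assumes f: "f \<in> V_space" and C: "\<And>x. norm (f x) \<le> C"
  shows "Linf_norm f \<le> C"
proof -
  have "(\<lambda>x. ereal (norm (f x))) \<in> borel_measurable borel"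
    using V_spaceD(3)[OF f] by (intro borel_measurable_continuous_onI continuous_intros) auto
  then have meas: "(\<lambda>x. ereal (norm (f x))) \<in> borel_measurable lebesgue" 
    by (simp add: measurable_completion)
  let ?e = "esssup lebesgue (\<lambda>x. ereal (norm (f x)))"
  have "?e \<le> ereal C" using C by (intro esssup_I meas) auto
  moreover have "0 \<le> C" using C[of 0] norm_ge_zero[of "f 0"] by linarith
  ultimately show ?thesis unfolding Linf_norm_def by (cases ?e) auto
qed

lemma Linf_norm_nonneg: "f \<in> V_space \<Longrightarrow> 0 \<le> Linf_norm f"
  using Linf_norm_upper[of f 0] norm_ge_zero[of "f 0"] by linarith

text \<open>
  All operations on \<open>V(\<real>)\<close> needed below have a derivative of the form \<open>A f' + B g'\<close> with bounded
  continuous \<open>A\<close> and \<open>B\<close>. Estimating the variation on every measurable set, not only on the whole line,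
  gives the bounds on the tails as well.
\<close>

lemma V_combination:
  assumes f: "f \<in> V_space" and g: "g \<in> V_space"
    and h: "\<And>x y. norm (h y - h x) \<le> \<alpha> * norm (f y - f x) + \<beta> * norm (g y - g x)"
    and A: "continuous_on UNIV A" "\<And>x. norm (A x) \<le> \<alpha>"
    and B: "continuous_on UNIV B" "\<And>x. norm (B x) \<le> \<beta>"
    and deriv: "\<And>x. (f has_vector_derivative D f x) (at x) \<Longrightarrow> (g has_vector_derivative D g x) (at x) \<Longrightarrow>
       (h has_vector_derivative A x * D f x + B x * D g x) (at x)"
  shows "h \<in> V_space"
    "\<And>S. S \<in> sets lebesgue \<Longrightarrow> variation_on S h \<le> \<alpha> * variation_on S f + \<beta> * variation_on S g"
proof -
  have ab: "0 \<le> \<alpha>" "0 \<le> \<beta>"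
    using A(2)[of 0] B(2)[of 0] norm_ge_zero[of "A 0"] norm_ge_zero[of "B 0"] by linarith+
  define N where "N = {x. \<not> f differentiable (at x)} \<union> {x. \<not> g differentiable (at x)}"
  have N: "negligible N" unfolding N_def by (intro negligible_Un V_spaceD f g)
  have Dh: "D h x = A x * D f x + B x * D g x" if "x \<notin> N" for x
    using that by (intro vector_derivative_at deriv V_space_has_derivative) (auto simp: N_def)
  have int: "integrable lebesgue (\<lambda>x. C x * D k x)"
    if "continuous_on UNIV C" "\<And>x. norm (C x) \<le> c" "k \<in> V_space" for C c k
  proof (rule Bochner_Integration.integrable_bound)
    show "integrable lebesgue (\<lambda>x. c * norm (D k x))"
      using V_spaceD(2)[OF \<open>k \<in> _\<close>] by (intro integrable_mult_right integrable_norm)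
    have "C \<in> borel_measurable borel" using that(1) by (intro borel_measurable_continuous_onI)
    then have "C \<in> borel_measurable lebesgue" by (simp add: measurable_completion)
    then show "(\<lambda>x. C x * D k x) \<in> borel_measurable lebesgue"
      using V_spaceD(2)[OF \<open>k \<in> _\<close>] by (intro borel_measurable_times) auto
    have "c \<ge> 0" using that(2)[of 0] norm_ge_zero[of "C 0"] by linarith
    then show "AE x in lebesgue. norm (C x * D k x) \<le> norm (c * norm (D k x))"
      using that(2) by (auto simp: norm_mult intro!: mult_right_mono)
  qed
  show hV: "h \<in> V_space"
  proof (rule V_spaceI[OF _ N Dh])
    show "abs_continuous_on UNIV h"
      by (rule abs_continuous_of_increments[OF _ _ h ab]) (intro V_spaceD f g)+
    show "integrable lebesgue (\<lambda>x. A x * D f x + B x * D g x)"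
      by (intro Bochner_Integration.integrable_add int[OF A f] int[OF B g])
  qed
  fix S :: "real set" assume S: "S \<in> sets lebesgue"
  have "variation_on S h \<le> (LINT x:S|lebesgue. \<alpha> * norm (D f x) + \<beta> * norm (D g x))"
    unfolding set_lebesgue_integral_def
  proof (rule integral_mono_AE)
    show "integrable lebesgue (\<lambda>x. indicator S x *\<^sub>R norm (D h x))"
      using V_set_integrable(2)[OF hV S] by (simp add: set_integrable_def)
    show "integrable lebesgue (\<lambda>x. indicator S x *\<^sub>R (\<alpha> * norm (D f x) + \<beta> * norm (D g x)))"
      using V_set_integrable(2)[OF f S] V_set_integrable(2)[OF g S]
      by (auto simp: set_integrable_def algebra_simps)
    have "AE x in lebesgue. x \<notin> N" using N by (intro AE_not_in) (simp add: negligible_iff_null_sets)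
    then show "AE x in lebesgue. indicator S x *\<^sub>R norm (D h x)
        \<le> indicator S x *\<^sub>R (\<alpha> * norm (D f x) + \<beta> * norm (D g x))"
    proof (rule AE_mp, intro AE_I2 impI)
      fix x assume "x \<notin> N"
      have "norm (D h x) \<le> norm (A x) * norm (D f x) + norm (B x) * norm (D g x)"
        unfolding Dh[OF \<open>x \<notin> N\<close>] by (metis norm_mult norm_triangle_ineq)
      also have "\<dots> \<le> \<alpha> * norm (D f x) + \<beta> * norm (D g x)"
        by (intro add_mono mult_right_mono A B) auto
      finally show "indicator S x *\<^sub>R norm (D h x)
        \<le> indicator S x *\<^sub>R (\<alpha> * norm (D f x) + \<beta> * norm (D g x))"
        by (auto simp: indicator_def)
    qed
  qed
  also have "\<dots> = \<alpha> * variation_on S f + \<beta> * variation_on S g"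
    using V_set_integrable(2)[OF f S] V_set_integrable(2)[OF g S]
    by (subst set_integral_add) (auto intro: set_integrable_mult_right)
  finally show "variation_on S h \<le> \<alpha> * variation_on S f + \<beta> * variation_on S g" .
qed

lemma V_const:
  shows "(\<lambda>x. c) \<in> V_space" "D (\<lambda>x. c) = (\<lambda>x. 0)" "variation_on S (\<lambda>x. c) = 0" "V_norm (\<lambda>x. c) = norm c"
    "Linf_norm (\<lambda>x. c) = norm c"
proof -
  show 0: "D (\<lambda>x. c) = (\<lambda>x. 0)" by (intro ext vector_derivative_at) (auto intro: derivative_eq_intros)
  show 1: "(\<lambda>x. c) \<in> V_space"
    by (rule V_spaceI[where N="{}" and g="\<lambda>x. 0"]) (auto simp: 0 intro: abs_continuous_Lipschitz[where C=0])
  show 2: "variation_on S (\<lambda>x. c) = 0" for S by (simp add: 0 set_lebesgue_integral_def)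
  show "Linf_norm (\<lambda>x. c) = norm c"
    by (intro antisym Linf_norm_least[OF 1] Linf_norm_upper[OF 1]) simp
  then show "V_norm (\<lambda>x. c) = norm c" unfolding V_norm_def V_variation_UNIV by (simp add: 2)
qed

lemma V_add:
  assumes f: "f \<in> V_space" and g: "g \<in> V_space"
  shows "(\<lambda>x. f x + g x) \<in> V_space"
    "\<And>S. S \<in> sets lebesgue \<Longrightarrow> variation_on S (\<lambda>x. f x + g x) \<le> variation_on S f + variation_on S g"
    "Linf_norm (\<lambda>x. f x + g x) \<le> Linf_norm f + Linf_norm g"
    "V_norm (\<lambda>x. f x + g x) \<le> V_norm f + V_norm g"
proof -
  note * = V_combination[OF f g, where h="\<lambda>x. f x + g x" and \<alpha>=1 and \<beta>=1 and A="\<lambda>_. 1" and B="\<lambda>_. 1"]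
  have inc: "norm (f y + g y - (f x + g x)) \<le> 1 * norm (f y - f x) + 1 * norm (g y - g x)" for x y
    using norm_triangle_ineq[of "f y - f x" "g y - g x"] by (simp add: algebra_simps)
  show 1: "(\<lambda>x. f x + g x) \<in> V_space" using inc by (intro *(1)) (auto intro!: derivative_eq_intros)
  show 2: "variation_on S (\<lambda>x. f x + g x) \<le> variation_on S f + variation_on S g" if "S \<in> sets lebesgue" for S
    using *(2)[of S] inc that by (auto intro!: derivative_eq_intros)
  show 3: "Linf_norm (\<lambda>x. f x + g x) \<le> Linf_norm f + Linf_norm g"
    by (intro Linf_norm_least 1 norm_triangle_le add_mono Linf_norm_upper f g)
  show "V_norm (\<lambda>x. f x + g x) \<le> V_norm f + V_norm g"
    using 2[of UNIV] 3 by (simp add: V_norm_def V_variation_UNIV)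
qed

text \<open>
  The variation over a set is bounded by the product rule; adding the supremum norms makes \<open>V(\<real>)\<close>
  a normed algebra.
\<close>

lemma V_mult:
  assumes f: "f \<in> V_space" and g: "g \<in> V_space"
  shows "(\<lambda>x. f x * g x) \<in> V_space"
    "\<And>S. S \<in> sets lebesgue \<Longrightarrow>
       variation_on S (\<lambda>x. f x * g x) \<le> Linf_norm g * variation_on S f + Linf_norm f * variation_on S g"
    "Linf_norm (\<lambda>x. f x * g x) \<le> Linf_norm f * Linf_norm g"
    "V_norm (\<lambda>x. f x * g x) \<le> V_norm f * V_norm g"
proof -
  note * = V_combination[OF f g, where h="\<lambda>x. f x * g x" and \<alpha>="Linf_norm g" and \<beta>="Linf_norm f" and A=g and B=f]
  have inc: "norm (f y * g y - f x * g x) \<le> Linf_norm g * norm (f y - f x) + Linf_norm f * norm (g y - g x)" for x y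
  proof -
    have "f y * g y - f x * g x = g y * (f y - f x) + f x * (g y - g x)" by (simp add: algebra_simps)
    also have "norm \<dots> \<le> norm (g y) * norm (f y - f x) + norm (f x) * norm (g y - g x)"
      by (metis norm_mult norm_triangle_ineq)
    also have "\<dots> \<le> Linf_norm g * norm (f y - f x) + Linf_norm f * norm (g y - g x)"
      by (intro add_mono mult_right_mono Linf_norm_upper f g) auto
    finally show ?thesis .
  qed
  have der: "((\<lambda>x. f x * g x) has_vector_derivative g x * D f x + f x * D g x) (at x)"
    if "(f has_vector_derivative D f x) (at x)" "(g has_vector_derivative D g x) (at x)" for x
    using has_vector_derivative_mult[OF that] by (simp add: algebra_simps)
  show 1: "(\<lambda>x. f x * g x) \<in> V_space"
    by (intro *(1) inc der V_spaceD(3) Linf_norm_upper f g)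
  show 2: "variation_on S (\<lambda>x. f x * g x) \<le> Linf_norm g * variation_on S f + Linf_norm f * variation_on S g"
    if "S \<in> sets lebesgue" for S
    by (intro *(2) inc der V_spaceD(3) Linf_norm_upper f g that)
  show 3: "Linf_norm (\<lambda>x. f x * g x) \<le> Linf_norm f * Linf_norm g"
    unfolding norm_mult[symmetric] using Linf_norm_upper f g Linf_norm_nonneg
    by (intro Linf_norm_least 1) (auto simp: norm_mult intro!: mult_mono)
  have "0 \<le> variation_on UNIV f * variation_on UNIV g"
    by (intro mult_nonneg_nonneg V_variation_on_nonneg)
  then show "V_norm (\<lambda>x. f x * g x) \<le> V_norm f * V_norm g"
    using 2[of UNIV] 3 unfolding V_norm_def V_variation_UNIV by (simp add: algebra_simps)
qed

lemma V_inverse: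
  assumes f: "f \<in> V_space" and C: "\<And>x. f x \<noteq> 0" "\<And>x. norm (1 / f x) \<le> C"
  shows "(\<lambda>x. 1 / f x) \<in> V_space"
    "\<And>S. S \<in> sets lebesgue \<Longrightarrow> variation_on S (\<lambda>x. 1 / f x) \<le> C\<^sup>2 * variation_on S f"
    "Linf_norm (\<lambda>x. 1 / f x) \<le> C"
proof -
  note * = V_combination[OF f f, where h="\<lambda>x. 1 / f x" and \<alpha>="C\<^sup>2" and \<beta>=0 and A="\<lambda>x. - (1 / f x)\<^sup>2" and B="\<lambda>x. 0"]
  have C0: "0 \<le> C" using C(2)[of 0] norm_ge_zero[of "1 / f 0"] by linarith
  have inc: "norm (1 / f y - 1 / f x) \<le> C\<^sup>2 * norm (f y - f x) + 0 * norm (f y - f x)" for x y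
  proof -
    have "1 / f y - 1 / f x = (1 / f y) * (1 / f x) * (f x - f y)" using C(1) by (simp add: field_simps)
    then have "norm (1 / f y - 1 / f x) = norm (1 / f y) * norm (1 / f x) * norm (f y - f x)"
      by (metis norm_minus_commute norm_mult)
    also have "\<dots> \<le> C * C * norm (f y - f x)"
      using C0 by (intro mult_right_mono mult_mono C) auto
    finally show ?thesis by (simp add: power2_eq_square)
  qed
  have der: "((\<lambda>x. 1 / f x) has_vector_derivative - (1 / f x)\<^sup>2 * D f x + 0 * D f x) (at x)"
    if d: "(f has_vector_derivative D f x) (at x)" "(f has_vector_derivative D f x) (at x)" for x
  proof -
    have "((\<lambda>z. 1 / z) has_field_derivative - (1 / f x)\<^sup>2) (at (f x))"
      using C(1)[of x] by (auto intro!: derivative_eq_intros simp: power2_eq_square)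
    from field_vector_diff_chain_at[OF d(1) this] show ?thesis by (simp add: o_def algebra_simps)
  qed
  have A: "continuous_on UNIV (\<lambda>x. - (1 / f x)\<^sup>2)"
    using C(1) V_spaceD(3)[OF f] by (intro continuous_intros) auto
  have A2: "norm (- (1 / f x)\<^sup>2) \<le> C\<^sup>2" for x
    using C(2)[of x] by (simp only: norm_minus_cancel norm_power) (rule power_mono, auto)
  show 1: "(\<lambda>x. 1 / f x) \<in> V_space"
    by (rule *(1)[OF inc A A2 _ _ der]) auto
  show 2: "variation_on S (\<lambda>x. 1 / f x) \<le> C\<^sup>2 * variation_on S f" if "S \<in> sets lebesgue" for S
    using *(2)[OF inc A A2 _ _ der that] by auto
  show "Linf_norm (\<lambda>x. 1 / f x) \<le> C"
    by (intro Linf_norm_least 1 C)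
qed

lemma V_diff:
  assumes f: "f \<in> V_space" and g: "g \<in> V_space"
  shows "(\<lambda>x. f x - g x) \<in> V_space"
proof -
  have "(\<lambda>x. f x + (- 1) * g x) \<in> V_space" by (intro V_add V_mult f g V_const)
  then show ?thesis by simp
qed

lemma V_shift:
  assumes f: "f \<in> V_space"
  shows "(\<lambda>x. f (x + h)) \<in> V_space" "V_norm (\<lambda>x. f (x + h)) = V_norm f"
    "Linf_norm (\<lambda>x. f (x + h)) = Linf_norm f"
proof -
  have N: "negligible ((\<lambda>x. - h + x) ` {x. \<not> f differentiable (at x)})"
    by (intro negligible_translation V_spaceD f)
  have Df: "D (\<lambda>x. f (x + h)) x = D f (x + h)" if "x \<notin> (\<lambda>x. - h + x) ` {x. \<not> f differentiable (at x)}" for x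
  proof -
    have "f differentiable (at (x + h))"
      using that by (auto simp: image_iff dest: spec[of _ "x + h"])
    then have "(f has_vector_derivative D f (x + h)) (at (x + h))" by (rule V_space_has_derivative)
    moreover have "((\<lambda>x. x + h) has_vector_derivative 1) (at x)" by (auto intro!: derivative_eq_intros)
    ultimately show ?thesis
      using vector_diff_chain_at[of "\<lambda>x. x + h" 1 x f "D f (x + h)"] by (intro vector_derivative_at) (simp add: o_def)
  qed
  have AC: "abs_continuous_on UNIV (\<lambda>x. f (x + h))"
    unfolding abs_continuous_on_def
  proof (intro allI impI)
    fix e :: real assume "0 < e"
    then obtain d where d: "d > 0" "\<forall>(n::nat) l u.
        (\<forall>k<n. l k \<le> u k \<and> {l k..u k} \<subseteq> UNIV) \<longrightarrow>
        disjoint_family_on (\<lambda>k. {l k<..<u k}) {..<n} \<longrightarrow>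
        (\<Sum>k<n. u k - l k) < d \<longrightarrow> (\<Sum>k<n. norm (f (u k) - f (l k))) < e"
      using V_spaceD(1)[OF f] unfolding abs_continuous_on_def by blast
    have "(\<Sum>k<n. norm (f (u k + h) - f (l k + h))) < e"
      if "\<forall>k<n. l k \<le> u k" "disjoint_family_on (\<lambda>k. {l k<..<u k}) {..<n}" "(\<Sum>k<n. u k - l k) < d"
      for n :: nat and l u
    proof (rule d(2)[rule_format])
      show "disjoint_family_on (\<lambda>k. {l k + h<..<u k + h}) {..<n}"
        using that(2) unfolding disjoint_family_on_def by (force simp: disjoint_iff)
    qed (use that in auto)
    then show "\<exists>\<delta>>0. \<forall>(n::nat) l u.
        (\<forall>k<n. l k \<le> u k \<and> {l k..u k} \<subseteq> UNIV) \<longrightarrow>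
        disjoint_family_on (\<lambda>k. {l k<..<u k}) {..<n} \<longrightarrow>
        (\<Sum>k<n. u k - l k) < \<delta> \<longrightarrow> (\<Sum>k<n. norm (f (u k + h) - f (l k + h))) < e"
      using d(1) by blast
  qed
  have int: "integrable lebesgue (\<lambda>x. D f (x + h))"
    using lebesgue_integrable_real_affine[OF V_spaceD(2)[OF f], of 1 h] by (simp add: add.commute)
  show 1: "(\<lambda>x. f (x + h)) \<in> V_space" by (rule V_spaceI[OF AC N Df int])
  have "V_variation (\<lambda>x. f (x + h)) = (LINT x|lebesgue. norm (D f (x + h)))"
    unfolding V_variation_def
  proof (rule integral_cong_AE)
    have "AE x in lebesgue. x \<notin> (\<lambda>x. - h + x) ` {x. \<not> f differentiable (at x)}"
      using N by (intro AE_not_in) (simp add: negligible_iff_null_sets)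
    then show "AE x in lebesgue. norm (D (\<lambda>x. f (x + h)) x) = norm (D f (x + h))"
      
    proof (rule AE_mp, intro AE_I2 impI)
      fix x assume "x \<notin> (\<lambda>x. - h + x) ` {x. \<not> f differentiable (at x)}"
      then show "norm (D (\<lambda>x. f (x + h)) x) = norm (D f (x + h))" by (subst Df) auto
    qed
  qed (use V_spaceD(2)[OF 1] int in auto)
  also have "\<dots> = V_variation f"
    unfolding V_variation_def
    using lebesgue_integral_real_affine[of 1 "\<lambda>x. norm (D f x)" h] by (simp add: add.commute)
  finally have 2: "V_variation (\<lambda>x. f (x + h)) = V_variation f" .
  show 3: "Linf_norm (\<lambda>x. f (x + h)) = Linf_norm f"
  proof (rule antisym)
    show "Linf_norm (\<lambda>x. f (x + h)) \<le> Linf_norm f" by (intro Linf_norm_least 1 Linf_norm_upper f)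
    show "Linf_norm f \<le> Linf_norm (\<lambda>x. f (x + h))"
      using Linf_norm_upper[OF 1, of "x - h" for x] by (intro Linf_norm_least f) simp
  qed
  show "V_norm (\<lambda>x. f (x + h)) = V_norm f" by (simp add: V_norm_def 2 3)
qed

lemma V_norm_bounds:
  assumes "f \<in> V_space"
  shows "0 \<le> V_norm f" "Linf_norm f \<le> V_norm f" "S \<in> sets lebesgue \<Longrightarrow> variation_on S f \<le> V_norm f"
  using Linf_norm_nonneg[OF assms] V_variation_on_nonneg[of UNIV f] V_variation_on_mono[OF assms, of S UNIV]
  by (auto simp: V_norm_def V_variation_UNIV)


section \<open>The algebra of symbols\<close>

lemma variation_on_tail_tendsto:
  assumes f: "f \<in> V_space"
  shows "((\<lambda>m. variation_on (UNIV - {- m..m}) f) \<longlongrightarrow> 0) at_top"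
proof -
  have "((\<lambda>m. LINT x|lebesgue. indicator (UNIV - {- m..m}) x *\<^sub>R norm (D f x)) \<longlongrightarrow> (LINT x::real|lebesgue. (0::real))) at_top"
  proof (rule integral_dominated_convergence_at_top[where w="\<lambda>x. norm (D f x)" and f="\<lambda>x. 0"
        and s="\<lambda>m x. indicator (UNIV - {- m..m}) x *\<^sub>R norm (D f x)"])
    show "integrable lebesgue (\<lambda>x. norm (D f x))" using V_spaceD(2)[OF f] by simp
    show "(\<lambda>x. indicator (UNIV - {- m..m}) x *\<^sub>R norm (D f x)) \<in> borel_measurable lebesgue" for m
      using V_set_integrable(2)[OF f, of "UNIV - {- m..m}"] by (auto simp: set_integrable_def)
    show "AE x in lebesgue. ((\<lambda>m. indicator (UNIV - {- m..m}) x *\<^sub>R norm (D f x)) \<longlongrightarrow> 0) at_top"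
    proof (intro AE_I2 tendsto_eventually)
      fix x :: real
      show "\<forall>\<^sub>F m in at_top. indicator (UNIV - {- m..m}) x *\<^sub>R norm (D f x) = 0"
        using eventually_ge_at_top[of "\<bar>x\<bar>"] by eventually_elim (auto simp: indicator_def)
    qed
  qed (auto simp: indicator_def)
  then show ?thesis by (simp add: set_lebesgue_integral_def)
qed

text \<open>
  The increments from \<open>0\<close> are integrals of the integrable derivative over growing intervals.
\<close>

lemma V_convergent:
  assumes f: "f \<in> V_space"
  shows "\<exists>l. (f \<longlongrightarrow> l) at_top" "\<exists>l. (f \<longlongrightarrow> l) at_bot"
proof -
  have int: "(\<lambda>x. indicator S x *\<^sub>R D f x) \<in> borel_measurable lebesgue" if "S \<in> sets lebesgue" for S
    using V_set_integrable(1)[OF f that] by (auto simp: set_integrable_def)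
  have 1: "((\<lambda>y. LINT x|lebesgue. indicator {0..y} x *\<^sub>R D f x) \<longlongrightarrow> (LINT x|lebesgue. indicator {0..} x *\<^sub>R D f x)) at_top"
  proof (rule integral_dominated_convergence_at_top[where w="\<lambda>x. norm (D f x)"])
    show "integrable lebesgue (\<lambda>x. norm (D f x))" using V_spaceD(2)[OF f] by simp
    show "(\<lambda>x. indicator {0..} x *\<^sub>R D f x) \<in> borel_measurable lebesgue"
      "(\<lambda>x. indicator {0..y} x *\<^sub>R D f x) \<in> borel_measurable lebesgue" for y by (auto intro: int)
    show "AE x in lebesgue. ((\<lambda>y. indicator {0..y} x *\<^sub>R D f x) \<longlongrightarrow> indicator {0..} x *\<^sub>R D f x) at_top"
    proof (intro AE_I2 tendsto_eventually)
      fix x :: real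
      show "\<forall>\<^sub>F y in at_top. indicator {0..y} x *\<^sub>R D f x = indicator {0..} x *\<^sub>R D f x"
        using eventually_ge_at_top[of "x"] by eventually_elim (auto simp: indicator_def)
    qed
  qed (auto simp: indicator_def)
  have 2: "((\<lambda>y. LINT x|lebesgue. indicator {- y..0} x *\<^sub>R D f x) \<longlongrightarrow> (LINT x|lebesgue. indicator {..0} x *\<^sub>R D f x)) at_top"
  proof (rule integral_dominated_convergence_at_top[where w="\<lambda>x. norm (D f x)"])
    show "integrable lebesgue (\<lambda>x. norm (D f x))" using V_spaceD(2)[OF f] by simp
    show "(\<lambda>x. indicator {..0} x *\<^sub>R D f x) \<in> borel_measurable lebesgue"
      "(\<lambda>x. indicator {- y..0} x *\<^sub>R D f x) \<in> borel_measurable lebesgue" for y by (auto intro: int)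
    show "AE x in lebesgue. ((\<lambda>y. indicator {- y..0} x *\<^sub>R D f x) \<longlongrightarrow> indicator {..0} x *\<^sub>R D f x) at_top"
    proof (intro AE_I2 tendsto_eventually)
      fix x :: real
      show "\<forall>\<^sub>F y in at_top. indicator {- y..0} x *\<^sub>R D f x = indicator {..0} x *\<^sub>R D f x"
        using eventually_ge_at_top[of "- x"] by eventually_elim (auto simp: indicator_def)
    qed
  qed (auto simp: indicator_def)
  have "\<forall>\<^sub>F y in at_top. f 0 + (LINT x|lebesgue. indicator {0..y} x *\<^sub>R D f x) = f y"
    using eventually_ge_at_top[of 0]
  proof eventually_elim
    case (elim y)
    then show ?case using V_increment_le(2)[OF f, of 0 y] by (simp add: set_lebesgue_integral_def algebra_simps)
  qed
  moreover have "((\<lambda>y. f 0 + (LINT x|lebesgue. indicator {0..y} x *\<^sub>R D f x)) \<longlongrightarrow> f 0 + (LINT x|lebesgue. indicator {0..} x *\<^sub>R D f x)) at_top"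
    by (intro tendsto_intros 1)
  ultimately show "\<exists>l. (f \<longlongrightarrow> l) at_top" by (blast intro: Lim_transform_eventually)
  have "\<forall>\<^sub>F y in at_top. f 0 - (LINT x|lebesgue. indicator {- y..0} x *\<^sub>R D f x) = f (- y)"
    using eventually_ge_at_top[of 0]
  proof eventually_elim
    case (elim y)
    then show ?case using V_increment_le(2)[OF f, of "- y" 0] by (simp add: set_lebesgue_integral_def algebra_simps)
  qed
  moreover have "((\<lambda>y. f 0 - (LINT x|lebesgue. indicator {- y..0} x *\<^sub>R D f x)) \<longlongrightarrow> f 0 - (LINT x|lebesgue. indicator {..0} x *\<^sub>R D f x)) at_top"
    by (intro tendsto_intros 2)
  ultimately have "\<exists>l. ((\<lambda>y. f (- y)) \<longlongrightarrow> l) at_top" by (blast intro: Lim_transform_eventually)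
  then show "\<exists>l. (f \<longlongrightarrow> l) at_bot" by (simp add: filterlim_at_bot_mirror)
qed

text \<open>
  The filter along which the continuation to \<open>[-\<infinity>, \<infinity>]\<close> is a limit, so that finite and infinite
  points need no separate treatment.
\<close>

definition ext_filter :: "ereal \<Rightarrow> real filter" where
  "ext_filter x = (case x of ereal y \<Rightarrow> principal {y} | PInfty \<Rightarrow> at_top | MInfty \<Rightarrow> at_bot)"

lemma ext_filter_ne_bot: "ext_filter x \<noteq> bot"
  by (cases x) (auto simp: ext_filter_def principal_eq_bot_iff)

lemma ext_infty_ereal [simp]: "ext_infty f (ereal y) = f y"
  by (simp add: ext_infty_def)

lemma ext_infty_eqI: "(f \<longlongrightarrow> l) (ext_filter x) \<Longrightarrow> ext_infty f x = l"
proof (cases x)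
  case (real y)
  assume "(f \<longlongrightarrow> l) (ext_filter x)"
  then have "(f \<longlongrightarrow> l) (principal {y})" by (simp add: ext_filter_def real)
  from tendsto_unique[OF _ tendsto_principal_singleton this] show ?thesis
    by (simp add: real principal_eq_bot_iff)
qed (auto simp: ext_filter_def ext_infty_def intro: tendsto_Lim)

lemma V_tendsto_ext_infty:
  assumes "f \<in> V_space"
  shows "(f \<longlongrightarrow> ext_infty f x) (ext_filter x)"
  using V_convergent[OF assms]
  by (cases x) (auto simp: ext_filter_def ext_infty_def tendsto_Lim tendsto_principal_singleton)

lemma ext_infty_norm_le:
  assumes "f \<in> V_space" "\<And>x. norm (f x) \<le> C"
  shows "norm (ext_infty f x) \<le> C"
  by (rule tendsto_upperbound[OF tendsto_norm[OF V_tendsto_ext_infty[OF assms(1), of x]] _ ext_filter_ne_bot])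
    (use assms(2) in auto)

lemma ext_infty_norm_le_Linf: "f \<in> V_space \<Longrightarrow> norm (ext_infty f x) \<le> Linf_norm f"
  by (intro ext_infty_norm_le Linf_norm_upper)

lemma ext_infty_diff:
  "f \<in> V_space \<Longrightarrow> g \<in> V_space \<Longrightarrow> ext_infty (\<lambda>y. f y - g y) x = ext_infty f x - ext_infty g x"
  by (intro ext_infty_eqI tendsto_intros V_tendsto_ext_infty)

text \<open>
  A majorant in place of a supremum: statements of the form \<open>SUP \<dots> \<longlongrightarrow> 0\<close> can then be compared
  termwise, without checking boundedness each time.
\<close>

definition uniformly_vanishing :: "'h filter \<Rightarrow> ('h \<Rightarrow> 'i set) \<Rightarrow> ('h \<Rightarrow> 'i \<Rightarrow> real) \<Rightarrow> bool" where
  "uniformly_vanishing F A X \<longleftrightarrow> (\<exists>S. (S \<longlongrightarrow> 0) F \<and> (\<forall>\<^sub>F h in F. \<forall>i\<in>A h. X h i \<le> S h))"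

lemma uniformly_vanishing_iff_SUP:
  assumes "\<forall>\<^sub>F h in F. A h \<noteq> {} \<and> (\<forall>i\<in>A h. 0 \<le> X h i) \<and> bdd_above (X h ` A h)"
  shows "((\<lambda>h. SUP i\<in>A h. X h i) \<longlongrightarrow> 0) F \<longleftrightarrow> uniformly_vanishing F A X"
proof
  assume L: "((\<lambda>h. SUP i\<in>A h. X h i) \<longlongrightarrow> 0) F"
  have "\<forall>\<^sub>F h in F. \<forall>i\<in>A h. X h i \<le> (SUP i\<in>A h. X h i)"
    using assms by eventually_elim (auto intro: cSUP_upper)
  with L show "uniformly_vanishing F A X" unfolding uniformly_vanishing_def by blast
next
  assume "uniformly_vanishing F A X"
  then obtain S where S: "(S \<longlongrightarrow> 0) F" "\<forall>\<^sub>F h in F. \<forall>i\<in>A h. X h i \<le> S h"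
    unfolding uniformly_vanishing_def by blast
  show "((\<lambda>h. SUP i\<in>A h. X h i) \<longlongrightarrow> 0) F"
  proof (rule tendsto_sandwich[OF _ _ tendsto_const S(1)])
    show "\<forall>\<^sub>F h in F. 0 \<le> (SUP i\<in>A h. X h i)"
      using assms
    proof eventually_elim
      case (elim h)
      then obtain i where "i \<in> A h" by blast
      with elim have "X h i \<le> (SUP i\<in>A h. X h i)" "0 \<le> X h i" by (auto intro: cSUP_upper)
      then show ?case by linarith
    qed
    show "\<forall>\<^sub>F h in F. (SUP i\<in>A h. X h i) \<le> S h"
      using assms S(2) by eventually_elim (auto intro: cSUP_least)
  qed
qed

lemma uniformly_vanishing_zero: "(\<And>h i. i \<in> A h \<Longrightarrow> X h i = 0) \<Longrightarrow> uniformly_vanishing F A X"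
  unfolding uniformly_vanishing_def by (intro exI[of _ "\<lambda>h. 0"]) auto

lemma uniformly_vanishing_bound:
  assumes "uniformly_vanishing F A X" "uniformly_vanishing F A Y"
    and "\<forall>\<^sub>F h in F. \<forall>i\<in>A h. Z h i \<le> C * X h i + C' * Y h i" "0 \<le> C" "0 \<le> C'"
  shows "uniformly_vanishing F A Z"
proof -
  obtain S where S: "(S \<longlongrightarrow> 0) F" "\<forall>\<^sub>F h in F. \<forall>i\<in>A h. X h i \<le> S h"
    using assms(1) unfolding uniformly_vanishing_def by blast
  obtain T where T: "(T \<longlongrightarrow> 0) F" "\<forall>\<^sub>F h in F. \<forall>i\<in>A h. Y h i \<le> T h"
    using assms(2) unfolding uniformly_vanishing_def by blast
  have "\<forall>\<^sub>F h in F. \<forall>i\<in>A h. Z h i \<le> C * S h + C' * T h"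
    using assms(3) S(2) T(2)
  proof eventually_elim
    case (elim h)
    show ?case
    proof
      fix i assume i: "i \<in> A h"
      then have "Z h i \<le> C * X h i + C' * Y h i" using elim by blast
      also have "\<dots> \<le> C * S h + C' * T h"
        using elim i assms(4,5) by (intro add_mono mult_left_mono) auto
      finally show "Z h i \<le> C * S h + C' * T h" .
    qed
  qed
  moreover have "((\<lambda>h. C * S h + C' * T h) \<longlongrightarrow> C * 0 + C' * 0) F"
    by (intro tendsto_intros S T)
  ultimately show ?thesis unfolding uniformly_vanishing_def by auto
qed

text \<open>
  The limit conditions in the definition of \<^const>\<open>E_tilde_V\<close>, with every supremum replaced by a
  vanishing majorant: norm continuity, slow oscillation at the two ends, equicontinuity under
  translation, and uniformly small tails of the variation.
\<close>

definition vanishing_tests :: "(real \<Rightarrow> real \<Rightarrow> complex) \<Rightarrow> bool" where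
  "vanishing_tests a \<longleftrightarrow>
    (\<forall>t>0. uniformly_vanishing (at t within {0<..}) (\<lambda>\<tau>. {\<tau>}) (\<lambda>_ \<tau>. V_norm (\<lambda>x. a \<tau> x - a t x))) \<and>
    (\<forall>F\<in>{at_right 0, at_top}. uniformly_vanishing F (\<lambda>r. {r..2 * r} \<times> {r..2 * r})
       (\<lambda>r (t, \<tau>). Linf_norm (\<lambda>x. a t x - a \<tau> x))) \<and>
    uniformly_vanishing (at 0) (\<lambda>h. {0<..}) (\<lambda>h t. V_norm (\<lambda>x. a t x - a t (x + h))) \<and>
    uniformly_vanishing at_top (\<lambda>m. {0<..}) (\<lambda>m t. variation_on (UNIV - {- m..m}) (a t))"

lemma eventually_pos_at_right_at_top:
  "F \<in> {at_right 0, at_top :: real filter} \<Longrightarrow> \<forall>\<^sub>F r in F. 0 < r"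
  by (auto simp: eventually_at_right_less)

lemma V_norm_diff_le:
  assumes "f \<in> V_space" "g \<in> V_space"
  shows "V_norm (\<lambda>x. f x - g x) \<le> V_norm f + V_norm g"
proof -
  have "V_norm (\<lambda>x. f x + (- 1) * g x) \<le> V_norm f + V_norm (\<lambda>x. - 1 * g x)"
    by (intro V_add V_mult V_const assms)
  also have "V_norm (\<lambda>x. - 1 * g x) \<le> V_norm (\<lambda>x. - 1) * V_norm g"
    by (intro V_mult V_const assms)
  finally show ?thesis by (simp add: V_const)
qed

text \<open>
  For symbols with values in \<open>V(\<real>)\<close> and bounded norms all suprema in the definition are suprema of
  bounded sets, hence equivalent to their majorant forms.
\<close>

lemma E_tilde_V_iff:
  "a \<in> E_tilde_V \<longleftrightarrow> (\<forall>t>0. a t \<in> V_space) \<and> (\<exists>M. \<forall>t>0. V_norm (a t) \<le> M) \<and> vanishing_tests a"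
proof (cases "(\<forall>t>0. a t \<in> V_space) \<and> (\<exists>M. \<forall>t>0. V_norm (a t) \<le> M)")
  case False
  then show ?thesis
    by (auto simp: E_tilde_V_def E_V_def SO_V_def Cb_V_def bdd_above_def)
next
  case True
  then obtain M where aV: "\<And>t. t > 0 \<Longrightarrow> a t \<in> V_space" and M: "\<And>t. t > 0 \<Longrightarrow> V_norm (a t) \<le> M" by blast
  have dV: "(\<lambda>x. a t x - a \<tau> x) \<in> V_space" if "t > 0" "\<tau> > 0" for t \<tau> by (intro V_diff aV that)
  have dM: "V_norm (\<lambda>x. a t x - a \<tau> x) \<le> M + M" if "t > 0" "\<tau> > 0" for t \<tau>
    using V_norm_diff_le[OF aV aV, OF that] M[OF that(1)] M[OF that(2)] by simp
  have b: "bdd_above ((\<lambda>t. V_norm (a t)) ` {0<..})" using M by (auto intro!: bdd_aboveI[of _ M])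
  have 1: "((\<lambda>\<tau>. V_norm (\<lambda>x. a \<tau> x - a t x)) \<longlongrightarrow> 0) (at t within {0<..}) \<longleftrightarrow>
      uniformly_vanishing (at t within {0<..}) (\<lambda>\<tau>. {\<tau>}) (\<lambda>_ \<tau>. V_norm (\<lambda>x. a \<tau> x - a t x))"
    if "t > 0" for t
  proof -
    have "\<forall>\<^sub>F \<tau> in at t within {0<..}. \<tau> > 0" by (simp add: eventually_at_filter)
    then have "\<forall>\<^sub>F \<tau> in at t within {0<..}. {\<tau>} \<noteq> {} \<and> (\<forall>i\<in>{\<tau>}. 0 \<le> V_norm (\<lambda>x. a i x - a t x))
        \<and> bdd_above ((\<lambda>i. V_norm (\<lambda>x. a i x - a t x)) ` {\<tau>})"
      by eventually_elim (use dV that in \<open>auto intro: V_norm_bounds\<close>)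
    from uniformly_vanishing_iff_SUP[OF this] show ?thesis by simp
  qed
  have 2: "((\<lambda>r. SUP (t, \<tau>) \<in> {r..2 * r} \<times> {r..2 * r}. Linf_norm (\<lambda>x. a t x - a \<tau> x)) \<longlongrightarrow> 0) F \<longleftrightarrow>
      uniformly_vanishing F (\<lambda>r. {r..2 * r} \<times> {r..2 * r}) (\<lambda>r (t, \<tau>). Linf_norm (\<lambda>x. a t x - a \<tau> x))"
    if F: "F \<in> {at_right 0, at_top}" for F
  proof (rule uniformly_vanishing_iff_SUP)
    show "\<forall>\<^sub>F r in F. {r..2 * r} \<times> {r..2 * r} \<noteq> {} \<and>
         (\<forall>i\<in>{r..2 * r} \<times> {r..2 * r}. 0 \<le> (case i of (t, \<tau>) \<Rightarrow> Linf_norm (\<lambda>x. a t x - a \<tau> x))) \<and>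
         bdd_above ((\<lambda>i. case i of (t, \<tau>) \<Rightarrow> Linf_norm (\<lambda>x. a t x - a \<tau> x)) ` ({r..2 * r} \<times> {r..2 * r}))"
      using eventually_pos_at_right_at_top[OF F]
    proof eventually_elim
      case (elim r)
      have *: "0 \<le> Linf_norm (\<lambda>x. a t x - a \<tau> x) \<and> Linf_norm (\<lambda>x. a t x - a \<tau> x) \<le> M + M"
        if "t \<in> {r..2 * r}" "\<tau> \<in> {r..2 * r}" for t \<tau>
        using Linf_norm_nonneg[OF dV] order_trans[OF V_norm_bounds(2)[OF dV] dM] that elim by auto
      then show ?case using elim by (auto intro!: bdd_aboveI[of _ "M + M"])
    qed
  qed
  have 3: "((\<lambda>h. SUP t\<in>{0<..}. V_norm (\<lambda>x. a t x - a t (x + h))) \<longlongrightarrow> 0) (at 0) \<longleftrightarrow>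
    uniformly_vanishing (at 0) (\<lambda>h. {0<..}) (\<lambda>h t. V_norm (\<lambda>x. a t x - a t (x + h)))"
  proof (intro uniformly_vanishing_iff_SUP always_eventually allI conjI ballI)
    fix h :: real
    have *: "0 \<le> V_norm (\<lambda>x. a t x - a t (x + h)) \<and> V_norm (\<lambda>x. a t x - a t (x + h)) \<le> M + M" if "t > 0" for t
      using V_norm_diff_le[OF aV[OF that] V_shift(1)[OF aV[OF that]], of h] V_shift(2)[OF aV[OF that], of h] M[OF that]
        V_norm_bounds(1)[OF V_diff[OF aV[OF that] V_shift(1)[OF aV[OF that]]], of h] by simp
    then show "0 \<le> V_norm (\<lambda>x. a t x - a t (x + h))" if "t \<in> {0<..}" for t using that by simp
    show "bdd_above ((\<lambda>t. V_norm (\<lambda>x. a t x - a t (x + h))) ` {0<..})"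
      using * by (auto intro!: bdd_aboveI[of _ "M + M"])
  qed auto
  have 4: "((\<lambda>m. SUP t\<in>{0<..}. variation_on (UNIV - {- m..m}) (a t)) \<longlongrightarrow> 0) at_top \<longleftrightarrow>
    uniformly_vanishing at_top (\<lambda>m. {0<..}) (\<lambda>m t. variation_on (UNIV - {- m..m}) (a t))"
  proof (intro uniformly_vanishing_iff_SUP always_eventually allI conjI ballI)
    fix m :: real
    show "bdd_above ((\<lambda>t. variation_on (UNIV - {- m..m}) (a t)) ` {0<..})"
      using order_trans[OF V_norm_bounds(3)[OF aV] M] by (auto intro!: bdd_aboveI[of _ M])
  qed (auto intro: V_variation_on_nonneg)
  show ?thesis
    using True b 1 2 3 4
    unfolding E_tilde_V_def E_V_def SO_V_def Cb_V_def vanishing_tests_def by blast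
qed

lemma E_tilde_VD:
  assumes "a \<in> E_tilde_V"
  shows "\<And>t. t > 0 \<Longrightarrow> a t \<in> V_space" "vanishing_tests a"
    "\<exists>M\<ge>0. \<forall>t>0. V_norm (a t) \<le> M"
proof -
  show "\<And>t. t > 0 \<Longrightarrow> a t \<in> V_space" "vanishing_tests a" using assms by (auto simp: E_tilde_V_iff)
  then have "0 \<le> V_norm (a 1)" by (intro V_norm_bounds) auto
  then show "\<exists>M\<ge>0. \<forall>t>0. V_norm (a t) \<le> M"
    using assms unfolding E_tilde_V_iff by (meson order_trans zero_less_one)
qed

lemma E_tilde_V_congI:
  assumes "a \<in> E_tilde_V" "\<And>t. t > 0 \<Longrightarrow> a t = b t"
  shows "b \<in> E_tilde_V"
proof -
  have "vanishing_tests a \<longleftrightarrow> vanishing_tests b"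
  proof -
    have "uniformly_vanishing F A X \<longleftrightarrow> uniformly_vanishing F A Y"
      if "\<forall>\<^sub>F h in F. \<forall>i\<in>A h. X h i = Y h i" for F :: "real filter" and A :: "real \<Rightarrow> 'i set" and X Y
    proof -
      have *: "uniformly_vanishing F A Y"
        if "uniformly_vanishing F A X" "\<forall>\<^sub>F h in F. \<forall>i\<in>A h. X h i = Y h i" for X Y
        by (rule uniformly_vanishing_bound[OF that(1,1), where C=1 and C'=0])
          (use that(2) in \<open>auto elim: eventually_mono\<close>)
      have "\<forall>\<^sub>F h in F. \<forall>i\<in>A h. Y h i = X h i" using that by (rule eventually_mono) auto
      then show ?thesis using *[of X Y] *[of Y X] that by blast
    qed
    note cong = this
    have 1: "uniformly_vanishing (at t within {0<..}) (\<lambda>\<tau>. {\<tau>}) (\<lambda>_ \<tau>. V_norm (\<lambda>x. a \<tau> x - a t x)) \<longleftrightarrow>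
       uniformly_vanishing (at t within {0<..}) (\<lambda>\<tau>. {\<tau>}) (\<lambda>_ \<tau>. V_norm (\<lambda>x. b \<tau> x - b t x))"
      if "t > 0" for t
      using that assms(2) by (intro cong) (auto simp: eventually_at_filter)
    have 2: "uniformly_vanishing F (\<lambda>r. {r..2 * r} \<times> {r..2 * r}) (\<lambda>r (t, \<tau>). Linf_norm (\<lambda>x. a t x - a \<tau> x)) \<longleftrightarrow>
      uniformly_vanishing F (\<lambda>r. {r..2 * r} \<times> {r..2 * r}) (\<lambda>r (t, \<tau>). Linf_norm (\<lambda>x. b t x - b \<tau> x))"
      if F: "F \<in> {at_right 0, at_top}" for F
      using eventually_pos_at_right_at_top[OF F] assms(2) by (intro cong) (auto elim!: eventually_mono)
    have 3: "uniformly_vanishing (at 0) (\<lambda>h. {0<..}) (\<lambda>h t. V_norm (\<lambda>x. a t x - a t (x + h))) \<longleftrightarrow>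
      uniformly_vanishing (at 0) (\<lambda>h. {0<..}) (\<lambda>h t. V_norm (\<lambda>x. b t x - b t (x + h)))"
      using assms(2) by (intro cong) auto
    have 4: "uniformly_vanishing at_top (\<lambda>m. {0<..}) (\<lambda>m t. variation_on (UNIV - {- m..m}) (a t)) \<longleftrightarrow>
      uniformly_vanishing at_top (\<lambda>m. {0<..}) (\<lambda>m t. variation_on (UNIV - {- m..m}) (b t))"
      using assms(2) by (intro cong) auto
    show ?thesis unfolding vanishing_tests_def using 1 2 3 4 by blast
  qed
  with assms show ?thesis by (simp add: E_tilde_V_iff)
qed

text \<open>
  Each test is linear in the differences it measures, so closure under an operation follows from four
  inequalities with fixed constants.
\<close>

lemma vanishing_testsI:
  assumes "vanishing_tests a" "vanishing_tests b" "0 \<le> C" "0 \<le> C'"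
    and V: "\<And>t \<tau>. t > 0 \<Longrightarrow> \<tau> > 0 \<Longrightarrow> V_norm (\<lambda>x. c \<tau> x - c t x)
        \<le> C * V_norm (\<lambda>x. a \<tau> x - a t x) + C' * V_norm (\<lambda>x. b \<tau> x - b t x)"
    and L: "\<And>t \<tau>. t > 0 \<Longrightarrow> \<tau> > 0 \<Longrightarrow> Linf_norm (\<lambda>x. c t x - c \<tau> x)
        \<le> C * Linf_norm (\<lambda>x. a t x - a \<tau> x) + C' * Linf_norm (\<lambda>x. b t x - b \<tau> x)"
    and S: "\<And>t h. t > 0 \<Longrightarrow> V_norm (\<lambda>x. c t x - c t (x + h))
        \<le> C * V_norm (\<lambda>x. a t x - a t (x + h)) + C' * V_norm (\<lambda>x. b t x - b t (x + h))"
    and T: "\<And>t S. t > 0 \<Longrightarrow> S \<in> sets lebesgue \<Longrightarrow>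
        variation_on S (c t) \<le> C * variation_on S (a t) + C' * variation_on S (b t)"
  shows "vanishing_tests c"
  unfolding vanishing_tests_def
proof (intro conjI allI impI ballI)
  note a = assms(1)[unfolded vanishing_tests_def] and b = assms(2)[unfolded vanishing_tests_def]
  show "uniformly_vanishing (at t within {0<..}) (\<lambda>\<tau>. {\<tau>}) (\<lambda>_ \<tau>. V_norm (\<lambda>x. c \<tau> x - c t x))" if "0 < t" for t
  proof (rule uniformly_vanishing_bound[OF _ _ _ assms(3,4)])
    show "uniformly_vanishing (at t within {0<..}) (\<lambda>\<tau>. {\<tau>}) (\<lambda>_ \<tau>. V_norm (\<lambda>x. a \<tau> x - a t x))"
      "uniformly_vanishing (at t within {0<..}) (\<lambda>\<tau>. {\<tau>}) (\<lambda>_ \<tau>. V_norm (\<lambda>x. b \<tau> x - b t x))"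
      using a b that by blast+
  qed (use V that in \<open>auto simp: eventually_at_filter\<close>)
  show "uniformly_vanishing F (\<lambda>r. {r..2 * r} \<times> {r..2 * r}) (\<lambda>r (t, \<tau>). Linf_norm (\<lambda>x. c t x - c \<tau> x))"
    if F: "F \<in> {at_right 0, at_top}" for F
  proof (rule uniformly_vanishing_bound[OF _ _ _ assms(3,4)])
    show "uniformly_vanishing F (\<lambda>r. {r..2 * r} \<times> {r..2 * r}) (\<lambda>r (t, \<tau>). Linf_norm (\<lambda>x. a t x - a \<tau> x))"
      "uniformly_vanishing F (\<lambda>r. {r..2 * r} \<times> {r..2 * r}) (\<lambda>r (t, \<tau>). Linf_norm (\<lambda>x. b t x - b \<tau> x))"
      using a b F by blast+
  qed (use L eventually_pos_at_right_at_top[OF F] in \<open>auto elim!: eventually_mono\<close>)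
  show "uniformly_vanishing (at 0) (\<lambda>h. {0<..}) (\<lambda>h t. V_norm (\<lambda>x. c t x - c t (x + h)))"
    by (rule uniformly_vanishing_bound[OF conjunct1[OF conjunct2[OF conjunct2[OF a]]]
        conjunct1[OF conjunct2[OF conjunct2[OF b]]] _ assms(3,4)]) (use S in auto)
  show "uniformly_vanishing at_top (\<lambda>m. {0<..}) (\<lambda>m t. variation_on (UNIV - {- m..m}) (c t))"
    by (rule uniformly_vanishing_bound[OF conjunct2[OF conjunct2[OF conjunct2[OF a]]]
        conjunct2[OF conjunct2[OF conjunct2[OF b]]] _ assms(3,4)]) (use T in auto)
qed

text \<open>
  The identity \<open>f g - f' g' = (f - f') g + f' (g - g')\<close>.
\<close>

lemma V_diff_mult:
  assumes V: "f \<in> V_space" "g \<in> V_space" "f' \<in> V_space" "g' \<in> V_space"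
    and M: "V_norm g \<le> M" "V_norm f' \<le> M'"
  shows "V_norm (\<lambda>x. f x * g x - f' x * g' x) \<le> M * V_norm (\<lambda>x. f x - f' x) + M' * V_norm (\<lambda>x. g x - g' x)"
    "Linf_norm (\<lambda>x. f x * g x - f' x * g' x) \<le> M * Linf_norm (\<lambda>x. f x - f' x) + M' * Linf_norm (\<lambda>x. g x - g' x)"
proof -
  note d = V_diff[OF V(1,3)] V_diff[OF V(2,4)]
  have eq: "(\<lambda>x. f x * g x - f' x * g' x) = (\<lambda>x. (f x - f' x) * g x + f' x * (g x - g' x))"
    by (auto simp: algebra_simps)
  have "V_norm (\<lambda>x. f x * g x - f' x * g' x) \<le> V_norm (\<lambda>x. (f x - f' x) * g x) + V_norm (\<lambda>x. f' x * (g x - g' x))"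
    unfolding eq by (intro V_add V_mult V d)
  also have "\<dots> \<le> V_norm (\<lambda>x. f x - f' x) * V_norm g + V_norm f' * V_norm (\<lambda>x. g x - g' x)"
    by (intro add_mono V_mult V d)
  also have "\<dots> \<le> V_norm (\<lambda>x. f x - f' x) * M + M' * V_norm (\<lambda>x. g x - g' x)"
    by (intro add_mono mult_left_mono mult_right_mono M V_norm_bounds d)
  finally show "V_norm (\<lambda>x. f x * g x - f' x * g' x) \<le> M * V_norm (\<lambda>x. f x - f' x) + M' * V_norm (\<lambda>x. g x - g' x)"
    by (simp add: algebra_simps)
  have L: "Linf_norm g \<le> M" "Linf_norm f' \<le> M'" using V_norm_bounds(2) V M order_trans by blast+
  have "Linf_norm (\<lambda>x. f x * g x - f' x * g' x) \<le> Linf_norm (\<lambda>x. (f x - f' x) * g x) + Linf_norm (\<lambda>x. f' x * (g x - g' x))"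
    unfolding eq by (intro V_add V_mult V d)
  also have "\<dots> \<le> Linf_norm (\<lambda>x. f x - f' x) * Linf_norm g + Linf_norm f' * Linf_norm (\<lambda>x. g x - g' x)"
    by (intro add_mono V_mult V d)
  also have "\<dots> \<le> Linf_norm (\<lambda>x. f x - f' x) * M + M' * Linf_norm (\<lambda>x. g x - g' x)"
    by (intro add_mono mult_left_mono mult_right_mono L Linf_norm_nonneg d)
  finally show "Linf_norm (\<lambda>x. f x * g x - f' x * g' x) \<le> M * Linf_norm (\<lambda>x. f x - f' x) + M' * Linf_norm (\<lambda>x. g x - g' x)"
    by (simp add: algebra_simps)
qed

lemma E_tilde_V_mult:
  assumes a: "a \<in> E_tilde_V" and b: "b \<in> E_tilde_V"
  shows "(\<lambda>t x. a t x * b t x) \<in> E_tilde_V"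
proof -
  note aV = E_tilde_VD(1)[OF a] and bV = E_tilde_VD(1)[OF b]
  obtain M where M: "M \<ge> 0" "\<And>t. t > 0 \<Longrightarrow> V_norm (a t) \<le> M" using E_tilde_VD(3)[OF a] by blast
  obtain M' where M': "M' \<ge> 0" "\<And>t. t > 0 \<Longrightarrow> V_norm (b t) \<le> M'" using E_tilde_VD(3)[OF b] by blast
  have L: "Linf_norm (a t) \<le> M" "Linf_norm (b t) \<le> M'" if "t > 0" for t
    using V_norm_bounds(2)[OF aV] V_norm_bounds(2)[OF bV] M(2) M'(2) that order_trans by blast+
  have "vanishing_tests (\<lambda>t x. a t x * b t x)"
  proof (rule vanishing_testsI[OF E_tilde_VD(2)[OF a] E_tilde_VD(2)[OF b] M'(1) M(1)])
    fix t :: real assume t: "0 < t"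
    show "V_norm (\<lambda>x. a \<tau> x * b \<tau> x - a t x * b t x)
        \<le> M' * V_norm (\<lambda>x. a \<tau> x - a t x) + M * V_norm (\<lambda>x. b \<tau> x - b t x)" if "0 < \<tau>" for \<tau>
      by (intro V_diff_mult aV bV M M' t that)
    show "Linf_norm (\<lambda>x. a t x * b t x - a \<tau> x * b \<tau> x)
        \<le> M' * Linf_norm (\<lambda>x. a t x - a \<tau> x) + M * Linf_norm (\<lambda>x. b t x - b \<tau> x)" if "0 < \<tau>" for \<tau>
      by (intro V_diff_mult aV bV M M' t that)
    show "V_norm (\<lambda>x. a t x * b t x - a t (x + h) * b t (x + h))
        \<le> M' * V_norm (\<lambda>x. a t x - a t (x + h)) + M * V_norm (\<lambda>x. b t x - b t (x + h))" for h
      by (intro V_diff_mult aV bV M' t V_shift) (use V_shift(2)[OF aV[OF t]] M t in simp)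
    show "variation_on S (\<lambda>x. a t x * b t x) \<le> M' * variation_on S (a t) + M * variation_on S (b t)"
      if "S \<in> sets lebesgue" for S
    proof -
      have "variation_on S (\<lambda>x. a t x * b t x) \<le> Linf_norm (b t) * variation_on S (a t) + Linf_norm (a t) * variation_on S (b t)"
        by (intro V_mult aV bV t that)
      also have "\<dots> \<le> M' * variation_on S (a t) + M * variation_on S (b t)"
        by (intro add_mono mult_right_mono L t V_variation_on_nonneg)
      finally show ?thesis .
    qed
  qed
  moreover have "V_norm (\<lambda>x. a t x * b t x) \<le> M * M'" if "t > 0" for t
  proof -
    have "V_norm (\<lambda>x. a t x * b t x) \<le> V_norm (a t) * V_norm (b t)" by (intro V_mult aV bV that)
    also have "\<dots> \<le> M * M'" by (intro mult_mono M M' V_norm_bounds aV bV that)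
    finally show ?thesis .
  qed
  ultimately show ?thesis unfolding E_tilde_V_iff using V_mult(1) aV bV by blast
qed

lemma E_tilde_V_add:
  assumes a: "a \<in> E_tilde_V" and b: "b \<in> E_tilde_V"
  shows "(\<lambda>t x. a t x + b t x) \<in> E_tilde_V"
proof -
  note aV = E_tilde_VD(1)[OF a] and bV = E_tilde_VD(1)[OF b]
  obtain M where M: "M \<ge> 0" "\<And>t. t > 0 \<Longrightarrow> V_norm (a t) \<le> M" using E_tilde_VD(3)[OF a] by blast
  obtain M' where M': "M' \<ge> 0" "\<And>t. t > 0 \<Longrightarrow> V_norm (b t) \<le> M'" using E_tilde_VD(3)[OF b] by blast
  have eq: "f x + g x - (f' x + g' x) = (f x - f' x) + (g x - g' x)" for f g f' g' :: "real \<Rightarrow> complex" and x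
    by simp
  have d: "V_norm (\<lambda>x. f x + g x - (f' x + g' x)) \<le> 1 * V_norm (\<lambda>x. f x - f' x) + 1 * V_norm (\<lambda>x. g x - g' x)"
    "Linf_norm (\<lambda>x. f x + g x - (f' x + g' x)) \<le> 1 * Linf_norm (\<lambda>x. f x - f' x) + 1 * Linf_norm (\<lambda>x. g x - g' x)"
    if "f \<in> V_space" "g \<in> V_space" "f' \<in> V_space" "g' \<in> V_space" for f g f' g'
    unfolding eq mult_1 by (intro V_add V_diff that)+
  have "vanishing_tests (\<lambda>t x. a t x + b t x)"
  proof (rule vanishing_testsI[OF E_tilde_VD(2)[OF a] E_tilde_VD(2)[OF b], of 1 1])
    show "variation_on S (\<lambda>x. a t x + b t x) \<le> 1 * variation_on S (a t) + 1 * variation_on S (b t)"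
      if "0 < t" "S \<in> sets lebesgue" for S t
      unfolding mult_1 by (intro V_add aV bV that)
  qed (auto intro!: d[unfolded mult_1] aV bV V_shift)
  moreover have "V_norm (\<lambda>x. a t x + b t x) \<le> M + M'" if "t > 0" for t
    using V_add(4)[OF aV bV, of t] M(2)[OF that] M'(2)[OF that] that by force
  ultimately show ?thesis unfolding E_tilde_V_iff using V_add(1) aV bV by blast
qed

text \<open>
  The identity \<open>1/f - 1/g = - (f - g) (1/f) (1/g)\<close>, where \<open>K = C + C\<^sup>2 M\<close> bounds the norms of
  the reciprocals.
\<close>

lemma E_tilde_V_inverse:
  assumes a: "a \<in> E_tilde_V"
    and C: "\<And>t x. t > 0 \<Longrightarrow> a t x \<noteq> 0" "\<And>t x. t > 0 \<Longrightarrow> norm (1 / a t x) \<le> C"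
  shows "(\<lambda>t x. 1 / a t x) \<in> E_tilde_V"
proof -
  note aV = E_tilde_VD(1)[OF a]
  obtain M where M: "M \<ge> 0" "\<And>t. t > 0 \<Longrightarrow> V_norm (a t) \<le> M" using E_tilde_VD(3)[OF a] by blast
  have C0: "0 \<le> C" using order_trans[OF norm_ge_zero C(2)[of 1 0]] by simp
  define K where "K = C + C\<^sup>2 * M"
  have K0: "0 \<le> K" using M C0 by (simp add: K_def)
  have uK: "V_norm (\<lambda>x. 1 / f x) \<le> K"
    if f: "f \<in> V_space" "V_norm f \<le> M" "\<And>x. f x \<noteq> 0" "\<And>x. norm (1 / f x) \<le> C" for f
  proof -
    have "variation_on UNIV (\<lambda>x. 1 / f x) \<le> C\<^sup>2 * variation_on UNIV f"
      by (rule V_inverse(2)[OF f(1,3,4)]) auto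
    also have "\<dots> \<le> C\<^sup>2 * M"
      using order_trans[OF V_norm_bounds(3)[OF f(1)] f(2)] by (intro mult_left_mono) auto
    finally show ?thesis
      using V_inverse(3)[OF f(1,3,4)] unfolding V_norm_def V_variation_UNIV K_def by simp
  qed
  have d: "V_norm (\<lambda>x. 1 / f x - 1 / g x) \<le> (C\<^sup>2 + K * K) * V_norm (\<lambda>x. f x - g x)"
      "Linf_norm (\<lambda>x. 1 / f x - 1 / g x) \<le> (C\<^sup>2 + K * K) * Linf_norm (\<lambda>x. f x - g x)"
    if f: "f \<in> V_space" "V_norm f \<le> M" "\<And>x. f x \<noteq> 0" "\<And>x. norm (1 / f x) \<le> C"
      and g: "g \<in> V_space" "V_norm g \<le> M" "\<And>x. g x \<noteq> 0" "\<And>x. norm (1 / g x) \<le> C" for f g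
  proof -
    note fi = V_inverse(1)[OF f(1,3,4)] and gi = V_inverse(1)[OF g(1,3,4)]
    have eq: "1 / f x - 1 / g x = (f x - g x) * (- 1 * ((1 / f x) * (1 / g x)))" for x
      using f(3)[of x] g(3)[of x] by (simp add: field_simps)
    have "V_norm (\<lambda>x. 1 / f x - 1 / g x) \<le> V_norm (\<lambda>x. f x - g x) * V_norm (\<lambda>x. - 1 * ((1 / f x) * (1 / g x)))"
      unfolding eq by (intro V_mult V_diff V_const f g fi gi)
    also have "V_norm (\<lambda>x. - 1 * ((1 / f x) * (1 / g x))) \<le> V_norm (\<lambda>x::real. - 1) * V_norm (\<lambda>x. (1 / f x) * (1 / g x))"
      by (intro V_mult V_const fi gi)
    also have "V_norm (\<lambda>x. (1 / f x) * (1 / g x)) \<le> V_norm (\<lambda>x. 1 / f x) * V_norm (\<lambda>x. 1 / g x)"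
      by (intro V_mult fi gi)
    also have "\<dots> \<le> K * K" by (intro mult_mono uK f g V_norm_bounds fi gi K0)
    finally have "V_norm (\<lambda>x. 1 / f x - 1 / g x) \<le> V_norm (\<lambda>x. f x - g x) * (K * K)"
      using V_norm_bounds(1)[OF V_diff[OF f(1) g(1)]] by (simp add: V_const mult_left_mono)
    also have "\<dots> \<le> V_norm (\<lambda>x. f x - g x) * (C\<^sup>2 + K * K)"
      by (intro mult_left_mono V_norm_bounds V_diff f g) simp
    finally show "V_norm (\<lambda>x. 1 / f x - 1 / g x) \<le> (C\<^sup>2 + K * K) * V_norm (\<lambda>x. f x - g x)"
      by (simp add: mult.commute)
    show "Linf_norm (\<lambda>x. 1 / f x - 1 / g x) \<le> (C\<^sup>2 + K * K) * Linf_norm (\<lambda>x. f x - g x)"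
    proof (rule Linf_norm_least)
      show "(\<lambda>x. 1 / f x - 1 / g x) \<in> V_space" by (intro V_diff fi gi)
      fix x
      have "norm (1 / f x - 1 / g x) = norm (f x - g x) * (norm (1 / f x) * norm (1 / g x))"
        unfolding eq by (simp only: norm_mult norm_minus_cancel norm_one mult_1)
      also have "\<dots> \<le> Linf_norm (\<lambda>x. f x - g x) * (C * C)"
        using C0 by (intro mult_mono f g Linf_norm_upper[OF V_diff] Linf_norm_nonneg V_diff) auto
      also have "\<dots> \<le> Linf_norm (\<lambda>x. f x - g x) * (C\<^sup>2 + K * K)"
        by (intro mult_left_mono Linf_norm_nonneg V_diff f g) (simp add: power2_eq_square)
      finally show "norm (1 / f x - 1 / g x) \<le> (C\<^sup>2 + K * K) * Linf_norm (\<lambda>x. f x - g x)"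
        by (simp add: mult.commute)
    qed
  qed
  have CK: "0 \<le> C\<^sup>2 + K * K" by simp
  have "vanishing_tests (\<lambda>t x. 1 / a t x)"
  proof (rule vanishing_testsI[OF E_tilde_VD(2)[OF a] E_tilde_VD(2)[OF a] CK order_refl]; unfold mult_zero_left add_0_right)
    fix t :: real assume t: "0 < t"
    show "V_norm (\<lambda>x. 1 / a \<tau> x - 1 / a t x) \<le> (C\<^sup>2 + K * K) * V_norm (\<lambda>x. a \<tau> x - a t x)" if "0 < \<tau>" for \<tau>
      by (intro d aV M C t that)
    show "Linf_norm (\<lambda>x. 1 / a t x - 1 / a \<tau> x) \<le> (C\<^sup>2 + K * K) * Linf_norm (\<lambda>x. a t x - a \<tau> x)" if "0 < \<tau>" for \<tau>
      by (intro d aV M C t that)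
    show "V_norm (\<lambda>x. 1 / a t x - 1 / a t (x + h)) \<le> (C\<^sup>2 + K * K) * V_norm (\<lambda>x. a t x - a t (x + h))" for h
      by (intro d aV M C t V_shift) (use V_shift(2)[OF aV[OF t]] M t in simp)
    show "variation_on S (\<lambda>x. 1 / a t x) \<le> (C\<^sup>2 + K * K) * variation_on S (a t)" if "S \<in> sets lebesgue" for S
    proof -
      have "variation_on S (\<lambda>x. 1 / a t x) \<le> C\<^sup>2 * variation_on S (a t)"
        by (intro V_inverse(2) aV C t that)
      also have "\<dots> \<le> (C\<^sup>2 + K * K) * variation_on S (a t)"
        by (intro mult_right_mono V_variation_on_nonneg) simp
      finally show ?thesis .
    qed
  qed
  moreover have "\<forall>t>0. V_norm (\<lambda>x. 1 / a t x) \<le> K" using uK aV M(2) C by blast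
  moreover have "\<forall>t>0. (\<lambda>x. 1 / a t x) \<in> V_space" using V_inverse(1)[OF aV] C by blast
  ultimately show ?thesis unfolding E_tilde_V_iff by blast
qed


lemma E_tilde_V_continuous:
  assumes "a \<in> E_tilde_V" "t > 0"
  shows "((\<lambda>\<tau>. V_norm (\<lambda>x. a \<tau> x - a t x)) \<longlongrightarrow> 0) (at t within {0<..})"
  using assms by (auto simp: E_tilde_V_def E_V_def SO_V_def Cb_V_def)

text \<open>
  Slow oscillation survives a change of the variable \<open>t\<close> if near each end it is the identity or
  constant; the other conditions are uniform in \<open>t\<close> or follow from continuity.
\<close>

lemma E_tilde_V_reparametrize:
  assumes a: "a \<in> E_tilde_V"
    and \<rho>: "continuous_on {0<..} \<rho>" "\<And>t. t > 0 \<Longrightarrow> \<rho> t > 0"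
    and ends: "\<And>F. F \<in> {at_right 0, at_top} \<Longrightarrow>
       (\<forall>\<^sub>F r in F. \<forall>t\<in>{r..2 * r}. \<rho> t = t) \<or> (\<forall>\<^sub>F r in F. \<forall>t\<in>{r..2 * r}. \<forall>\<tau>\<in>{r..2 * r}. \<rho> t = \<rho> \<tau>)"
  shows "(\<lambda>t. a (\<rho> t)) \<in> E_tilde_V"
proof -
  note aV = E_tilde_VD(1)[OF a]
  note at = E_tilde_VD(2)[OF a, unfolded vanishing_tests_def]
  have "vanishing_tests (\<lambda>t. a (\<rho> t))"
    unfolding vanishing_tests_def
  proof (intro conjI allI impI ballI)
    fix t :: real assume t: "0 < t"
    \<comment> \<open>\<open>\<rho>\<close> need not be injective, so the limit is taken as continuity of \<open>?Y\<close>, which is \<open>0\<close> at \<open>\<rho> t\<close>.\<close>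
    let ?Y = "\<lambda>\<sigma>. V_norm (\<lambda>x. a \<sigma> x - a (\<rho> t) x)"
    have Y0: "?Y (\<rho> t) = 0" by (simp add: V_const)
    have "continuous (at (\<rho> t) within {0<..}) ?Y"
      unfolding continuous_within Y0 by (rule E_tilde_V_continuous[OF a \<rho>(2)[OF t]])
    then have "continuous (at (\<rho> t) within \<rho> ` {0<..}) ?Y"
      by (rule continuous_within_subset) (use \<rho>(2) in auto)
    moreover have "continuous (at t within {0<..}) \<rho>"
      using \<rho>(1) t by (simp add: continuous_on_eq_continuous_within)
    ultimately have "continuous (at t within {0<..}) (\<lambda>\<tau>. ?Y (\<rho> \<tau>))"
      by (rule continuous_within_compose2[rotated])
    then have "((\<lambda>\<tau>. ?Y (\<rho> \<tau>)) \<longlongrightarrow> 0) (at t within {0<..})"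
      unfolding continuous_within Y0 .
    then show "uniformly_vanishing (at t within {0<..}) (\<lambda>\<tau>. {\<tau>}) (\<lambda>_ \<tau>. V_norm (\<lambda>x. a (\<rho> \<tau>) x - a (\<rho> t) x))"
      unfolding uniformly_vanishing_def by (intro exI[of _ "\<lambda>\<tau>. ?Y (\<rho> \<tau>)"]) auto
  next
    fix F :: "real filter" assume F: "F \<in> {at_right 0, at_top}"
    have "uniformly_vanishing F (\<lambda>r. {r..2 * r} \<times> {r..2 * r}) (\<lambda>r (t, \<tau>). Linf_norm (\<lambda>x. a t x - a \<tau> x))"
      using at F by blast
    then obtain S where S: "(S \<longlongrightarrow> 0) F"
      "\<forall>\<^sub>F r in F. \<forall>i\<in>{r..2 * r} \<times> {r..2 * r}. (case i of (t, \<tau>) \<Rightarrow> Linf_norm (\<lambda>x. a t x - a \<tau> x)) \<le> S r"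
      unfolding uniformly_vanishing_def by blast
    from ends[OF F] show "uniformly_vanishing F (\<lambda>r. {r..2 * r} \<times> {r..2 * r})
        (\<lambda>r (t, \<tau>). Linf_norm (\<lambda>x. a (\<rho> t) x - a (\<rho> \<tau>) x))"
    proof
      assume "\<forall>\<^sub>F r in F. \<forall>t\<in>{r..2 * r}. \<rho> t = t"
      with S(2) have "\<forall>\<^sub>F r in F. \<forall>i\<in>{r..2 * r} \<times> {r..2 * r}.
          (case i of (t, \<tau>) \<Rightarrow> Linf_norm (\<lambda>x. a (\<rho> t) x - a (\<rho> \<tau>) x)) \<le> S r"
        by eventually_elim auto
      with S(1) show ?thesis unfolding uniformly_vanishing_def by blast
    next
      assume *: "\<forall>\<^sub>F r in F. \<forall>t\<in>{r..2 * r}. \<forall>\<tau>\<in>{r..2 * r}. \<rho> t = \<rho> \<tau>"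
      have "\<forall>\<^sub>F r in F. \<forall>i\<in>{r..2 * r} \<times> {r..2 * r}.
          (case i of (t, \<tau>) \<Rightarrow> Linf_norm (\<lambda>x. a (\<rho> t) x - a (\<rho> \<tau>) x)) \<le> 0"
        using *
      proof eventually_elim
        case (elim r)
        have "Linf_norm (\<lambda>x. a (\<rho> t) x - a (\<rho> \<tau>) x) \<le> 0" if "t \<in> {r..2 * r}" "\<tau> \<in> {r..2 * r}" for t \<tau>
        proof -
          have "\<rho> t = \<rho> \<tau>" using elim that by blast
          then show ?thesis by (simp add: V_const)
        qed
        then show ?case by auto
      qed
      then show ?thesis unfolding uniformly_vanishing_def by (intro exI[of _ "\<lambda>r. 0"]) auto
    qed
  next
    obtain S where "(S \<longlongrightarrow> 0) (at 0)" "\<forall>\<^sub>F h in at 0. \<forall>t\<in>{0<..}. V_norm (\<lambda>x. a t x - a t (x + h)) \<le> S h"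
      using at unfolding uniformly_vanishing_def by blast
    then show "uniformly_vanishing (at 0) (\<lambda>h. {0<..}) (\<lambda>h t. V_norm (\<lambda>x. a (\<rho> t) x - a (\<rho> t) (x + h)))"
      unfolding uniformly_vanishing_def using \<rho>(2) by (intro exI[of _ S]) (auto elim!: eventually_mono)
  next
    obtain S where "(S \<longlongrightarrow> 0) at_top" "\<forall>\<^sub>F m in at_top. \<forall>t\<in>{0<..}. variation_on (UNIV - {- m..m}) (a t) \<le> S m"
      using at unfolding uniformly_vanishing_def by blast
    then show "uniformly_vanishing at_top (\<lambda>m. {0<..}) (\<lambda>m t. variation_on (UNIV - {- m..m}) (a (\<rho> t)))"
      unfolding uniformly_vanishing_def using \<rho>(2) by (intro exI[of _ S]) (auto elim!: eventually_mono)
  qed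
  then show ?thesis using a aV \<rho>(2) unfolding E_tilde_V_iff by blast
qed

section \<open>Slowly oscillating functions and the fibres over the ends\<close>

lemma SO_iff:
  "\<phi> \<in> SO \<longleftrightarrow> continuous_on {0<..} \<phi> \<and> bounded (\<phi> ` {0<..}) \<and>
     (\<forall>F\<in>{at_right 0, at_top}. uniformly_vanishing F (\<lambda>r. {r..2 * r} \<times> {r..2 * r}) (\<lambda>r (t, \<tau>). norm (\<phi> t - \<phi> \<tau>)))"
proof (cases "bounded (\<phi> ` {0<..})")
  case True
  then obtain M where M: "\<And>t. t > 0 \<Longrightarrow> norm (\<phi> t) \<le> M" unfolding bounded_iff by blast
  have "((\<lambda>r. SUP (t, \<tau>) \<in> {r..2 * r} \<times> {r..2 * r}. norm (\<phi> t - \<phi> \<tau>)) \<longlongrightarrow> 0) F \<longleftrightarrow>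
      uniformly_vanishing F (\<lambda>r. {r..2 * r} \<times> {r..2 * r}) (\<lambda>r (t, \<tau>). norm (\<phi> t - \<phi> \<tau>))"
    if F: "F \<in> {at_right 0, at_top}" for F
  proof (rule uniformly_vanishing_iff_SUP)
    show "\<forall>\<^sub>F r in F. {r..2 * r} \<times> {r..2 * r} \<noteq> {} \<and>
         (\<forall>i\<in>{r..2 * r} \<times> {r..2 * r}. 0 \<le> (case i of (t, \<tau>) \<Rightarrow> norm (\<phi> t - \<phi> \<tau>))) \<and>
         bdd_above ((\<lambda>i. case i of (t, \<tau>) \<Rightarrow> norm (\<phi> t - \<phi> \<tau>)) ` ({r..2 * r} \<times> {r..2 * r}))"
      using eventually_pos_at_right_at_top[OF F]
    proof eventually_elim
      case (elim r)
      have "norm (\<phi> t - \<phi> \<tau>) \<le> M + M" if "t \<in> {r..2 * r}" "\<tau> \<in> {r..2 * r}" for t \<tau>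
        using norm_triangle_ineq4[of "\<phi> t" "\<phi> \<tau>"] M[of t] M[of \<tau>] that elim by simp
      then show ?case using elim by (auto intro!: bdd_aboveI[of _ "M + M"])
    qed
  qed
  then show ?thesis unfolding SO_def by blast
qed (auto simp: SO_def)

text \<open>
  Evaluation at \<open>x\<close>, also at an infinite one, is a functional of norm at most one for the supremum
  norm.
\<close>

lemma SO_ext_infty:
  assumes a: "a \<in> E_tilde_V"
  shows "(\<lambda>t. ext_infty (a t) x) \<in> SO"
  unfolding SO_iff
proof (intro conjI ballI)
  note aV = E_tilde_VD(1)[OF a]
  have d: "norm (ext_infty (a t) x - ext_infty (a \<tau>) x) \<le> Linf_norm (\<lambda>x. a t x - a \<tau> x)" if "t > 0" "\<tau> > 0" for t \<tau>
    using ext_infty_norm_le_Linf[OF V_diff[OF aV aV, OF that], of x] by (simp add: ext_infty_diff aV that)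
  show "continuous_on {0<..} (\<lambda>t. ext_infty (a t) x)"
    unfolding continuous_on_def
  proof
    fix t :: real assume t: "t \<in> {0<..}"
    have "((\<lambda>\<tau>. ext_infty (a \<tau>) x - ext_infty (a t) x) \<longlongrightarrow> 0) (at t within {0<..})"
    proof (rule Lim_null_comparison[OF _ E_tilde_V_continuous[OF a]])
      have "norm (ext_infty (a \<tau>) x - ext_infty (a t) x) \<le> V_norm (\<lambda>x. a \<tau> x - a t x)" if "\<tau> > 0" for \<tau>
        using order_trans[OF d V_norm_bounds(2)[OF V_diff[OF aV aV]]] that t by auto
      then show "\<forall>\<^sub>F \<tau> in at t within {0<..}. norm (ext_infty (a \<tau>) x - ext_infty (a t) x) \<le> V_norm (\<lambda>x. a \<tau> x - a t x)"
        by (simp add: eventually_at_filter)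
    qed (use t in auto)
    then show "((\<lambda>t. ext_infty (a t) x) \<longlongrightarrow> ext_infty (a t) x) (at t within {0<..})"
      by (simp add: LIM_zero_iff)
  qed
  obtain M where M: "M \<ge> 0" "\<And>t. t > 0 \<Longrightarrow> V_norm (a t) \<le> M" using E_tilde_VD(3)[OF a] by blast
  have "norm (ext_infty (a t) x) \<le> M" if "t > 0" for t
    using ext_infty_norm_le_Linf[OF aV[OF that], of x] V_norm_bounds(2)[OF aV[OF that]] M(2)[OF that] by simp
  then show "bounded ((\<lambda>t. ext_infty (a t) x) ` {0<..})" unfolding bounded_iff by auto
  fix F :: "real filter" assume F: "F \<in> {at_right 0, at_top}"
  have "uniformly_vanishing F (\<lambda>r. {r..2 * r} \<times> {r..2 * r}) (\<lambda>r (t, \<tau>). Linf_norm (\<lambda>x. a t x - a \<tau> x))"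
    using E_tilde_VD(2)[OF a] F unfolding vanishing_tests_def by blast
  from this this show "uniformly_vanishing F (\<lambda>r. {r..2 * r} \<times> {r..2 * r}) (\<lambda>r (t, \<tau>). norm (ext_infty (a t) x - ext_infty (a \<tau>) x))"
    by (rule uniformly_vanishing_bound[where C=1 and C'=0])
      (use eventually_pos_at_right_at_top[OF F] d in \<open>auto elim!: eventually_mono\<close>)
qed

lemma SO_imp_scalar_symbol:
  assumes \<phi>: "\<phi> \<in> SO"
  shows "(\<lambda>t x. \<phi> t) \<in> E_tilde_V"
proof -
  obtain M where M: "\<And>t. t > 0 \<Longrightarrow> norm (\<phi> t) \<le> M" using \<phi> unfolding SO_def bounded_iff by blast
  have "vanishing_tests (\<lambda>t x. \<phi> t)"
    unfolding vanishing_tests_def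
  proof (intro conjI allI impI ballI)
    fix t :: real assume t: "0 < t"
    then have "((\<lambda>\<tau>. \<phi> \<tau> - \<phi> t) \<longlongrightarrow> 0) (at t within {0<..})"
      using \<phi> unfolding SO_def continuous_on_def by (auto simp: LIM_zero_iff)
    then have "((\<lambda>\<tau>. norm (\<phi> \<tau> - \<phi> t)) \<longlongrightarrow> 0) (at t within {0<..})" by (rule tendsto_norm_zero)
    then show "uniformly_vanishing (at t within {0<..}) (\<lambda>\<tau>. {\<tau>}) (\<lambda>_ \<tau>. V_norm (\<lambda>x. \<phi> \<tau> - \<phi> t))"
      unfolding uniformly_vanishing_def V_const by (intro exI[of _ "\<lambda>\<tau>. norm (\<phi> \<tau> - \<phi> t)"]) auto
  next
    fix F :: "real filter" assume F: "F \<in> {at_right 0, at_top}"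
    have "uniformly_vanishing F (\<lambda>r. {r..2 * r} \<times> {r..2 * r}) (\<lambda>r (t, \<tau>). norm (\<phi> t - \<phi> \<tau>))"
      using \<phi> F unfolding SO_iff by blast
    from this this show "uniformly_vanishing F (\<lambda>r. {r..2 * r} \<times> {r..2 * r}) (\<lambda>r (t, \<tau>). Linf_norm (\<lambda>x. \<phi> t - \<phi> \<tau>))"
      by (rule uniformly_vanishing_bound[where C=1 and C'=0]) (auto intro!: always_eventually simp: V_const)
  qed (auto intro!: uniformly_vanishing_zero simp: V_const)
  then show ?thesis unfolding E_tilde_V_iff using M by (auto simp: V_const)
qed

text \<open>
  Slowly oscillating functions are the symbols that do not depend on \<open>x\<close>; their algebraic closure
  properties are inherited from the algebra of symbols.
\<close>

lemma SO_iff_scalar_symbol: "\<phi> \<in> SO \<longleftrightarrow> (\<lambda>t x. \<phi> t) \<in> E_tilde_V"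
  using SO_imp_scalar_symbol SO_ext_infty[of "\<lambda>t x. \<phi> t" "ereal 0"] by auto

lemma SO_cong: "\<phi> \<in> SO \<Longrightarrow> (\<And>t. t > 0 \<Longrightarrow> \<phi> t = \<psi> t) \<Longrightarrow> \<psi> \<in> SO"
  unfolding SO_iff_scalar_symbol using E_tilde_V_congI[of "\<lambda>t x. \<phi> t" "\<lambda>t x. \<psi> t"] by simp

lemma SO_add: "\<phi> \<in> SO \<Longrightarrow> \<psi> \<in> SO \<Longrightarrow> (\<lambda>t. \<phi> t + \<psi> t) \<in> SO"
  unfolding SO_iff_scalar_symbol by (rule E_tilde_V_add)

lemma SO_mult: "\<phi> \<in> SO \<Longrightarrow> \<psi> \<in> SO \<Longrightarrow> (\<lambda>t. \<phi> t * \<psi> t) \<in> SO"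
  unfolding SO_iff_scalar_symbol by (rule E_tilde_V_mult)

lemma SO_clamp:
  fixes \<phi> :: "real \<Rightarrow> complex"
  assumes \<phi>: "continuous_on {p..q} \<phi>" and pq: "0 < p" "p \<le> q"
  shows "(\<lambda>t. \<phi> (max p (min t q))) \<in> SO"
  unfolding SO_iff
proof (intro conjI ballI)
  have im: "max p (min t q) \<in> {p..q}" for t using pq by auto
  show "continuous_on {0<..} (\<lambda>t. \<phi> (max p (min t q)))"
    by (rule continuous_on_compose2[OF \<phi>]) (use im in \<open>auto intro!: continuous_intros\<close>)
  have "bounded (\<phi> ` {p..q})" by (intro compact_imp_bounded compact_continuous_image \<phi>) simp
  then show "bounded ((\<lambda>t. \<phi> (max p (min t q))) ` {0<..})" by (rule bounded_subset) (use im in auto)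
  fix F :: "real filter" assume F: "F \<in> {at_right 0, at_top}"
  have "\<forall>\<^sub>F r in at_right 0. 2 * r < p" using eventually_at_right_less[of 0] eventually_at_right_real[of 0 "p/2"] pq
    by (auto elim!: eventually_mono)
  then have "\<forall>\<^sub>F r in at_right 0. \<forall>t\<in>{r..2 * r}. max p (min t q) = p"
    by eventually_elim (use pq in auto)
  moreover have "\<forall>\<^sub>F r in at_top. \<forall>t\<in>{r..2 * r}. max p (min t q) = q"
    using eventually_ge_at_top[of q] by eventually_elim (use pq in auto)
  ultimately have "\<exists>c. \<forall>\<^sub>F r in F. \<forall>t\<in>{r..2 * r}. max p (min t q) = c" using F by auto
  then obtain c where "\<forall>\<^sub>F r in F. \<forall>t\<in>{r..2 * r}. max p (min t q) = c" by blast
  then have "\<forall>\<^sub>F r in F. \<forall>i\<in>{r..2 * r} \<times> {r..2 * r}.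
      (case i of (t, \<tau>) \<Rightarrow> norm (\<phi> (max p (min t q)) - \<phi> (max p (min \<tau> q)))) \<le> 0"
    by eventually_elim auto
  then show "uniformly_vanishing F (\<lambda>r. {r..2 * r} \<times> {r..2 * r})
      (\<lambda>r (t, \<tau>). norm (\<phi> (max p (min t q)) - \<phi> (max p (min \<tau> q))))"
    unfolding uniformly_vanishing_def by (intro exI[of _ "\<lambda>r. 0"]) auto
qed

text \<open>
  A function that factors through a compact subinterval of \<open>(0, \<infinity>)\<close> extends continuously to
  \<open>[0, \<infinity>]\<close>, where the functional is evaluation at \<open>s\<close>.
\<close>

lemma M_SO_fiber_clamp:
  fixes \<phi> :: "real \<Rightarrow> complex"
  assumes \<xi>: "\<xi> \<in> M_SO_fiber s" and \<phi>: "continuous_on {p..q} \<phi>" and pq: "0 < p" "p \<le> q"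
  shows "s = 0 \<Longrightarrow> \<xi> (\<lambda>t. \<phi> (max p (min t q))) = \<phi> p"
    "s = \<infinity> \<Longrightarrow> \<xi> (\<lambda>t. \<phi> (max p (min t q))) = \<phi> q"
proof -
  define f where "f e = \<phi> (real_of_ereal (max (ereal p) (min e (ereal q))))" for e
  have "continuous_on {0..\<infinity>} f"
    unfolding f_def
  proof (rule continuous_on_compose2[OF \<phi>])
    show "continuous_on {0..\<infinity>} (\<lambda>e. real_of_ereal (max (ereal p) (min e (ereal q))))"
    proof (rule continuous_on_compose2[OF continuous_on_real])
      show "continuous_on {0..\<infinity>} (\<lambda>e. max (ereal p) (min e (ereal q)))"
        by (intro continuous_intros)
      show "(\<lambda>e. max (ereal p) (min e (ereal q))) ` {0..\<infinity>} \<subseteq> UNIV - {\<infinity>, - \<infinity>}"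
        using pq by (auto simp: max_def min_def)
    qed
    show "(\<lambda>e. real_of_ereal (max (ereal p) (min e (ereal q)))) ` {0..\<infinity>} \<subseteq> {p..q}"
    proof clarify
      fix e :: ereal
      show "real_of_ereal (max (ereal p) (min e (ereal q))) \<in> {p..q}"
        using pq by (cases e) (auto simp: max_def min_def)
    qed
  qed
  then have "\<xi> (\<lambda>t. f (ereal t)) = f s" using \<xi> unfolding M_SO_fiber_def by blast
  moreover have "f (ereal t) = \<phi> (max p (min t q))" for t
    unfolding f_def by (simp add: max_def min_def)
  moreover have "f 0 = \<phi> p" "f \<infinity> = \<phi> q" using pq by (auto simp: f_def max_def min_def zero_ereal_def)
  ultimately show "s = 0 \<Longrightarrow> \<xi> (\<lambda>t. \<phi> (max p (min t q))) = \<phi> p"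
    "s = \<infinity> \<Longrightarrow> \<xi> (\<lambda>t. \<phi> (max p (min t q))) = \<phi> q" by auto
qed

lemma Delta_const:
  assumes "\<xi> \<in> Delta"
  shows "\<xi> (\<lambda>t. c) = c"
  using assms unfolding Delta_def M_SO_fiber_def by (auto dest!: spec[of _ "\<lambda>_. c"])

text \<open>
  The cutoff is piecewise linear and depends on the end: over \<open>0\<close> it rises from \<open>0\<close> at
  \<open>p / 2\<close> to \<open>1\<close> at \<open>p\<close>, over \<open>\<infinity>\<close> it falls from \<open>1\<close> at \<open>q\<close> to \<open>0\<close> at
  \<open>q + 1\<close>.
\<close>

lemma Delta_cutoff:
  assumes "\<xi> \<in> Delta" "0 < p" "p \<le> q"
  obtains \<eta> where "\<eta> \<in> SO" "\<xi> \<eta> = 0" "\<And>t. p \<le> t \<Longrightarrow> t \<le> q \<Longrightarrow> \<eta> t = 1"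
proof -
  consider "\<xi> \<in> M_SO_fiber 0" | "\<xi> \<in> M_SO_fiber \<infinity>" using assms(1) unfolding Delta_def by blast
  then show thesis
  proof cases
    case 1
    let ?\<phi> = "\<lambda>y. complex_of_real (2 * y / p - 1)"
    have c: "continuous_on {p/2..p} ?\<phi>" using assms by (intro continuous_intros) auto
    show thesis
    proof (rule that[of "\<lambda>t. ?\<phi> (max (p/2) (min t p))"])
      show "(\<lambda>t. ?\<phi> (max (p/2) (min t p))) \<in> SO" by (rule SO_clamp[OF c]) (use assms in auto)
      show "\<xi> (\<lambda>t. ?\<phi> (max (p/2) (min t p))) = 0"
        using M_SO_fiber_clamp(1)[OF 1 c] assms by simp
      show "?\<phi> (max (p/2) (min t p)) = 1" if "p \<le> t" for t
        using that assms by (auto simp: max_def min_def)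
    qed
  next
    case 2
    let ?\<phi> = "\<lambda>y. complex_of_real (q + 1 - y)"
    have c: "continuous_on {q..q + 1} ?\<phi>" by (intro continuous_intros)
    show thesis
    proof (rule that[of "\<lambda>t. ?\<phi> (max q (min t (q + 1)))"])
      show "(\<lambda>t. ?\<phi> (max q (min t (q + 1)))) \<in> SO" by (rule SO_clamp[OF c]) (use assms in auto)
      show "\<xi> (\<lambda>t. ?\<phi> (max q (min t (q + 1)))) = 0"
        using M_SO_fiber_clamp(2)[OF 2 c] assms by simp
      show "?\<phi> (max q (min t (q + 1))) = 1" if "t \<le> q" for t
        using that by (auto simp: max_def min_def)
    qed
  qed
qed

text \<open>
  The function \<open>F G - 1\<close> lives on \<open>[p, q]\<close>, so it is unchanged by multiplication with a cutoff
  on which \<open>\<xi>\<close> vanishes.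
\<close>

lemma Delta_reciprocal:
  assumes \<xi>: "\<xi> \<in> Delta" and F: "F \<in> SO" and G: "G \<in> SO" and p: "0 < p" "p \<le> q"
    and FG: "\<And>t. t > 0 \<Longrightarrow> t \<notin> {p..q} \<Longrightarrow> F t * G t = 1"
  shows "\<xi> G = 1 / \<xi> F"
proof -
  have hom: "\<xi> \<in> M_SO" using \<xi> by (auto simp: Delta_def M_SO_fiber_def)
  have c: "(\<lambda>t. c) \<in> SO" for c using SO_clamp[OF continuous_on_const, of 1 1 c] by simp
  note \<xi>_cong = hom[unfolded M_SO_def, THEN CollectD, THEN conjunct1, rule_format]
  note \<xi>_add = hom[unfolded M_SO_def, THEN CollectD, THEN conjunct2, THEN conjunct1, rule_format]
  note \<xi>_mult = hom[unfolded M_SO_def, THEN CollectD, THEN conjunct2, THEN conjunct2, THEN conjunct2, THEN conjunct1, rule_format]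
  let ?H = "\<lambda>t. F t * G t + (- 1)"
  have FGs: "(\<lambda>t. F t * G t) \<in> SO" by (rule SO_mult[OF F G])
  have H: "?H \<in> SO" by (rule SO_add[OF FGs c])
  obtain \<eta> where \<eta>: "\<eta> \<in> SO" "\<xi> \<eta> = 0" "\<And>t. p \<le> t \<Longrightarrow> t \<le> q \<Longrightarrow> \<eta> t = 1"
    using Delta_cutoff[OF \<xi> p] by metis
  have "\<xi> ?H = \<xi> (\<lambda>t. ?H t * \<eta> t)"
  proof (rule \<xi>_cong[OF H SO_mult[OF H \<eta>(1)]])
    fix t :: real assume "0 < t"
    then show "?H t = ?H t * \<eta> t" using FG[of t] \<eta>(3)[of t] by (cases "t \<in> {p..q}") auto
  qed
  also have "\<dots> = 0" using \<xi>_mult[OF H \<eta>(1)] \<eta>(2) by simp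
  finally have "\<xi> F * \<xi> G = 1"
    using \<xi>_add[OF FGs c, of "- 1"] \<xi>_mult[OF F G] Delta_const[OF \<xi>, of "- 1"] by simp
  then show ?thesis by (metis mult_zero_left nonzero_mult_div_cancel_left zero_neq_one)
qed

section \<open>The transition functions \<open>p\<^sub>-\<close> and \<open>p\<^sub>+\<close>\<close>

text \<open>
  Only translation is a condition here: norm continuity and slow oscillation are trivial for a symbol
  that does not depend on \<open>t\<close>, and a single function of \<open>V(\<real>)\<close> has small tails.
\<close>

lemma E_tilde_V_constant_symbol:
  assumes f: "f \<in> V_space" and h: "((\<lambda>h. V_norm (\<lambda>x. f x - f (x + h))) \<longlongrightarrow> 0) (at 0)"
  shows "(\<lambda>t. f) \<in> E_tilde_V"
proof -
  have "vanishing_tests (\<lambda>t. f)"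
    unfolding vanishing_tests_def
  proof (intro conjI allI impI ballI)
    show "uniformly_vanishing (at 0) (\<lambda>h. {0<..}) (\<lambda>h t. V_norm (\<lambda>x. f x - f (x + h)))"
      unfolding uniformly_vanishing_def
      by (intro exI[of _ "\<lambda>h. V_norm (\<lambda>x. f x - f (x + h))"] conjI h) auto
    show "uniformly_vanishing at_top (\<lambda>m. {0<..}) (\<lambda>m t. variation_on (UNIV - {- m..m}) f)"
      unfolding uniformly_vanishing_def
      by (intro exI[of _ "\<lambda>m. variation_on (UNIV - {- m..m}) f"] conjI variation_on_tail_tendsto f) auto
  qed (auto intro!: uniformly_vanishing_zero simp: V_const)
  then show ?thesis unfolding E_tilde_V_iff using f by (auto intro!: exI[of _ "V_norm f"])
qed

lemma cosh_add_le: "cosh (a + b) \<le> exp \<bar>b\<bar> * cosh (a::real)"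
proof -
  have "exp (a + b) \<le> exp \<bar>b\<bar> * exp a" "exp (- a - b) \<le> exp \<bar>b\<bar> * exp (- a)"
    unfolding exp_add[symmetric] by (intro exp_le_cancel_iff[THEN iffD2]; linarith)+
  then show ?thesis by (simp add: cosh_def algebra_simps)
qed

text \<open>
  The derivative of \<open>(1 + tanh (\<pi> x)) / 2\<close>.
\<close>

definition tanh_density :: "real \<Rightarrow> real" where
  "tanh_density x = pi / 2 / (cosh (pi * x))\<^sup>2"

lemma tanh_density_pos: "0 < tanh_density x"
  by (simp add: tanh_density_def)

lemma tanh_density_le: "tanh_density x \<le> pi / 2"
  using cosh_real_ge_1[of "pi * x"] by (simp add: tanh_density_def field_simps)

text \<open>
  A Harnack-type inequality: translation changes the density by a factor close to \<open>1\<close>, uniformly in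
  \<open>x\<close>. It replaces continuity of translation in \<open>L\<^sup>1\<close>.
\<close>

lemma tanh_density_shift: "tanh_density (x + h) \<le> exp (2 * pi * \<bar>h\<bar>) * tanh_density x"
proof -
  have "cosh (pi * x) \<le> exp (pi * \<bar>h\<bar>) * cosh (pi * (x + h))"
    using cosh_add_le[of "pi * (x + h)" "- (pi * h)"] by (simp add: algebra_simps abs_mult)
  then have "(cosh (pi * x))\<^sup>2 \<le> (exp (pi * \<bar>h\<bar>) * cosh (pi * (x + h)))\<^sup>2"
    by (intro power_mono) auto
  also have "\<dots> = exp (2 * pi * \<bar>h\<bar>) * (cosh (pi * (x + h)))\<^sup>2"
    by (simp add: power_mult_distrib exp_double[symmetric] mult.assoc)
  finally show ?thesis unfolding tanh_density_def by (simp add: field_simps)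
qed

lemma p_plus_derivative:
  "((\<lambda>x. (1 + tanh (pi * x)) / 2) has_field_derivative tanh_density x) (at x)"
proof -
  have "1 - (tanh (pi * x))\<^sup>2 = 1 / (cosh (pi * x))\<^sup>2"
  proof -
    have nz: "(cosh (pi * x))\<^sup>2 \<noteq> 0" using cosh_real_pos[of "pi * x"] by simp
    have "1 - (tanh (pi * x))\<^sup>2 = ((cosh (pi * x))\<^sup>2 - (sinh (pi * x))\<^sup>2) / (cosh (pi * x))\<^sup>2"
      using nz by (simp add: diff_divide_distrib tanh_def power_divide)
    then show ?thesis by (simp add: cosh_square_eq)
  qed
  then show ?thesis unfolding tanh_density_def by (auto intro!: derivative_eq_intros)
qed

lemma p_plus_vector_derivative: "(p_plus has_vector_derivative of_real (tanh_density x)) (at x)"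
  unfolding p_plus_def[abs_def] by (rule has_vector_derivative_of_real[OF p_plus_derivative])

lemma p_plus_Lipschitz: "norm (p_plus y - p_plus x) \<le> pi / 2 * \<bar>y - x\<bar>"
proof -
  have "norm ((1 + tanh (pi * y)) / 2 - (1 + tanh (pi * x)) / 2) \<le> pi / 2 * norm (y - x)"
    using p_plus_derivative tanh_density_le tanh_density_pos
    by (intro field_differentiable_bound[of UNIV _ tanh_density]) (auto simp: abs_of_pos)
  then show ?thesis by (simp only: p_plus_def of_real_diff[symmetric] norm_of_real real_norm_def)
qed

lemma p_plus_limits: "(p_plus \<longlongrightarrow> 1) at_top" "(p_plus \<longlongrightarrow> 0) at_bot"
proof -
  have "filterlim (\<lambda>x. pi * x) at_top at_top" "filterlim (\<lambda>x. pi * x) at_bot at_bot"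
    by (auto intro!: filterlim_tendsto_pos_mult_at_top[OF tendsto_const] filterlim_tendsto_pos_mult_at_bot[OF tendsto_const] filterlim_ident)
  note t = filterlim_compose[OF tanh_real_at_top this(1)] filterlim_compose[OF tanh_real_at_bot this(2)]
  have "((\<lambda>x. complex_of_real ((1 + tanh (pi * x)) / 2)) \<longlongrightarrow> of_real ((1 + 1) / 2)) at_top"
    by (intro tendsto_intros t) auto
  then show "(p_plus \<longlongrightarrow> 1) at_top" unfolding p_plus_def by simp
  have "((\<lambda>x. complex_of_real ((1 + tanh (pi * x)) / 2)) \<longlongrightarrow> of_real ((1 + - 1) / 2)) at_bot"
    by (intro tendsto_intros t) auto
  then show "(p_plus \<longlongrightarrow> 0) at_bot" unfolding p_plus_def by simp
qed

lemma tanh_density_integrable: "integrable lebesgue tanh_density"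
proof -
  have "set_integrable lborel (einterval (- \<infinity>) \<infinity>) tanh_density"
  proof (rule interval_integral_FTC_nonneg(1))
    show "((\<lambda>x. (1 + tanh (pi * x)) / 2) has_field_derivative tanh_density x) (at x)" for x
      by (rule p_plus_derivative)
    show "isCont tanh_density x" for x
      unfolding tanh_density_def by (intro continuous_intros) (simp add: cosh_real_pos less_imp_neq[symmetric])
    show "(((\<lambda>x. (1 + tanh (pi * x)) / 2) \<circ> real_of_ereal) \<longlongrightarrow> 0) (at_right (- \<infinity>))"
      using tendsto_Re[OF p_plus_limits(2)] by (simp add: ereal_tendsto_simps p_plus_def)
    show "(((\<lambda>x. (1 + tanh (pi * x)) / 2) \<circ> real_of_ereal) \<longlongrightarrow> 1) (at_left \<infinity>)"
      using tendsto_Re[OF p_plus_limits(1)] by (simp add: ereal_tendsto_simps p_plus_def)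
  qed (auto simp: tanh_density_pos less_imp_le)
  then have "integrable lborel tanh_density" by (simp add: set_integrable_def)
  then show ?thesis by (simp add: integrable_completion)
qed

lemma p_plus_V: "p_plus \<in> V_space"
proof (rule V_spaceI[where N="{}" and g="\<lambda>x. of_real (tanh_density x)"])
  show "abs_continuous_on UNIV p_plus" by (rule abs_continuous_Lipschitz[OF p_plus_Lipschitz])
  show "integrable lebesgue (\<lambda>x. complex_of_real (tanh_density x))"
    using tanh_density_integrable by simp
qed (auto intro: vector_derivative_at p_plus_vector_derivative)

text \<open>
  The supremum norm of \<open>p\<^sub>+ - p\<^sub>+(\<cdot> + h)\<close> is at most \<open>(\<pi> / 2) |h|\<close> by the Lipschitz bound. Writing
  \<open>E = exp (2 \<pi> |h|)\<close>, the density changes pointwise by at most \<open>E - 1\<close> times itself, because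
  \<open>1 / E \<ge> 2 - E\<close>.
\<close>

lemma p_plus_symbol: "(\<lambda>t. p_plus) \<in> E_tilde_V"
proof (rule E_tilde_V_constant_symbol[OF p_plus_V])
  let ?I = "LINT x|lebesgue. tanh_density x"
  have le: "V_norm (\<lambda>x. p_plus x - p_plus (x + h)) \<le> pi / 2 * \<bar>h\<bar> + (exp (2 * pi * \<bar>h\<bar>) - 1) * ?I" for h
  proof -
    let ?k = "\<lambda>x. p_plus x - p_plus (x + h)" and ?E = "exp (2 * pi * \<bar>h\<bar>)"
    have kV: "?k \<in> V_space" by (intro V_diff p_plus_V V_shift)
    have L: "Linf_norm ?k \<le> pi / 2 * \<bar>h\<bar>"
      by (intro Linf_norm_least kV) (use p_plus_Lipschitz[of x "x + h" for x] in \<open>auto simp: norm_minus_commute\<close>)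
    have Dk: "D ?k x = of_real (tanh_density x - tanh_density (x + h))" for x
    proof (rule vector_derivative_at)
      have "((\<lambda>x. x + h) has_vector_derivative 1) (at x)" by (auto intro!: derivative_eq_intros)
      from vector_diff_chain_at[OF this p_plus_vector_derivative]
      have "((\<lambda>x. p_plus (x + h)) has_vector_derivative of_real (tanh_density (x + h))) (at x)" by (simp add: o_def)
      from has_vector_derivative_diff[OF p_plus_vector_derivative this]
      show "(?k has_vector_derivative of_real (tanh_density x - tanh_density (x + h))) (at x)" by simp
    qed
    have E1: "1 \<le> ?E" by simp
    have bd: "norm (D ?k x) \<le> (?E - 1) * tanh_density x" for x
    proof -
      have 1: "tanh_density (x + h) \<le> ?E * tanh_density x" by (rule tanh_density_shift)
      have "tanh_density x \<le> ?E * tanh_density (x + h)" using tanh_density_shift[of "x + h" "- h"] by simp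
      then have "tanh_density x / ?E \<le> tanh_density (x + h)" by (simp add: field_simps)
      moreover have "(2 - ?E) * tanh_density x \<le> tanh_density x / ?E"
      proof -
        have "0 \<le> (?E - 1)\<^sup>2" by simp
        then have "(2 - ?E) * ?E \<le> 1" by (simp add: power2_eq_square algebra_simps)
        then have "2 - ?E \<le> 1 / ?E" by (simp add: field_simps)
        from mult_right_mono[OF this less_imp_le[OF tanh_density_pos]] show ?thesis by simp
      qed
      ultimately have "(2 - ?E) * tanh_density x \<le> tanh_density (x + h)" by linarith
      with 1 have "\<bar>tanh_density x - tanh_density (x + h)\<bar> \<le> (?E - 1) * tanh_density x"
        by (simp add: abs_le_iff algebra_simps)
      then show ?thesis unfolding Dk by (simp only: norm_of_real)
    qed
    have "V_variation ?k \<le> (LINT x|lebesgue. (?E - 1) * tanh_density x)"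
      unfolding V_variation_def using V_spaceD(2)[OF kV] tanh_density_integrable bd
      by (intro integral_mono) auto
    with L show ?thesis by (simp add: V_norm_def)
  qed
  have "((\<lambda>h. pi / 2 * \<bar>h\<bar> + (exp (2 * pi * \<bar>h\<bar>) - 1) * ?I) \<longlongrightarrow> pi / 2 * \<bar>0\<bar> + (exp (2 * pi * \<bar>0\<bar>) - 1) * ?I) (at 0)"
    by (intro tendsto_intros)
  then have lim: "((\<lambda>h. pi / 2 * \<bar>h\<bar> + (exp (2 * pi * \<bar>h\<bar>) - 1) * ?I) \<longlongrightarrow> 0) (at 0)" by simp
  show "((\<lambda>h. V_norm (\<lambda>x. p_plus x - p_plus (x + h))) \<longlongrightarrow> 0) (at 0)"
    by (rule tendsto_sandwich[OF _ _ tendsto_const lim]; intro always_eventually allI)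
      (intro V_norm_bounds V_diff p_plus_V V_shift le)+
qed


lemma p_minus_symbol: "(\<lambda>t. p_minus) \<in> E_tilde_V"
proof -
  have "(\<lambda>t::real. c) \<in> SO" for c using SO_clamp[OF continuous_on_const, of 1 1 c] by simp
  then have "(\<lambda>t x. 1 + (- 1) * p_plus x) \<in> E_tilde_V"
    by (intro E_tilde_V_add E_tilde_V_mult p_plus_symbol SO_imp_scalar_symbol)
  moreover have "1 + (- 1) * p_plus x = p_minus x" for x by (simp add: p_plus_def p_minus_def field_simps)
  ultimately show ?thesis by simp
qed

lemma p_minus_V: "p_minus \<in> V_space"
  using E_tilde_VD(1)[OF p_minus_symbol, of 1] by simp

lemma ext_infty_p:
  "ext_infty p_plus \<infinity> = 1" "ext_infty p_plus (- \<infinity>) = 0"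
  "ext_infty p_minus \<infinity> = 0" "ext_infty p_minus (- \<infinity>) = 1"
proof -
  show "ext_infty p_plus \<infinity> = 1" "ext_infty p_plus (- \<infinity>) = 0"
    using p_plus_limits by (auto simp: ext_infty_def intro: tendsto_Lim)
  have eq: "1 - p_plus x = p_minus x" for x by (simp add: p_plus_def p_minus_def field_simps)
  have "((\<lambda>x. 1 - p_plus x) \<longlongrightarrow> 1 - 1) at_top" "((\<lambda>x. 1 - p_plus x) \<longlongrightarrow> 1 - 0) at_bot"
    by (intro tendsto_intros p_plus_limits)+
  then show "ext_infty p_minus \<infinity> = 0" "ext_infty p_minus (- \<infinity>) = 1"
    by (auto simp: eq ext_infty_def intro: tendsto_Lim)
qed

section \<open>The regularizing symbol\<close>

text \<open>
  The uniform formula for \<open>\<bb>\<close> exhibits it as an element of the algebra of symbols. The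
  coefficients are continuous functions of \<open>\<kappa>(t)\<close>, hence slowly oscillating.
\<close>

lemma E_tilde_V_regularizer:
  assumes a: "a \<in> E_tilde_V" and r: "1 < r"
    and nz: "\<And>t. t > 0 \<Longrightarrow> ext_infty (a t) (- \<infinity>) \<noteq> 0 \<and> ext_infty (a t) \<infinity> \<noteq> 0"
    and T: "\<And>t x. t \<in> T_set r \<Longrightarrow> a t x \<noteq> 0" "\<And>t x. t \<in> T_set r \<Longrightarrow> norm (1 / a t x) \<le> C"
  shows "(\<lambda>t x. b_symbol a r t (ereal x)) \<in> E_tilde_V"
proof -
  let ?i = "inverse r"
  have "?i < 1" using r by (simp add: field_simps)
  then have i: "0 < ?i" "?i < 1" "?i < r" using r by auto
  define \<kappa> where "\<kappa> t = max ?i (min t r)" for t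
  have min_pos: "0 < min t ?i" if "t > 0" for t using that i by auto
  have Tmin: "min t ?i \<in> T_set r" and Tmax: "max t r \<in> T_set r" if "t > 0" for t
    using that i by (auto simp: T_set_def)
  \<comment> \<open>The factor \<open>2\<close>: all of \<open>[s, 2 s]\<close> must lie to the left of \<open>1 / r\<close>.\<close>
  have near0: "\<forall>\<^sub>F s in at_right 0. s > 0 \<and> 2 * s < ?i"
    using eventually_at_right_real[of 0 "?i / 2"] i by (auto elim!: eventually_mono)
  have am: "(\<lambda>t. a (min t ?i)) \<in> E_tilde_V"
  proof (rule E_tilde_V_reparametrize[OF a])
    fix F :: "real filter" assume F: "F \<in> {at_right 0, at_top}"
    have "\<forall>\<^sub>F s in at_right 0. \<forall>t\<in>{s..2 * s}. min t ?i = t" using near0 by eventually_elim auto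
    moreover have "\<forall>\<^sub>F s in at_top. \<forall>t\<in>{s..2 * s}. \<forall>\<tau>\<in>{s..2 * s}. min t ?i = min \<tau> ?i"
      using eventually_ge_at_top[of ?i] by eventually_elim auto
    ultimately show "(\<forall>\<^sub>F s in F. \<forall>t\<in>{s..2 * s}. min t ?i = t) \<or>
        (\<forall>\<^sub>F s in F. \<forall>t\<in>{s..2 * s}. \<forall>\<tau>\<in>{s..2 * s}. min t ?i = min \<tau> ?i)" using F by blast
  next
    show "continuous_on {0<..} (\<lambda>t. min t ?i)" by (intro continuous_intros)
  qed (rule min_pos)
  have ax: "(\<lambda>t. a (max t r)) \<in> E_tilde_V"
  proof (rule E_tilde_V_reparametrize[OF a])
    fix F :: "real filter" assume F: "F \<in> {at_right 0, at_top}"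
    have "\<forall>\<^sub>F s in at_right 0. \<forall>t\<in>{s..2 * s}. \<forall>\<tau>\<in>{s..2 * s}. max t r = max \<tau> r"
      using near0 by eventually_elim (use i in auto)
    moreover have "\<forall>\<^sub>F s in at_top. \<forall>t\<in>{s..2 * s}. max t r = t"
      using eventually_ge_at_top[of r] by eventually_elim auto
    ultimately show "(\<forall>\<^sub>F s in F. \<forall>t\<in>{s..2 * s}. max t r = t) \<or>
        (\<forall>\<^sub>F s in F. \<forall>t\<in>{s..2 * s}. \<forall>\<tau>\<in>{s..2 * s}. max t r = max \<tau> r)" using F by blast
  qed (use r in \<open>auto intro!: continuous_intros\<close>)
  have ui: "(\<lambda>t x. 1 / a (min t ?i) x) \<in> E_tilde_V" "(\<lambda>t x. 1 / a (max t r) x) \<in> E_tilde_V"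
    by (rule E_tilde_V_inverse[OF am, of C] E_tilde_V_inverse[OF ax, of C]; intro T Tmin Tmax; assumption)+
  have sub: "{?i..r} \<subseteq> {0<..}" using i(1) by (meson atLeastAtMost_iff greaterThan_iff less_le_trans subsetI)
  then have "\<forall>t\<in>{?i..r}. 0 < t" by blast
  then have lnc: "continuous_on {?i..r} ln" by (intro continuous_intros) auto
  have ell_cont: "continuous_on {?i..r} (\<lambda>t. complex_of_real (ell_minus r t))"
      "continuous_on {?i..r} (\<lambda>t. complex_of_real (ell_plus r t))"
    unfolding ell_minus_def ell_plus_def divide_inverse by (intro continuous_intros lnc)+
  have ell: "(\<lambda>t. complex_of_real (ell_minus r (\<kappa> t))) \<in> SO" "(\<lambda>t. complex_of_real (ell_plus r (\<kappa> t))) \<in> SO"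
    unfolding \<kappa>_def by (rule SO_clamp[OF ell_cont(1) i(1)] SO_clamp[OF ell_cont(2) i(1)], use i(3) in simp)+
  have c: "(\<lambda>t. c_coeff a r x (\<kappa> t)) \<in> SO" if "x = \<infinity> \<or> x = - \<infinity>" for x
    unfolding \<kappa>_def
  proof (rule SO_clamp)
    have "continuous_on {0<..} (\<lambda>t. ext_infty (a t) x)" using SO_ext_infty[OF a, of x] by (simp add: SO_def)
    then have "continuous_on {?i..r} (\<lambda>t. ext_infty (a t) x)" by (rule continuous_on_subset[OF _ sub])
    moreover have "\<forall>t\<in>{?i..r}. ext_infty (a t) x \<noteq> 0" using nz that sub by auto
    ultimately show "continuous_on {?i..r} (c_coeff a r x)"
      unfolding c_coeff_def[abs_def] divide_inverse by (intro continuous_intros ell_cont) auto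
  qed (use i r in auto)
  have "(\<lambda>t x. complex_of_real (ell_minus r (\<kappa> t)) * (1 / a (min t ?i) x)
      + complex_of_real (ell_plus r (\<kappa> t)) * (1 / a (max t r) x)
      + c_coeff a r (- \<infinity>) (\<kappa> t) * p_minus x + c_coeff a r \<infinity> (\<kappa> t) * p_plus x) \<in> E_tilde_V"
    by (intro E_tilde_V_add E_tilde_V_mult SO_imp_scalar_symbol ell c ui p_minus_symbol p_plus_symbol disjI1 disjI2 refl)
  then show ?thesis
  proof (rule E_tilde_V_congI)
    fix t :: real assume t: "t > 0"
    have lr: "ln r > 0" using r by simp
    have ends: "ell_minus r ?i = 1" "ell_plus r ?i = 0" "ell_minus r r = 0" "ell_plus r r = 1"
      using lr r by (auto simp: ell_minus_def ell_plus_def ln_inverse)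
    have c0: "c_coeff a r x ?i = 0" "c_coeff a r x r = 0" for x by (simp_all add: c_coeff_def ends)
    consider "t < ?i" | "?i \<le> t" "t \<le> r" | "r < t" by linarith
    then show "(\<lambda>x. complex_of_real (ell_minus r (\<kappa> t)) * (1 / a (min t ?i) x)
      + complex_of_real (ell_plus r (\<kappa> t)) * (1 / a (max t r) x)
      + c_coeff a r (- \<infinity>) (\<kappa> t) * p_minus x + c_coeff a r \<infinity> (\<kappa> t) * p_plus x)
      = (\<lambda>x. b_symbol a r t (ereal x))"
    proof cases
      case 1
      then have "\<kappa> t = ?i" "min t ?i = t" "max t r = r" using i by (auto simp: \<kappa>_def)
      then show ?thesis using 1 by (simp add: b_symbol_def ends c0)
    next
      case 2
      then have "\<kappa> t = t" "min t ?i = ?i" "max t r = r" using i by (auto simp: \<kappa>_def)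
      then show ?thesis using 2 by (simp add: b_symbol_def)
    next
      case 3
      then have "\<kappa> t = r" "min t ?i = ?i" "max t r = t" using i by (auto simp: \<kappa>_def)
      then show ?thesis using 3 by (simp add: b_symbol_def ends c0)
    qed
  qed
qed

text \<open>
  The formula for \<open>\<bb>(t, x)\<close> commutes with the limits \<open>x \<longlongrightarrow> \<plusminus>\<infinity>\<close> since the denominators have
  nonzero limits.
\<close>

lemma ext_infty_regularizer:
  assumes a: "a \<in> E_tilde_V" and r: "1 < r" and t: "0 < t"
    and T: "\<And>t x. t \<in> T_set r \<Longrightarrow> ext_infty (a t) x \<noteq> 0"
  shows "ext_infty (\<lambda>y. b_symbol a r t (ereal y)) x = b_symbol a r t x"
proof -
  have i: "0 < inverse r" "inverse r \<in> T_set r" "r \<in> T_set r" using r by (auto simp: T_set_def)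
  note lim = V_tendsto_ext_infty[OF E_tilde_VD(1)[OF a]] V_tendsto_ext_infty[OF p_minus_V] V_tendsto_ext_infty[OF p_plus_V]
  show ?thesis
  proof (cases "t \<in> {inverse r..r}")
    case True
    then have "(\<lambda>y. b_symbol a r t (ereal y)) = (\<lambda>y. of_real (ell_minus r t) / a (inverse r) y
        + of_real (ell_plus r t) / a r y
        + c_coeff a r (- \<infinity>) t * p_minus y + c_coeff a r \<infinity> t * p_plus y)"
      by (simp add: b_symbol_def)
    moreover have "b_symbol a r t x = of_real (ell_minus r t) / ext_infty (a (inverse r)) x
        + of_real (ell_plus r t) / ext_infty (a r) x
        + c_coeff a r (-\<infinity>) t * ext_infty p_minus x + c_coeff a r \<infinity> t * ext_infty p_plus x"
      using True by (simp add: b_symbol_def)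
    moreover have "ext_infty (\<lambda>y. of_real (ell_minus r t) / a (inverse r) y
        + of_real (ell_plus r t) / a r y
        + c_coeff a r (- \<infinity>) t * p_minus y + c_coeff a r \<infinity> t * p_plus y) x
      = of_real (ell_minus r t) / ext_infty (a (inverse r)) x
        + of_real (ell_plus r t) / ext_infty (a r) x
        + c_coeff a r (-\<infinity>) t * ext_infty p_minus x + c_coeff a r \<infinity> t * ext_infty p_plus x"
      by (intro ext_infty_eqI tendsto_intros lim T i) (use r in auto)
    ultimately show ?thesis by simp
  next
    case False
    then have "t \<in> T_set r" using t by (auto simp: T_set_def)
    then have "ext_infty (\<lambda>y. 1 / a t y) x = 1 / ext_infty (a t) x"
      by (intro ext_infty_eqI tendsto_intros lim T t)
    with False show ?thesis by (auto simp: b_symbol_def)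
  qed
qed

theorem lemma5p6:
  fixes a :: "real \<Rightarrow> real \<Rightarrow> complex" and r :: real
  assumes "a \<in> E_tilde_V"
    and "\<And>t. t > 0 \<Longrightarrow> ext_infty (a t) (-\<infinity>) \<noteq> 0 \<and> ext_infty (a t) \<infinity> \<noteq> 0"
    and "\<And>\<xi> (x::ereal). \<xi> \<in> Delta \<Longrightarrow> \<xi> (\<lambda>t. ext_infty (a t) x) \<noteq> 0"
    and "r > 1"
    and "\<And>t (x::ereal). t \<in> T_set r \<Longrightarrow> ext_infty (a t) x \<noteq> 0"
    and "bdd_above ((\<lambda>(t, x::ereal). norm (1 / ext_infty (a t) x)) ` (T_set r \<times> UNIV))"
  shows "(\<lambda>t x. b_symbol a r t (ereal x)) \<in> E_tilde_V
    \<and> (\<forall>t>0. \<forall>x::ereal. ext_infty (\<lambda>y. b_symbol a r t (ereal y)) x = b_symbol a r t x)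
    \<and> (\<forall>t>0. b_symbol a r t (-\<infinity>) = 1 / ext_infty (a t) (-\<infinity>)
            \<and> b_symbol a r t \<infinity> = 1 / ext_infty (a t) \<infinity>)
    \<and> (\<forall>\<xi>\<in>Delta. \<forall>x::ereal.
         \<xi> (\<lambda>t. b_symbol a r t x) = 1 / \<xi> (\<lambda>t. ext_infty (a t) x))"
proof -
  obtain C where C: "norm (1 / ext_infty (a t) x) \<le> C" if "t \<in> T_set r" for t x
    using assms(6) unfolding bdd_above_def by auto
  have b: "(\<lambda>t x. b_symbol a r t (ereal x)) \<in> E_tilde_V"
  proof (rule E_tilde_V_regularizer[OF assms(1,4,2)])
    show "a t x \<noteq> 0" "norm (1 / a t x) \<le> C" if "t \<in> T_set r" for t x
      using assms(5)[OF that, of "ereal x"] C[OF that, of "ereal x"] by auto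
  qed
  have ext: "ext_infty (\<lambda>y. b_symbol a r t (ereal y)) x = b_symbol a r t x" if "t > 0" for t x
    by (rule ext_infty_regularizer[OF assms(1,4) that assms(5)])
  have vals: "b_symbol a r t (-\<infinity>) = 1 / ext_infty (a t) (-\<infinity>)" "b_symbol a r t \<infinity> = 1 / ext_infty (a t) \<infinity>" for t
    unfolding b_symbol_def ext_infty_p c_coeff_def by simp_all
  have "\<xi> (\<lambda>t. b_symbol a r t x) = 1 / \<xi> (\<lambda>t. ext_infty (a t) x)" if \<xi>: "\<xi> \<in> Delta" for \<xi> x
  proof (rule Delta_reciprocal[OF \<xi> SO_ext_infty[OF assms(1)]])
    show "(\<lambda>t. b_symbol a r t x) \<in> SO"
      by (rule SO_cong[OF SO_ext_infty[OF b, of x] ext])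
    show "0 < inverse r" "inverse r \<le> r"
      using assms(4) order_trans[of "inverse r" 1 r] by (auto simp: field_simps)
    show "ext_infty (a t) x * b_symbol a r t x = 1" if "t > 0" "t \<notin> {inverse r..r}" for t
    proof -
      have "t \<in> T_set r" using that by (auto simp: T_set_def)
      from assms(5)[OF this, of x] that(2) show ?thesis
        by (auto simp: b_symbol_def)
    qed
  qed
  with b ext vals show ?thesis by blast
qed

end
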